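(* Let $(M^m,g)$ be a Riemannian manifold, let $\varphi: M^m\to S^n$ be a biharmonic map with constant energy density (i.e. $|d\varphi|^2$ is constant on $M$), and let $\phi=i\circ\varphi: M\to\mathbb{R}^{n+1}$, where $i: S^n\to\mathbb{R}^{n+1}$ is the standard isometric embedding. If $\Delta^2\phi=\lambda\,\phi$ for some function $\lambda$ on $M$, then $\varphi$ is harmonic.
   Context: Everything is smooth. $S^n\subset\mathbb{R}^{n+1}$ is the unit sphere centered at the origin with its standard metric. $\Delta f=\mathrm{div}(\nabla f)$ is the Laplace operator of $(M,g)$ acting on functions; it is applied componentwise to $\mathbb{R}^{n+1}$-valued maps, and $\Delta^2\phi=\Delta(\Delta\phi)$. The quantity $|d\varphi|^2=\mathrm{Tr}_g\,\varphi^*h$ ($h$ the metric of the target) is the squared norm of the differential. For a map $\varphi:(M,g)\to(N,h)$ between Riemannian manifolds, $\tau(\varphi)=\mathrm{Tr}_g\nabla d\varphi$ is its tension field; $\varphi$ is harmonic if $\tau(\varphi)=0$. The map $\varphi$ is biharmonic if it is a critical point of the bienergy $E_2(\varphi)=\frac12\int_M|\tau(\varphi)|^2\,dv_g$ (with respect to compactly supported variations); equivalently, $\mathrm{Tr}_g\big(\nabla^{\varphi}\nabla^{\varphi}-\nabla^{\varphi}_{\nabla^M}\big)\tau(\varphi)-\mathrm{Tr}_g R^N(d\varphi,\tau(\varphi))d\varphi=0$, with the curvature convention $R^N(X,Y)=[\nabla_X,\nabla_Y]-\nabla_{[X,Y]}$. *)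

theory Defs
  imports "HOL-Analysis.Analysis"
begin

section \<open>Smooth maps on open subsets of Euclidean spaces\<close>

primrec Ck_on :: "nat \<Rightarrow> ('a::euclidean_space \<Rightarrow> 'b::real_normed_vector) \<Rightarrow> 'a set \<Rightarrow> bool" where
  "Ck_on 0 f S \<longleftrightarrow> continuous_on S f"
| "Ck_on (Suc k) f S \<longleftrightarrow>
     (\<forall>x\<in>S. f differentiable (at x)) \<and> (\<forall>v. Ck_on k (\<lambda>x. frechet_derivative f (at x) v) S)"

text \<open>Meant for open \<^term>\<open>S\<close> only, since the derivatives are two-sided.\<close>
definition smooth_on :: "('a::euclidean_space \<Rightarrow> 'b::real_normed_vector) \<Rightarrow> 'a set \<Rightarrow> bool" where
  "smooth_on f S \<longleftrightarrow> (\<forall>k. Ck_on k f S)"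

section \<open>Smooth manifolds and Riemannian metrics\<close>

text \<open>The point set of the manifold is a whole type \<^typ>\<open>'a\<close> (Hausdorff and second countable,
  by type class); its dimension is the cardinality of the index type \<^typ>\<open>'m\<close>.
  A chart is a pair of its domain and its coordinate map; the values of the coordinate map
  outside the domain are irrelevant.\<close>

type_synonym ('a, 'm) chart = "'a set \<times> ('a \<Rightarrow> real ^ 'm)"

definition chart_inv :: "('a, 'm) chart \<Rightarrow> real ^ 'm \<Rightarrow> 'a" where
  "chart_inv c = inv_into (fst c) (snd c)"

definition smooth_atlas ::
  "('a::{t2_space, second_countable_topology}, 'm::finite) chart set \<Rightarrow> bool" where
  "smooth_atlas \<A> \<longleftrightarrow>
     (\<Union>c\<in>\<A>. fst c) = UNIV \<and>
     (\<forall>(U, x)\<in>\<A>. open U \<and> open (x ` U) \<and> homeomorphism U (x ` U) x (chart_inv (U, x))) \<and>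
     (\<forall>(U, x)\<in>\<A>. \<forall>(V, y)\<in>\<A>. smooth_on (y \<circ> chart_inv (U, x)) (x ` (U \<inter> V)))"

text \<open>A metric is given by its component matrices: \<open>g c p $ i $ j\<close> is the inner product of the
  i-th and the j-th coordinate vector field of the chart \<open>c\<close> at the point \<open>p\<close>. The last
  condition is the transformation law of a covariant 2-tensor; \<open>J\<close> is the differential
  of the coordinate change.\<close>

type_synonym ('a, 'm) metric = "('a, 'm) chart \<Rightarrow> 'a \<Rightarrow> real ^ 'm ^ 'm"

definition riemannian_manifold ::
  "('a::{t2_space, second_countable_topology}, 'm::finite) chart set \<Rightarrow> ('a, 'm) metric \<Rightarrow> bool"
where
  "riemannian_manifold \<A> g \<longleftrightarrow>
     smooth_atlas \<A> \<and>
     (\<forall>c\<in>\<A>. smooth_on (g c \<circ> chart_inv c) (snd c ` fst c)) \<and>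
     (\<forall>c\<in>\<A>. \<forall>p\<in>fst c. transpose (g c p) = g c p \<and> (\<forall>v. v \<noteq> 0 \<longrightarrow> v \<bullet> (g c p *v v) > 0)) \<and>
     (\<forall>c\<in>\<A>. \<forall>d\<in>\<A>. \<forall>p\<in>fst c \<inter> fst d. \<forall>v w.
        (let J = frechet_derivative (snd d \<circ> chart_inv c) (at (snd c p))
         in v \<bullet> (g c p *v w) = J v \<bullet> (g d p *v J w)))"

definition chart_at :: "('a, 'm) chart set \<Rightarrow> 'a \<Rightarrow> ('a, 'm) chart" where
  "chart_at \<A> p = (SOME c. c \<in> \<A> \<and> p \<in> fst c)"

definition smooth_map ::
  "('a, 'm::finite) chart set \<Rightarrow> ('a \<Rightarrow> 'b::real_normed_vector) \<Rightarrow> bool" where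
  "smooth_map \<A> f \<longleftrightarrow> (\<forall>c\<in>\<A>. smooth_on (f \<circ> chart_inv c) (snd c ` fst c))"

section \<open>Local expressions in a chart\<close>

text \<open>The i-th coordinate vector field of the chart, applied to a function on the manifold.\<close>
definition pd ::
  "('a, 'm::finite) chart \<Rightarrow> 'm \<Rightarrow> ('a \<Rightarrow> 'b::real_normed_vector) \<Rightarrow> 'a \<Rightarrow> 'b" where
  "pd c i f p = frechet_derivative (f \<circ> chart_inv c) (at (snd c p)) (axis i 1)"

definition ginv :: "('a, 'm::finite) metric \<Rightarrow> ('a, 'm) chart \<Rightarrow> 'm \<Rightarrow> 'm \<Rightarrow> 'a \<Rightarrow> real" where
  "ginv g c i j p = matrix_inv (g c p) $ i $ j"

text \<open>\<open>christoffel g c k i j\<close> is the Christoffel symbol with upper index \<open>k\<close> and lower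
  indices \<open>i\<close>, \<open>j\<close> of the Levi-Civita connection of \<open>g\<close>.\<close>
definition christoffel ::
  "('a, 'm::finite) metric \<Rightarrow> ('a, 'm) chart \<Rightarrow> 'm \<Rightarrow> 'm \<Rightarrow> 'm \<Rightarrow> 'a \<Rightarrow> real" where
  "christoffel g c k i j p =
     (\<Sum>l\<in>UNIV. ginv g c k l p *
        (pd c i (\<lambda>q. g c q $ j $ l) p + pd c j (\<lambda>q. g c q $ i $ l) p
          - pd c l (\<lambda>q. g c q $ i $ j) p)) / 2"

definition gradient_in ::
  "('a, 'm::finite) metric \<Rightarrow> ('a, 'm) chart \<Rightarrow> ('a \<Rightarrow> real) \<Rightarrow> 'm \<Rightarrow> 'a \<Rightarrow> real" where
  "gradient_in g c f i p = (\<Sum>j\<in>UNIV. ginv g c i j p * pd c j f p)"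

text \<open>The divergence is the trace of the covariant derivative; \<open>X i\<close> is the i-th component of
  the vector field in the chart.\<close>
definition divergence_in ::
  "('a, 'm::finite) metric \<Rightarrow> ('a, 'm) chart \<Rightarrow> ('m \<Rightarrow> 'a \<Rightarrow> real) \<Rightarrow> 'a \<Rightarrow> real" where
  "divergence_in g c X p =
     (\<Sum>i\<in>UNIV. pd c i (X i) p + (\<Sum>j\<in>UNIV. christoffel g c i i j p * X j p))"

text \<open>For maps into the unit sphere: the Levi-Civita connection of the sphere is the tangential
  part of the flat connection, so the pull-back connection differentiates a vector field along
  \<open>\<phi>\<close> in the ambient space and projects onto the tangent space of the sphere.\<close>

definition sphere_proj :: "real ^ 'k \<Rightarrow> real ^ 'k \<Rightarrow> real ^ 'k" where
  "sphere_proj y v = v - (v \<bullet> y) *\<^sub>R y"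

definition pullback_deriv_in ::
  "('a, 'm::finite) chart \<Rightarrow> ('a \<Rightarrow> real ^ 'k) \<Rightarrow> 'm \<Rightarrow> ('a \<Rightarrow> real ^ 'k) \<Rightarrow> 'a \<Rightarrow> real ^ 'k" where
  "pullback_deriv_in c \<phi> i V p = sphere_proj (\<phi> p) (pd c i V p)"

text \<open>Components of \<open>\<nabla>d\<phi>\<close>, where
  \<open>(\<nabla>d\<phi>)(X,Y) = \<nabla>\<^sup>\<phi>\<^sub>X(d\<phi>(Y)) - d\<phi>(\<nabla>\<^sub>XY)\<close>.\<close>
definition second_fundamental_form_in ::
  "('a, 'm::finite) metric \<Rightarrow> ('a, 'm) chart \<Rightarrow> ('a \<Rightarrow> real ^ 'k) \<Rightarrow> 'm \<Rightarrow> 'm \<Rightarrow> 'a \<Rightarrow> real ^ 'k"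
where
  "second_fundamental_form_in g c \<phi> i j p =
     pullback_deriv_in c \<phi> i (pd c j \<phi>) p - (\<Sum>k\<in>UNIV. christoffel g c k i j p *\<^sub>R pd c k \<phi> p)"

definition tension_in ::
  "('a, 'm::finite) metric \<Rightarrow> ('a, 'm) chart \<Rightarrow> ('a \<Rightarrow> real ^ 'k) \<Rightarrow> 'a \<Rightarrow> real ^ 'k" where
  "tension_in g c \<phi> p =
     (\<Sum>i\<in>UNIV. \<Sum>j\<in>UNIV. ginv g c i j p *\<^sub>R second_fundamental_form_in g c \<phi> i j p)"

text \<open>The trace of the pull-back of the metric of the target.\<close>
definition energy_density_in ::
  "('a, 'm::finite) metric \<Rightarrow> ('a, 'm) chart \<Rightarrow> ('a \<Rightarrow> real ^ 'k) \<Rightarrow> 'a \<Rightarrow> real" where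
  "energy_density_in g c \<phi> p =
     (\<Sum>i\<in>UNIV. \<Sum>j\<in>UNIV. ginv g c i j p * (pd c i \<phi> p \<bullet> pd c j \<phi> p))"

section \<open>Global objects\<close>

text \<open>The value at \<open>p\<close> is computed in an arbitrary chart around \<open>p\<close>; on a Riemannian manifold
  and for smooth maps it does not depend on that chart.\<close>

definition laplacian ::
  "('a, 'm::finite) chart set \<Rightarrow> ('a, 'm) metric \<Rightarrow> ('a \<Rightarrow> real) \<Rightarrow> 'a \<Rightarrow> real" where
  "laplacian \<A> g f p =
     (let c = chart_at \<A> p in divergence_in g c (gradient_in g c f) p)"

definition vec_laplacian ::
  "('a, 'm::finite) chart set \<Rightarrow> ('a, 'm) metric \<Rightarrow> ('a \<Rightarrow> real ^ 'k) \<Rightarrow> 'a \<Rightarrow> real ^ 'k" where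
  "vec_laplacian \<A> g f p = (\<chi> a. laplacian \<A> g (\<lambda>q. f q $ a) p)"

definition tension_field ::
  "('a, 'm::finite) chart set \<Rightarrow> ('a, 'm) metric \<Rightarrow> ('a \<Rightarrow> real ^ 'k) \<Rightarrow> 'a \<Rightarrow> real ^ 'k" where
  "tension_field \<A> g \<phi> p = tension_in g (chart_at \<A> p) \<phi> p"

definition energy_density ::
  "('a, 'm::finite) chart set \<Rightarrow> ('a, 'm) metric \<Rightarrow> ('a \<Rightarrow> real ^ 'k) \<Rightarrow> 'a \<Rightarrow> real" where
  "energy_density \<A> g \<phi> p = energy_density_in g (chart_at \<A> p) \<phi> p"

text \<open>The unique Borel measure that has density \<open>sqrt (det g)\<close> with respect to the Lebesgue
  measure in each chart.\<close>

definition is_volume_measure ::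
  "('a::{t2_space, second_countable_topology}, 'm::finite) chart set \<Rightarrow> ('a, 'm) metric
     \<Rightarrow> 'a measure \<Rightarrow> bool" where
  "is_volume_measure \<A> g \<mu> \<longleftrightarrow>
     sets \<mu> = sets borel \<and>
     (\<forall>c\<in>\<A>. \<forall>B\<in>sets borel. B \<subseteq> fst c \<longrightarrow>
        emeasure \<mu> B =
          (\<integral>\<^sup>+ y. ennreal (sqrt (det (g c (chart_inv c y)))) * indicator (snd c ` B) y \<partial>lborel))"

definition volume_measure ::
  "('a::{t2_space, second_countable_topology}, 'm::finite) chart set \<Rightarrow> ('a, 'm) metric
     \<Rightarrow> 'a measure" where
  "volume_measure \<A> g = (SOME \<mu>. is_volume_measure \<A> g \<mu>)"

section \<open>Harmonic and biharmonic maps into the unit sphere\<close>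

text \<open>The sphere is the unit sphere of \<^typ>\<open>real ^ 'k\<close>, so its dimension is
  \<open>CARD('k) - 1\<close>. A map into the sphere is identified with its composition with the inclusion;
  it is smooth as a map into the sphere iff this composition is smooth, because the sphere is an
  embedded submanifold.\<close>

definition smooth_sphere_map ::
  "('a, 'm::finite) chart set \<Rightarrow> ('a \<Rightarrow> real ^ 'k) \<Rightarrow> bool" where
  "smooth_sphere_map \<A> \<phi> \<longleftrightarrow> smooth_map \<A> \<phi> \<and> range \<phi> \<subseteq> sphere 0 1"

definition harmonic ::
  "('a, 'm::finite) chart set \<Rightarrow> ('a, 'm) metric \<Rightarrow> ('a \<Rightarrow> real ^ 'k) \<Rightarrow> bool" where
  "harmonic \<A> g \<phi> \<longleftrightarrow> smooth_sphere_map \<A> \<phi> \<and> (\<forall>p. tension_field \<A> g \<phi> p = 0)"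

text \<open>On a noncompact manifold the bienergy may be infinite. As usual it is therefore taken over a
  compact set outside which the variation is constant; which one does not matter, since
  enlarging it changes the bienergies of all members of the variation by the same constant.\<close>

definition bienergy ::
  "('a::{t2_space, second_countable_topology}, 'm::finite) chart set \<Rightarrow> ('a, 'm) metric
     \<Rightarrow> 'a set \<Rightarrow> ('a \<Rightarrow> real ^ 'k) \<Rightarrow> real" where
  "bienergy \<A> g K \<phi> =
     1 / 2 * (LINT p:K|volume_measure \<A> g. (norm (tension_field \<A> g \<phi> p))\<^sup>2)"

definition compactly_supported_variation ::
  "('a::{t2_space, second_countable_topology}, 'm::finite) chart set \<Rightarrow> ('a \<Rightarrow> real ^ 'k)
     \<Rightarrow> real \<Rightarrow> 'a set \<Rightarrow> (real \<Rightarrow> 'a \<Rightarrow> real ^ 'k) \<Rightarrow> bool" where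
  "compactly_supported_variation \<A> \<phi> \<epsilon> K \<Phi> \<longleftrightarrow>
     compact K \<and>
     (\<forall>c\<in>\<A>. smooth_on (\<lambda>(t, y). \<Phi> t (chart_inv c y)) ({-\<epsilon><..<\<epsilon>} \<times> snd c ` fst c)) \<and>
     (\<forall>t\<in>{-\<epsilon><..<\<epsilon>}. range (\<Phi> t) \<subseteq> sphere 0 1) \<and>
     \<Phi> 0 = \<phi> \<and>
     (\<forall>t\<in>{-\<epsilon><..<\<epsilon>}. \<forall>p. p \<notin> K \<longrightarrow> \<Phi> t p = \<phi> p)"

definition biharmonic ::
  "('a::{t2_space, second_countable_topology}, 'm::finite) chart set \<Rightarrow> ('a, 'm) metric
     \<Rightarrow> ('a \<Rightarrow> real ^ 'k) \<Rightarrow> bool" where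
  "biharmonic \<A> g \<phi> \<longleftrightarrow>
     smooth_sphere_map \<A> \<phi> \<and>
     (\<forall>\<epsilon>>0. \<forall>K \<Phi>. compactly_supported_variation \<A> \<phi> \<epsilon> K \<Phi> \<longrightarrow>
        ((\<lambda>t. bienergy \<A> g K (\<Phi> t)) has_real_derivative 0) (at 0))"

end

(* Write tau for the tension field of phi and e for |d phi|^2. Since |phi| = 1, tau = Delta phi + e phi
   and |tau|^2 = |Delta phi|^2 - e^2, so the first variation of the bienergy in a compactly supported
   tangent direction V is the integral of <Delta V, Delta phi> - 2 e <dV, d phi>. Here e is constant
   and Delta^2 phi = lambda phi is orthogonal to V, so two integrations by parts turn this into 2 e
   times the integral of <V, tau>. Taking V = eta (w - <w, phi> phi), the velocity at t = 0 of
   (phi + t eta w) / |phi + t eta w|, for bump functions eta and constant vectors w gives e tau = 0;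
   and if e = 0, then d phi = 0.

   All integrals live in one chart, whereas the Laplacian and the tension field at p are computed in
   a chart that varies with p; hence the need for the transformation law of the Hessian. *)
theory Submission
  imports Defs
begin

section \<open>Calculus of smooth maps\<close>

text \<open>Only \<open>phi\<close> itself has constant energy density, not the members of its
  variation, so e may be treated as a constant only after differentiating at t = 0: the derivative
  of e^2 is 4 e <dV, d phi>, and this term survives and forces e tau = 0. Writing |tau|^2 as |Delta
  phi|^2 - e^2 avoids differentiating the projection onto the tangent spaces, which moves with t as
  well; the Euler-Lagrange equation with its curvature term never has to be derived. Starting from
  the definition of the bienergy has a price: it is an integral over the volume measure, so such a
  measure must be shown to exist, and an integral over a chart box must be rewritten in coordinates.
  Together with the divergence theorem this makes up most of the work. The direction w - <w, phi>
  phi is the tangential part of a constant vector; as tau is tangential, it pairs with tau as w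
  does, and w can be taken to be tau at the point in question.\<close>

lemma Ck_on_cong:
  assumes "open S" "\<And>x. x \<in> S \<Longrightarrow> f x = g x" "Ck_on k f S"
  shows "Ck_on k g S"
  using assms(2,3)
proof (induction k arbitrary: f g)
  case 0
  then show ?case using continuous_on_cong[OF refl 0(1)] by simp
next
  case (Suc k)
  have d: "g differentiable (at x)" and e: "frechet_derivative f (at x) = frechet_derivative g (at x)"
    if "x \<in> S" for x
  proof -
    have fd: "f differentiable (at x)" using Suc.prems(2) that by simp
    show "frechet_derivative f (at x) = frechet_derivative g (at x)"
      using frechet_derivative_transform_within_open[OF fd assms(1) that, of g] Suc.prems(1) by simp
    have "(f has_derivative frechet_derivative f (at x)) (at x)"
      using fd by (simp add: frechet_derivative_works)
    from has_derivative_transform_within_open[OF this assms(1) that Suc.prems(1)]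
    show "g differentiable (at x)" by (auto simp: differentiable_def)
  qed
  have "Ck_on k (\<lambda>x. frechet_derivative g (at x) v) S" for v
    by (rule Suc.IH[of "\<lambda>x. frechet_derivative f (at x) v"]) (use e Suc.prems(2) in auto)
  with d show ?case by simp
qed

text \<open>\<open>frechet_derivative\<close> is a choice operator; uniqueness of the derivative
  lets any explicit formula \<open>D\<close> take its place, so that \<open>Ck_on\<close> can be
  proved from the ordinary derivative rules.\<close>

lemma Ck_on_SucI:
  assumes "open S" "\<And>x. x \<in> S \<Longrightarrow> (f has_derivative D x) (at x)"
    and "\<And>v. Ck_on k (\<lambda>x. D x v) S"
  shows "Ck_on (Suc k) f S"
proof -
  have "Ck_on k (\<lambda>x. frechet_derivative f (at x) v) S" for v
  proof (rule Ck_on_cong[OF assms(1) _ assms(3)])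
    fix x assume "x \<in> S"
    from frechet_derivative_at[OF assms(2)[OF this]]
    show "D x v = frechet_derivative f (at x) v" by simp
  qed
  then show ?thesis using assms(2) by (auto simp: differentiable_def)
qed

lemma Ck_on_SucD:
  assumes "Ck_on (Suc k) f S" "x \<in> S"
  shows "(f has_derivative frechet_derivative f (at x)) (at x)"
  using assms by (simp add: frechet_derivative_works)

lemma Ck_on_Suc_imp: "Ck_on (Suc k) f S \<Longrightarrow> Ck_on k f S"
proof (induction k arbitrary: f)
  case 0
  have "isCont f x" if "x \<in> S" for x
    using 0 that by (simp add: differentiable_imp_continuous_within)
  then show ?case by (simp add: continuous_at_imp_continuous_on)
next
  case (Suc k)
  have d: "\<forall>x\<in>S. f differentiable (at x)"
    and D: "Ck_on (Suc k) (\<lambda>x. frechet_derivative f (at x) v) S" for v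
    using Suc.prems unfolding Ck_on.simps(2)[of "Suc k"] by (rule conjunct1, rule spec[OF conjunct2])
  show ?case unfolding Ck_on.simps(2)[of k] by (intro conjI allI d Suc.IH D)
qed

lemma Ck_on_subset: "Ck_on k f S \<Longrightarrow> T \<subseteq> S \<Longrightarrow> Ck_on k f T"
proof (induction k arbitrary: f)
  case 0
  then show ?case by (auto intro: continuous_on_subset)
next
  case (Suc k)
  then show ?case by (simp add: subset_eq)
qed

text \<open>Continuity and two-sided differentiability are local. Through
  \<open>smooth_on_local\<close> this serves functions glued from pieces on overlapping open sets,
  such as extensions by zero.\<close>

lemma Ck_on_open_Union:
  assumes "\<And>x. x \<in> S \<Longrightarrow> \<exists>T. open T \<and> x \<in> T \<and> Ck_on k f T"
  shows "Ck_on k f S"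
  using assms
proof (induction k arbitrary: f)
  case 0
  show ?case unfolding Ck_on.simps
  proof (rule continuous_at_imp_continuous_on, rule ballI)
    fix x assume "x \<in> S"
    from 0[OF this] obtain T where "open T" "x \<in> T" "continuous_on T f" by auto
    then show "isCont f x" by (simp add: continuous_on_eq_continuous_at)
  qed
next
  case (Suc k)
  have "Ck_on k (\<lambda>x. frechet_derivative f (at x) v) S" for v
  proof (rule Suc.IH)
    fix x assume "x \<in> S"
    with Suc.prems obtain T where "open T" "x \<in> T" "Ck_on (Suc k) f T" by blast
    then show "\<exists>T. open T \<and> x \<in> T \<and> Ck_on k (\<lambda>x. frechet_derivative f (at x) v) T" by auto
  qed
  moreover have "f differentiable (at x)" if "x \<in> S" for x
    using Suc.prems[OF that] by (elim exE conjE) simp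
  ultimately show ?case by simp
qed

lemma Ck_on_const: "Ck_on k (\<lambda>x. c) S"
proof (induction k arbitrary: c)
  case (Suc k)
  then show ?case by (simp add: frechet_derivative_const)
qed simp

lemma Ck_on_bounded_linear:
  assumes "bounded_linear L" "open S" "Ck_on k f S"
  shows "Ck_on k (\<lambda>x. L (f x)) S"
  using assms(3)
proof (induction k arbitrary: f)
  case 0
  then show ?case using assms(1) by (auto intro: bounded_linear.continuous_on)
next
  case (Suc k)
  show ?case
    by (rule Ck_on_SucI[OF assms(2) bounded_linear.has_derivative[OF assms(1) Ck_on_SucD[OF Suc.prems]]])
      (use Suc in auto)
qed

lemma Ck_on_id:
  assumes "open S" shows "Ck_on k (\<lambda>x. x) S"
proof (cases k)
  case (Suc l)
  show ?thesis unfolding Suc by (rule Ck_on_SucI[OF assms has_derivative_ident Ck_on_const])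
qed simp

lemma Ck_on_add:
  assumes "open S" "Ck_on k f S" "Ck_on k g S"
  shows "Ck_on k (\<lambda>x. f x + g x) S"
  using assms(2,3)
proof (induction k arbitrary: f g)
  case 0
  then show ?case by (auto intro: continuous_on_add)
next
  case (Suc k)
  show ?case
    by (rule Ck_on_SucI[OF assms(1) has_derivative_add[OF Ck_on_SucD[OF Suc.prems(1)] Ck_on_SucD[OF Suc.prems(2)]]])
      (use Suc in auto)
qed

text \<open>By the Leibniz rule the derivative is a sum of two terms of the same bilinear shape,
  each pairing an undifferentiated factor with a derivative. The induction hypothesis therefore
  needs the factors themselves at order k, which is what \<open>Ck_on_Suc_imp\<close> gives.\<close>

lemma Ck_on_bilinear:
  assumes "bounded_bilinear B" "open S" "Ck_on k f S" "Ck_on k g S"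
  shows "Ck_on k (\<lambda>x. B (f x) (g x)) S"
  using assms(3,4)
proof (induction k arbitrary: f g)
  case 0
  then show ?case using assms(1) by (auto intro: bounded_bilinear.continuous_on)
next
  case (Suc k)
  show ?case
    by (rule Ck_on_SucI[OF assms(2) bounded_bilinear.FDERIV[OF assms(1) Ck_on_SucD[OF Suc.prems(1)] Ck_on_SucD[OF Suc.prems(2)]]])
      (use Suc Ck_on_Suc_imp[OF Suc.prems(1)] Ck_on_Suc_imp[OF Suc.prems(2)] in \<open>auto intro!: Ck_on_add assms(2)\<close>)
qed

lemma Ck_on_sum:
  assumes "open S" "\<And>i. i \<in> I \<Longrightarrow> Ck_on k (f i) S"
  shows "Ck_on k (\<lambda>x. \<Sum>i\<in>I. f i x) S"
  using assms(2)
  by (induction I rule: infinite_finite_induct) (auto intro!: Ck_on_const Ck_on_add assms(1))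

lemma Ck_on_compose:
  fixes f :: "'a::euclidean_space \<Rightarrow> 'b::euclidean_space"
  assumes "open S" "f ` S \<subseteq> T" "Ck_on k f S" "Ck_on k g T"
  shows "Ck_on k (\<lambda>x. g (f x)) S"
  using assms(3,4)
proof (induction k arbitrary: g)
  case 0
  then show ?case using assms(2) by (auto intro: continuous_on_compose2)
next
  case (Suc k)
  let ?D = "\<lambda>x v. frechet_derivative g (at (f x)) (frechet_derivative f (at x) v)"
  show ?case
  proof (rule Ck_on_SucI[OF assms(1)])
    fix x assume x: "x \<in> S"
    show "((\<lambda>x. g (f x)) has_derivative ?D x) (at x)"
      by (rule has_derivative_compose[OF Ck_on_SucD[OF Suc.prems(1) x] Ck_on_SucD[OF Suc.prems(2)]])
        (use x assms(2) in auto)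
  next
    fix v
    \<comment> \<open>In the chain rule the direction fed into the derivative of g depends on x,
      whereas \<open>Ck_on\<close> controls derivatives in fixed directions only. Expanding that
      direction in the standard basis separates the two dependences.\<close>
    have "Ck_on k (\<lambda>x. \<Sum>b\<in>Basis. (frechet_derivative f (at x) v \<bullet> b) *\<^sub>R
            frechet_derivative g (at (f x)) b) S"
    proof (intro Ck_on_sum Ck_on_bilinear[OF bounded_bilinear_scaleR] assms(1))
      fix b :: 'b
      show "Ck_on k (\<lambda>x. frechet_derivative f (at x) v \<bullet> b) S"
        using Suc.prems(1) by (auto intro!: Ck_on_bounded_linear[OF bounded_linear_inner_left] assms(1))
      show "Ck_on k (\<lambda>x. frechet_derivative g (at (f x)) b) S"
        by (rule Suc.IH[OF Ck_on_Suc_imp[OF Suc.prems(1)]]) (use Suc.prems(2) in auto)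
    qed
    then show "Ck_on k (\<lambda>x. ?D x v) S"
    proof (rule Ck_on_cong[OF assms(1), rotated])
      fix x assume x: "x \<in> S"
      have "linear (frechet_derivative g (at (f x)))"
        using Ck_on_SucD[OF Suc.prems(2)] x assms(2) by (blast intro: has_derivative_linear)
      then have "(\<Sum>b\<in>Basis. (w \<bullet> b) *\<^sub>R frechet_derivative g (at (f x)) b) =
          frechet_derivative g (at (f x)) (\<Sum>b\<in>Basis. (w \<bullet> b) *\<^sub>R b)" for w
        by (simp add: linear_sum linear_cmul)
      then have "(\<Sum>b\<in>Basis. (w \<bullet> b) *\<^sub>R frechet_derivative g (at (f x)) b) =
          frechet_derivative g (at (f x)) w" for w
        by (simp add: euclidean_representation)
      then show "(\<Sum>b\<in>Basis. (frechet_derivative f (at x) v \<bullet> b) *\<^sub>R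
            frechet_derivative g (at (f x)) b) = ?D x v" .
    qed
  qed
qed

lemma smooth_on_cong:
  "open S \<Longrightarrow> (\<And>x. x \<in> S \<Longrightarrow> f x = g x) \<Longrightarrow> smooth_on f S \<Longrightarrow> smooth_on g S"
  unfolding smooth_on_def by (intro allI, rule Ck_on_cong[of S f g]) simp_all

lemma smooth_on_subset: "smooth_on f S \<Longrightarrow> T \<subseteq> S \<Longrightarrow> smooth_on f T"
  unfolding smooth_on_def by (intro allI, rule Ck_on_subset[of _ f S T]) simp_all

lemma smooth_on_local:
  assumes "\<And>x. x \<in> S \<Longrightarrow> \<exists>T. open T \<and> x \<in> T \<and> smooth_on f T"
  shows "smooth_on f S"
  unfolding smooth_on_def
proof (intro allI Ck_on_open_Union)
  fix k x assume "x \<in> S"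
  from assms[OF this] show "\<exists>T. open T \<and> x \<in> T \<and> Ck_on k f T"
    by (auto simp: smooth_on_def)
qed

lemma smooth_on_imp_Ck: "smooth_on f S \<Longrightarrow> Ck_on k f S"
  by (simp only: smooth_on_def)

lemma smooth_on_continuous: "smooth_on f S \<Longrightarrow> continuous_on S f"
  by (drule smooth_on_imp_Ck[of _ _ 0]) (simp only: Ck_on.simps)

lemma smooth_on_has_derivative:
  "smooth_on f S \<Longrightarrow> x \<in> S \<Longrightarrow> (f has_derivative frechet_derivative f (at x)) (at x)"
  by (rule Ck_on_SucD[OF smooth_on_imp_Ck])

lemma smooth_on_linear_derivative:
  "smooth_on f S \<Longrightarrow> x \<in> S \<Longrightarrow> linear (frechet_derivative f (at x))"
  by (rule has_derivative_linear[OF smooth_on_has_derivative])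

lemma smooth_on_derivative:
  assumes "smooth_on f S"
  shows "smooth_on (\<lambda>x. frechet_derivative f (at x) v) S"
  unfolding smooth_on_def
proof
  fix k
  from smooth_on_imp_Ck[OF assms, of "Suc k"]
  show "Ck_on k (\<lambda>x. frechet_derivative f (at x) v) S" by simp
qed

lemma smooth_on_const: "smooth_on (\<lambda>x. c) S"
  by (simp add: smooth_on_def Ck_on_const)

lemma smooth_on_id: "open S \<Longrightarrow> smooth_on (\<lambda>x. x) S"
  by (simp add: smooth_on_def Ck_on_id)

lemma smooth_on_bounded_linear:
  "bounded_linear L \<Longrightarrow> open S \<Longrightarrow> smooth_on f S \<Longrightarrow> smooth_on (\<lambda>x. L (f x)) S"
  unfolding smooth_on_def by (intro allI, rule Ck_on_bounded_linear) simp_all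

lemma smooth_on_bilinear:
  "bounded_bilinear B \<Longrightarrow> open S \<Longrightarrow> smooth_on f S \<Longrightarrow> smooth_on g S \<Longrightarrow> smooth_on (\<lambda>x. B (f x) (g x)) S"
  unfolding smooth_on_def by (intro allI, rule Ck_on_bilinear) simp_all

lemma smooth_on_add:
  "open S \<Longrightarrow> smooth_on f S \<Longrightarrow> smooth_on g S \<Longrightarrow> smooth_on (\<lambda>x. f x + g x) S"
  unfolding smooth_on_def by (intro allI, rule Ck_on_add) simp_all

lemma smooth_on_sum:
  "open S \<Longrightarrow> (\<And>i. i \<in> I \<Longrightarrow> smooth_on (f i) S) \<Longrightarrow> smooth_on (\<lambda>x. \<Sum>i\<in>I. f i x) S"
  unfolding smooth_on_def by (intro allI, rule Ck_on_sum) simp_all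

lemma smooth_on_compose:
  fixes f :: "'a::euclidean_space \<Rightarrow> 'b::euclidean_space"
  shows "open S \<Longrightarrow> f ` S \<subseteq> T \<Longrightarrow> smooth_on f S \<Longrightarrow> smooth_on g T \<Longrightarrow> smooth_on (\<lambda>x. g (f x)) S"
  unfolding smooth_on_def by (intro allI, rule Ck_on_compose[of S f T]) simp_all

lemmas smooth_on_scaleR = smooth_on_bilinear[OF bounded_bilinear_scaleR]
lemmas smooth_on_mult = smooth_on_bilinear[OF bounded_bilinear_mult]
lemmas smooth_on_inner = smooth_on_bilinear[OF bounded_bilinear_inner]
lemmas smooth_on_nth = smooth_on_bounded_linear[OF bounded_linear_vec_nth]

lemma smooth_on_minus:
  "open S \<Longrightarrow> smooth_on f S \<Longrightarrow> smooth_on (\<lambda>x. - f x) S"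
  by (rule smooth_on_bounded_linear[OF bounded_linear_minus[OF bounded_linear_ident]])

lemma smooth_on_diff:
  "open S \<Longrightarrow> smooth_on f S \<Longrightarrow> smooth_on g S \<Longrightarrow> smooth_on (\<lambda>x. f x - g x) S"
  by (subst diff_conv_add_uminus) (intro smooth_on_add smooth_on_minus)

lemma smooth_on_Pair:
  assumes "open S" "smooth_on f S" "smooth_on g S"
  shows "smooth_on (\<lambda>x. (f x, g x)) S"
proof -
  have "smooth_on (\<lambda>x. (f x, 0) + (0, g x)) S"
    using assms by (intro smooth_on_add smooth_on_bounded_linear[where L = "\<lambda>y. (y, 0)"]
      smooth_on_bounded_linear[where L = "\<lambda>y. (0, y)"])
      (auto intro!: bounded_linear_Pair bounded_linear_ident bounded_linear_zero)
  then show ?thesis by simp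
qed

lemma smooth_on_fst: "open S \<Longrightarrow> smooth_on fst S"
  by (rule smooth_on_bounded_linear[OF bounded_linear_fst _ smooth_on_id])

lemma smooth_on_snd: "open S \<Longrightarrow> smooth_on snd S"
  by (rule smooth_on_bounded_linear[OF bounded_linear_snd _ smooth_on_id])

lemma smooth_on_prod:
  fixes f :: "'i \<Rightarrow> 'a::euclidean_space \<Rightarrow> real"
  assumes "open S" "\<And>i. i \<in> I \<Longrightarrow> smooth_on (f i) S"
  shows "smooth_on (\<lambda>x. \<Prod>i\<in>I. f i x) S"
  using assms(2)
  by (induction I rule: infinite_finite_induct) (auto intro!: smooth_on_const smooth_on_mult assms(1))

text \<open>The induction needs all exponents at once, since a derivative lowers the exponent by
  one. Square roots, reciprocals and the normalisation of vectors all go through this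
  family.\<close>

lemma Ck_on_powr: "Ck_on k (\<lambda>x::real. x powr a) {0<..}"
proof (induction k arbitrary: a)
  case 0
  show ?case by (auto intro!: continuous_intros)
next
  case (Suc k)
  show ?case
  proof (rule Ck_on_SucI[where D = "\<lambda>x h. (a * h) *\<^sub>R x powr (a - 1)"])
    fix x :: real assume "x \<in> {0<..}"
    then show "((\<lambda>x. x powr a) has_derivative (\<lambda>h. (a * h) *\<^sub>R x powr (a - 1))) (at x)"
      using has_real_derivative_powr[of x a] unfolding has_field_derivative_def
      by (auto elim!: has_derivative_eq_rhs simp: fun_eq_iff)
  qed (intro Ck_on_bounded_linear[OF bounded_linear_scaleR_right] Suc open_greaterThan)+
qed

lemma smooth_on_powr:
  fixes f :: "'a::euclidean_space \<Rightarrow> real"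
  assumes "open S" "smooth_on f S" "\<And>x. x \<in> S \<Longrightarrow> f x > 0"
  shows "smooth_on (\<lambda>x. f x powr a) S"
proof (rule smooth_on_compose[OF assms(1) _ assms(2)])
  show "smooth_on (\<lambda>x::real. x powr a) {0<..}" by (simp add: smooth_on_def Ck_on_powr)
qed (use assms(3) in auto)

lemma smooth_on_det:
  assumes "open S" "\<And>i j. smooth_on (\<lambda>x. A x $ i $ j) S"
  shows "smooth_on (\<lambda>x. det (A x :: real ^ 'n ^ 'n)) S"
  unfolding det_def by (intro smooth_on_sum smooth_on_mult smooth_on_const smooth_on_prod assms)

text \<open>\<open>X\<close> and the complement of \<open>C\<close> are two open sets that cover the
  space; f is smooth on the first and zero on the second.\<close>

lemma smooth_on_extend_zero:
  assumes "open X" "closed C" "C \<subseteq> X" "smooth_on f X" "\<And>x. x \<in> X - C \<Longrightarrow> f x = 0"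
    and "\<And>x. x \<notin> X \<Longrightarrow> f x = 0"
  shows "smooth_on f UNIV"
proof (rule smooth_on_local)
  fix x :: 'a
  have "smooth_on f (- C)"
    by (rule smooth_on_cong[OF _ _ smooth_on_const[of 0]]) (use assms in auto)
  then show "\<exists>T. open T \<and> x \<in> T \<and> smooth_on f T"
    using assms(1-4) by (intro exI[of _ "if x \<in> C then X else - C"]) auto
qed

section \<open>Flat functions and bump functions\<close>

text \<open>The building block \<open>x\<^sup>-\<^sup>n exp (- 1 / x)\<close> of bump functions; this family is closed under
  differentiation up to linear combinations.\<close>

definition flat :: "nat \<Rightarrow> real \<Rightarrow> real" where
  "flat n x = (if x \<le> 0 then 0 else inverse x ^ n * exp (- inverse x))"

lemma flat_tendsto: "(flat n \<longlongrightarrow> 0) (at 0)"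
proof -
  \<comment> \<open>Under the substitution x -> 1 / x the limit at 0 from the right becomes the
    decay of \<open>x ^ n / exp x\<close> at infinity.\<close>
  have "((\<lambda>x::real. x ^ n / exp x) \<longlongrightarrow> 0) at_top" by (rule tendsto_power_div_exp_0)
  then have "((\<lambda>x::real. inverse x ^ n / exp (inverse x)) \<longlongrightarrow> 0) (at_right 0)"
    by (rule filterlim_compose) (rule filterlim_inverse_at_top_right)
  then have "(flat n \<longlongrightarrow> 0) (at_right 0)"
    by (rule Lim_transform_eventually)
      (auto simp: flat_def eventually_at_filter exp_minus divide_inverse)
  moreover have "(flat n \<longlongrightarrow> 0) (at_left 0)"
    by (rule Lim_transform_eventually[OF tendsto_const]) (auto simp: flat_def eventually_at_filter)
  ultimately show ?thesis by (simp add: filterlim_at_split)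
qed

lemma flat_deriv: "(flat n has_real_derivative (flat (n + 2) x - n * flat (n + 1) x)) (at x)"
proof -
  consider "x < 0" | "x = 0" | "x > 0" by linarith
  then show ?thesis
  proof cases
    case 1
    have "(flat n has_real_derivative 0) (at x)"
      by (rule has_field_derivative_transform_within_open[OF DERIV_const[of 0], of "{..<0}"])
        (use 1 in \<open>auto simp: flat_def\<close>)
    then show ?thesis using 1 by (simp add: flat_def)
  next
    case 2
    \<comment> \<open>The difference quotient of \<open>flat n\<close> at 0 is
      \<open>flat (Suc n)\<close>, so its limit is again an instance of
      \<open>flat_tendsto\<close>.\<close>
    have "((\<lambda>h. (flat n (0 + h) - flat n 0) / h) \<longlongrightarrow> 0) (at 0)"
      by (rule Lim_transform_eventually[OF flat_tendsto[of "Suc n"]])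
        (auto simp: flat_def eventually_at_filter divide_inverse)
    then show ?thesis using 2 by (simp add: DERIV_def flat_def)
  next
    case 3
    have "((\<lambda>x. inverse x ^ n * exp (- inverse x)) has_real_derivative
        (inverse x ^ (n+2) * exp (- inverse x) - n * (inverse x ^ (n+1) * exp (- inverse x)))) (at x)"
    proof -
      have d: "(inverse has_real_derivative - (inverse x ^ 2)) (at x)"
        using 3 by (auto intro!: derivative_eq_intros simp: power2_eq_square)
      have e: "((\<lambda>x. exp (- inverse x)) has_real_derivative exp (- inverse x) * inverse x ^ 2) (at x)"
        using 3 by (auto intro!: derivative_eq_intros simp: power2_eq_square)
      show ?thesis
        by (rule DERIV_cong[OF DERIV_mult[OF DERIV_power[OF d, of n] e]])
          (cases n; simp add: algebra_simps power2_eq_square)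
    qed
    then have "(flat n has_real_derivative
        (inverse x ^ (n+2) * exp (- inverse x) - n * (inverse x ^ (n+1) * exp (- inverse x)))) (at x)"
      by (rule has_field_derivative_transform_within_open[of _ _ _ "{0<..}"])
        (use 3 in \<open>auto simp: flat_def\<close>)
    then show ?thesis using 3 by (simp add: flat_def)
  qed
qed

lemma smooth_on_flat: "smooth_on (flat n) UNIV"
  unfolding smooth_on_def
proof
  fix k
  show "Ck_on k (flat n) UNIV"
  proof (induction k arbitrary: n)
    case 0
    show ?case using flat_deriv by (auto intro!: continuous_at_imp_continuous_on DERIV_isCont)
  next
    case (Suc k)
    show ?case
    proof (rule Ck_on_SucI[where D = "\<lambda>x h. h *\<^sub>R (flat (n + 2) x + (- real n) *\<^sub>R flat (n + 1) x)"])
      show "(flat n has_derivative (\<lambda>h. h *\<^sub>R (flat (n + 2) x + (- real n) *\<^sub>R flat (n + 1) x))) (at x)" for x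
        using flat_deriv[of n x] unfolding has_field_derivative_def
        by (auto elim!: has_derivative_eq_rhs simp: fun_eq_iff)
    qed (intro open_UNIV Ck_on_bounded_linear[OF bounded_linear_scaleR_right] Ck_on_add Suc)+
  qed
qed

text \<open>The squared distance is used because it is smooth at the centre, where the norm is
  not.\<close>

definition bump :: "'a::euclidean_space \<Rightarrow> real \<Rightarrow> 'a \<Rightarrow> real" where
  "bump y r x = flat 0 (r\<^sup>2 - (x - y) \<bullet> (x - y))"

lemma smooth_on_bump: "smooth_on (bump y r) UNIV"
  unfolding bump_def
  by (rule smooth_on_compose[OF _ _ _ smooth_on_flat, of UNIV])
    (auto intro!: smooth_on_diff smooth_on_inner smooth_on_const smooth_on_id)

lemma bump_nonneg: "bump y r x \<ge> 0"
  by (simp add: bump_def flat_def)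

lemma bump_pos_iff:
  assumes "r > 0"
  shows "bump y r x > 0 \<longleftrightarrow> x \<in> ball y r"
proof -
  have "bump y r x > 0 \<longleftrightarrow> (norm (x - y))\<^sup>2 < r\<^sup>2"
    by (simp add: bump_def flat_def power2_norm_eq_inner)
  also have "\<dots> \<longleftrightarrow> norm (x - y) < r"
    using assms power_strict_mono[of "norm (x - y)" r 2] power_less_imp_less_base[of "norm (x - y)" 2 r] by auto
  finally show ?thesis by (simp add: dist_norm norm_minus_commute)
qed

text \<open>This bound keeps phi + t eta w away from zero for small t, so that the varied map can be
  normalised.\<close>

lemma bump_le_1: "bump y r x \<le> 1"
  by (simp add: bump_def flat_def)


section \<open>Symmetry of second derivatives\<close>

text \<open>Differentiate \<open>f (x + s u + t v) - f (x + t v) = \<integral>\<^sub>0\<^sup>s D\<^sub>u f\<close> first under the integral sign in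
  \<open>t\<close> and then in \<open>s\<close>.\<close>

lemma second_derivative_commute:
  fixes f :: "'a::euclidean_space \<Rightarrow> 'b::euclidean_space"
  assumes "open S" "smooth_on f S" "x \<in> S"
  shows "frechet_derivative (\<lambda>z. frechet_derivative f (at z) v) (at x) u =
         frechet_derivative (\<lambda>z. frechet_derivative f (at z) u) (at x) v"
proof -
  let ?D = "\<lambda>u z. frechet_derivative f (at z) u"
  have smD: "smooth_on (?D u) S" for u by (rule smooth_on_derivative[OF assms(2)])
  obtain \<delta> where \<delta>: "\<delta> > 0" "cball x \<delta> \<subseteq> S" using assms(1,3) open_contains_cball by blast
  \<comment> \<open>With this r the points x + s u + t v with |s|, |t| at most r stay in
    \<open>cball x \<delta>\<close>; the summand 1 keeps the denominator positive when u = v =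
    0.\<close>
  define r where "r = \<delta> / (norm u + norm v + 1)"
  have pos: "norm u + norm v + 1 > 0" by (simp add: add_nonneg_pos)
  have r: "r > 0" using \<delta>(1) pos by (simp add: r_def)
  define c where "c s t = x + s *\<^sub>R u + t *\<^sub>R v" for s t
  have cS: "c s t \<in> S" if "\<bar>s\<bar> \<le> r" "\<bar>t\<bar> \<le> r" for s t
  proof -
    have "norm (s *\<^sub>R u + t *\<^sub>R v) \<le> \<bar>s\<bar> * norm u + \<bar>t\<bar> * norm v"
      using norm_triangle_ineq[of "s *\<^sub>R u" "t *\<^sub>R v"] by simp
    also have "\<dots> \<le> r * norm u + r * norm v" by (intro add_mono mult_right_mono that) auto
    also have "\<dots> \<le> r * (norm u + norm v + 1)" using r by (simp add: algebra_simps)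
    also have "\<dots> = \<delta>" using pos by (simp add: r_def)
    finally have "norm (s *\<^sub>R u + t *\<^sub>R v) \<le> \<delta>" .
    moreover have "x - c s t = - (s *\<^sub>R u + t *\<^sub>R v)" by (simp add: c_def)
    ultimately have "dist x (c s t) \<le> \<delta>" by (simp only: dist_norm norm_minus_cancel)
    with \<delta> show ?thesis by auto
  qed
  have ds: "((\<lambda>s. h (c s t)) has_vector_derivative frechet_derivative h (at (c s t)) u) (at s within A)"
    and dt: "((\<lambda>t. h (c s t)) has_vector_derivative frechet_derivative h (at (c s t)) v) (at t within A)"
    if "smooth_on h S" "\<bar>s\<bar> \<le> r" "\<bar>t\<bar> \<le> r" for h :: "'a \<Rightarrow> 'b" and s t A
  proof -
    note d = smooth_on_has_derivative[OF that(1) cS[OF that(2,3)]]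
    note l = linear_cmul[OF has_derivative_linear[OF d]]
    have "((\<lambda>s. h (c s t)) has_derivative (\<lambda>k. frechet_derivative h (at (c s t)) (k *\<^sub>R u))) (at s within A)"
      by (rule has_derivative_compose[of "\<lambda>s. c s t" _ s A h, OF _ d]) (auto simp: c_def intro!: derivative_eq_intros)
    then show "((\<lambda>s. h (c s t)) has_vector_derivative frechet_derivative h (at (c s t)) u) (at s within A)"
      by (simp add: has_vector_derivative_def l)
    have "((\<lambda>t. h (c s t)) has_derivative (\<lambda>k. frechet_derivative h (at (c s t)) (k *\<^sub>R v))) (at t within A)"
      by (rule has_derivative_compose[of "c s" _ t A h, OF _ d]) (auto simp: c_def[abs_def] intro!: derivative_eq_intros)
    then show "((\<lambda>t. h (c s t)) has_vector_derivative frechet_derivative h (at (c s t)) v) (at t within A)"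
      by (simp add: has_vector_derivative_def l)
  qed
  let ?I = "{-r..r}"
  have cont: "continuous_on (?I \<times> {0..r}) (\<lambda>(t, s). h (c s t))" if "smooth_on h S" for h :: "'a \<Rightarrow> 'b"
    unfolding split_def
    by (rule continuous_on_compose2[OF smooth_on_continuous[OF that]])
      (auto simp: c_def[abs_def] intro!: continuous_intros cS[unfolded c_def])
  have conts: "continuous_on {0..s} (\<lambda>s. h (c s t))" if "smooth_on h S" "s \<le> r" "\<bar>t\<bar> \<le> r" for h :: "'a \<Rightarrow> 'b" and s t
    by (rule continuous_on_compose2[OF smooth_on_continuous[OF that(1)]])
      (use that in \<open>auto simp: c_def[abs_def] intro!: continuous_intros cS[unfolded c_def]\<close>)
  have key: "?D v (c s 0) - ?D v (c 0 0) = integral {0..s} (\<lambda>\<sigma>. frechet_derivative (?D u) (at (c \<sigma> 0)) v)"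
    if s: "0 \<le> s" "s \<le> r" for s
  proof -
    have F: "f (c s t) - f (c 0 t) = integral (cbox 0 s) (\<lambda>\<sigma>. ?D u (c \<sigma> t))" if "t \<in> ?I" for t
    proof (rule integral_unique[symmetric], unfold cbox_interval, rule fundamental_theorem_of_calculus[OF s(1)])
      fix \<sigma> assume "\<sigma> \<in> {0..s}"
      then show "((\<lambda>s. f (c s t)) has_vector_derivative ?D u (c \<sigma> t)) (at \<sigma> within {0..s})"
        using s that by (intro ds assms(2)) auto
    qed
    have "((\<lambda>t. integral (cbox 0 s) (\<lambda>\<sigma>. ?D u (c \<sigma> t))) has_vector_derivative
        integral (cbox 0 s) (\<lambda>\<sigma>. frechet_derivative (?D u) (at (c \<sigma> 0)) v)) (at 0 within ?I)"
    proof (rule leibniz_rule_vector_derivative)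
      fix t \<sigma> assume "t \<in> ?I" "\<sigma> \<in> cbox 0 s"
      then show "((\<lambda>t. ?D u (c \<sigma> t)) has_vector_derivative frechet_derivative (?D u) (at (c \<sigma> t)) v) (at t within ?I)"
        using s by (intro dt smD) auto
    next
      fix t assume "t \<in> ?I"
      then show "(\<lambda>\<sigma>. ?D u (c \<sigma> t)) integrable_on cbox 0 s"
        using s by (intro integrable_continuous) (auto intro!: conts smD)
    next
      show "continuous_on (?I \<times> cbox 0 s) (\<lambda>(t, \<sigma>). frechet_derivative (?D u) (at (c \<sigma> t)) v)"
        by (rule continuous_on_subset[OF cont[OF smooth_on_derivative[OF smD]]]) (use s in auto)
    qed (use r in auto)
    then have "((\<lambda>t. f (c s t) - f (c 0 t)) has_vector_derivative
        integral (cbox 0 s) (\<lambda>\<sigma>. frechet_derivative (?D u) (at (c \<sigma> 0)) v)) (at 0 within ?I)"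
      by (rule has_vector_derivative_transform[rotated 2]) (use F r in auto)
    moreover have "((\<lambda>t. f (c s t) - f (c 0 t)) has_vector_derivative
        (?D v (c s 0) - ?D v (c 0 0))) (at 0 within ?I)"
      using s r by (intro has_vector_derivative_diff dt assms(2)) auto
    ultimately show ?thesis
      using vector_derivative_unique_within_closed_interval[of "-r" r 0] r by auto
  qed
  have "((\<lambda>s. integral {0..s} (\<lambda>\<sigma>. frechet_derivative (?D u) (at (c \<sigma> 0)) v)) has_vector_derivative
      frechet_derivative (?D u) (at (c 0 0)) v) (at 0 within {0..r})"
    using r by (intro integral_has_vector_derivative conts smooth_on_derivative smD) auto
  then have "((\<lambda>s. ?D v (c s 0) - ?D v (c 0 0)) has_vector_derivative
      frechet_derivative (?D u) (at (c 0 0)) v) (at 0 within {0..r})"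
    by (rule has_vector_derivative_transform[rotated 2]) (use key r in auto)
  moreover have "((\<lambda>s. ?D v (c s 0) - ?D v (c 0 0)) has_vector_derivative
      frechet_derivative (?D v) (at (c 0 0)) u - 0) (at 0 within {0..r})"
    using r by (intro has_vector_derivative_diff ds smD) auto
  ultimately have "frechet_derivative (?D v) (at (c 0 0)) u - 0 = frechet_derivative (?D u) (at (c 0 0)) v"
    using vector_derivative_unique_within_closed_interval[of 0 r 0] r by auto
  then show ?thesis by (simp add: c_def)
qed

section \<open>Differentiation of determinants\<close>

lemma matrix_inv_mult:
  fixes A :: "real ^ 'n ^ 'n"
  assumes "invertible A"
  shows "matrix_inv A ** A = mat 1" and "A ** matrix_inv A = mat 1"
proof -
  from assms obtain B where "A ** B = mat 1 \<and> B ** A = mat 1" unfolding invertible_def by blast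
  then have "A ** matrix_inv A = mat 1 \<and> matrix_inv A ** A = mat 1"
    unfolding matrix_inv_def by (rule someI)
  then show "matrix_inv A ** A = mat 1" "A ** matrix_inv A = mat 1" by auto
qed

text \<open>Jacobi's formula. The product rule in the Leibniz expansion gives a sum over i of
  determinants whose i-th row is replaced by that of G'. Since G' = (G' G^-1) G, the new row is a
  combination of the rows of G, and only the multiple of the i-th row contributes: the i-th diagonal
  entry of G' G^-1 times det G.\<close>

lemma has_derivative_det:
  fixes G :: "'a::real_normed_vector \<Rightarrow> real ^ 'n ^ 'n"
  assumes d: "(G has_derivative G') (at x)" and inv: "invertible (G x)"
  shows "((\<lambda>y. det (G y)) has_derivative
    (\<lambda>h. det (G x) * (\<Sum>i\<in>UNIV. \<Sum>k\<in>UNIV. G' h $ i $ k * matrix_inv (G x) $ k $ i))) (at x)"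
proof -
  let ?A = "G x" and ?C = "matrix_inv (G x)" and ?P = "{p. p permutes (UNIV :: 'n set)}"
  have comp: "((\<lambda>y. G y $ i $ j) has_derivative (\<lambda>h. G' h $ i $ j)) (at x)" for i j
    by (intro bounded_linear.has_derivative[OF bounded_linear_vec_nth] d)
  have row_det: "det (\<chi> j. if j = i then row i B else row j ?A) = (\<Sum>k\<in>UNIV. B $ i $ k * ?C $ k $ i) * det ?A"
    for i and B :: "real ^ 'n ^ 'n"
  proof -
    define z where "z = (B ** ?C) $ i"
    have "row i B = row i ((B ** ?C) ** ?A)"
      by (simp add: matrix_mul_assoc[symmetric] matrix_inv_mult[OF inv])
    also have "\<dots> = (\<Sum>k\<in>UNIV. z $ k *s row k ?A)"
      by (simp add: vec_eq_iff row_def z_def matrix_matrix_mult_def[of "B ** ?C"])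
    finally have rB: "row i B = (\<Sum>k\<in>UNIV. z $ k *s row k ?A)" .
    have "det (\<chi> j. if j = i then row i B else row j ?A) = z $ i * det ?A"
      unfolding rB by (simp only: cramer_lemma_transpose)
    then show ?thesis by (simp add: z_def matrix_matrix_mult_def)
  qed
  have row_expand: "det (\<chi> j. if j = i then row i B else row j ?A) =
      (\<Sum>p\<in>?P. of_int (sign p) * (B $ i $ p i * (\<Prod>j\<in>UNIV - {i}. ?A $ j $ p j)))" for i and B :: "real ^ 'n ^ 'n"
    unfolding det_def
  proof (rule sum.cong[OF refl])
    fix p
    have "(\<Prod>j\<in>UNIV. (\<chi> j. if j = i then row i B else row j ?A) $ j $ p j) =
      B $ i $ p i * (\<Prod>j\<in>UNIV - {i}. (\<chi> j. if j = i then row i B else row j ?A) $ j $ p j)"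
      by (subst prod.remove[of UNIV i]) (auto simp: row_def)
    also have "(\<Prod>j\<in>UNIV - {i}. (\<chi> j. if j = i then row i B else row j ?A) $ j $ p j) =
        (\<Prod>j\<in>UNIV - {i}. ?A $ j $ p j)"
      by (rule prod.cong) (auto simp: row_def)
    finally show "of_int (sign p) * (\<Prod>j\<in>UNIV. (\<chi> j. if j = i then row i B else row j ?A) $ j $ p j) =
      of_int (sign p) * (B $ i $ p i * (\<Prod>j\<in>UNIV - {i}. ?A $ j $ p j))" by simp
  qed
  have "((\<lambda>y. det (G y)) has_derivative
      (\<lambda>h. \<Sum>p\<in>?P. of_int (sign p) * (\<Sum>i\<in>UNIV. G' h $ i $ p i * (\<Prod>j\<in>UNIV - {i}. ?A $ j $ p j)))) (at x)"
    unfolding det_def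
    by (rule has_derivative_sum, rule has_derivative_mult_right, rule has_derivative_prod, rule comp)
  moreover have "(\<Sum>p\<in>?P. of_int (sign p) * (\<Sum>i\<in>UNIV. G' h $ i $ p i * (\<Prod>j\<in>UNIV - {i}. ?A $ j $ p j))) =
      det ?A * (\<Sum>i\<in>UNIV. \<Sum>k\<in>UNIV. G' h $ i $ k * ?C $ k $ i)" for h
  proof -
    have "(\<Sum>p\<in>?P. of_int (sign p) * (\<Sum>i\<in>UNIV. G' h $ i $ p i * (\<Prod>j\<in>UNIV - {i}. ?A $ j $ p j))) =
      (\<Sum>i\<in>UNIV. det (\<chi> j. if j = i then row i (G' h) else row j ?A))"
      by (simp only: row_expand sum_distrib_left sum.swap[of _ _ ?P])
    also have "\<dots> = det ?A * (\<Sum>i\<in>UNIV. \<Sum>k\<in>UNIV. G' h $ i $ k * ?C $ k $ i)"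
      unfolding row_det by (simp only: sum_distrib_right[symmetric] mult.commute[of _ "det ?A"] sum_distrib_left[symmetric])
    finally show ?thesis .
  qed
  ultimately show ?thesis by simp
qed

section \<open>Positive definite matrices\<close>

definition pos_def :: "real ^ 'n ^ 'n \<Rightarrow> bool" where
  "pos_def A \<longleftrightarrow> transpose A = A \<and> (\<forall>v. v \<noteq> 0 \<longrightarrow> v \<bullet> (A *v v) > 0)"

lemma pos_def_invertible: "pos_def A \<Longrightarrow> invertible A"
  unfolding pos_def_def invertible_left_inverse matrix_left_invertible_ker
  by (metis inner_zero_right less_irrefl)

text \<open>On the segment from the identity to A every matrix has trivial kernel, so the
  determinant does not vanish there and keeps the sign it has at the identity.\<close>

lemma pos_def_det_pos:
  fixes A :: "real ^ 'n ^ 'n"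
  assumes "pos_def A"
  shows "det A > 0"
proof (rule ccontr)
  assume "\<not> det A > 0"
  define M where "M t = (1 - t) *\<^sub>R mat 1 + t *\<^sub>R A" for t :: real
  have "continuous_on {0..1} (\<lambda>t. det (M t))"
    unfolding det_def M_def
    by (intro continuous_intros)
  moreover have "det (M 0) = 1" "det (M 1) \<le> 0" using \<open>\<not> det A > 0\<close> by (auto simp: M_def)
  ultimately obtain t where t: "0 \<le> t" "t \<le> 1" "det (M t) = 0"
    using IVT2'[of "\<lambda>t. det (M t)" 1 0 0] by auto
  have "invertible (M t)"
    unfolding invertible_left_inverse matrix_left_invertible_ker
  proof (intro allI impI)
    fix v assume v: "M t *v v = 0"
    have "M t *v v = (1 - t) *\<^sub>R v + t *\<^sub>R (A *v v)"
      by (simp add: M_def matrix_vector_mult_add_rdistrib scaleR_matrix_vector_assoc[symmetric])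
    then have 0: "(1 - t) * (v \<bullet> v) + t * (v \<bullet> (A *v v)) = 0"
      using v by (simp flip: inner_add_right inner_scaleR_right)
    show "v = 0"
    proof (rule ccontr)
      assume "v \<noteq> 0"
      then have p: "v \<bullet> v > 0" "v \<bullet> (A *v v) > 0" using assms by (auto simp: pos_def_def)
      have "(1 - t) * (v \<bullet> v) \<ge> 0" "t * (v \<bullet> (A *v v)) \<ge> 0" using p t by auto
      with 0 have "(1 - t) * (v \<bullet> v) = 0" "t * (v \<bullet> (A *v v)) = 0" by linarith+
      with p show False by auto
    qed
  qed
  with t(3) show False by (simp add: invertible_det_nz)
qed

text \<open>Cramer's rule writes an entry of the inverse as a quotient of determinants of smooth
  matrices; the denominator is positive, so its reciprocal is a smooth real power.\<close>

lemma smooth_on_matrix_inv: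
  fixes A :: "'a::euclidean_space \<Rightarrow> real ^ 'n ^ 'n"
  assumes "open S" "smooth_on A S" "\<And>x. x \<in> S \<Longrightarrow> pos_def (A x)"
  shows "smooth_on (\<lambda>x. matrix_inv (A x) $ i $ j) S"
proof -
  let ?d = "\<lambda>x. det (\<chi> a b. if b = i then axis j 1 $ a else A x $ a $ b) * det (A x) powr (-1)"
  have e: "smooth_on (\<lambda>x. A x $ a $ b) S" for a b
    by (intro smooth_on_nth assms)
  have "smooth_on (\<lambda>x. (\<chi> a b. if b = i then axis j 1 $ a else A x $ a $ b) $ a $ b) S" for a b
    by (cases "b = i") (auto intro!: smooth_on_const e)
  then have "smooth_on ?d S"
    by (intro smooth_on_mult smooth_on_powr smooth_on_det pos_def_det_pos assms e)
  then show ?thesis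
  proof (rule smooth_on_cong[OF assms(1), rotated])
    fix x assume x: "x \<in> S"
    have d: "det (A x) > 0" by (intro pos_def_det_pos assms x)
    have "A x *v (matrix_inv (A x) *v axis j 1) = axis j 1"
      by (simp add: matrix_vector_mul_assoc matrix_inv_mult pos_def_invertible assms x)
    then have "matrix_inv (A x) *v axis j 1 =
        (\<chi> k. det (\<chi> i ja. if ja = k then axis j 1 $ i else A x $ i $ ja) / det (A x))"
      using d by (subst (asm) cramer) auto
    then have "(matrix_inv (A x) *v axis j 1) $ i = ?d x"
      using d by (simp add: powr_minus_divide)
    moreover have "(matrix_inv (A x) *v axis j 1) $ i = matrix_inv (A x) $ i $ j"
      by (simp add: matrix_vector_mul_component inner_axis)
    ultimately show "?d x = matrix_inv (A x) $ i $ j" by simp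
  qed
qed

section \<open>Riemannian metrics in coordinates\<close>

definition partial :: "'m::finite \<Rightarrow> (real ^ 'm \<Rightarrow> 'b::real_normed_vector) \<Rightarrow> real ^ 'm \<Rightarrow> 'b" where
  "partial i f y = frechet_derivative f (at y) (axis i 1)"

lemma partial_eqI:
  assumes "(f has_derivative D) (at y)"
  shows "partial i f y = D (axis i 1)"
  unfolding partial_def frechet_derivative_at[OF assms, symmetric] ..

text \<open>Functions that agree on an open set have the same germ at its points. Most coordinate
  identities hold only on the image of a chart, and this is how they are used under
  \<open>partial\<close>.\<close>

lemma partial_cong:
  assumes "open S" "y \<in> S" "\<And>z. z \<in> S \<Longrightarrow> f z = g z" "smooth_on f S"
  shows "partial i f y = partial i g y"
proof -
  have "(g has_derivative frechet_derivative f (at y)) (at y)"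
    by (rule has_derivative_transform_within_open[OF smooth_on_has_derivative[OF assms(4,2)] assms(1,2,3)])
  from partial_eqI[OF this] show ?thesis by (simp add: partial_def)
qed

lemma smooth_on_partial: "smooth_on f S \<Longrightarrow> smooth_on (partial i f) S"
  using smooth_on_derivative[of f S "axis i 1"] by (simp add: partial_def[abs_def])

lemma partial_const: "partial i (\<lambda>y. c) y = 0"
  by (rule partial_eqI[OF has_derivative_const])

lemma partial_bilinear:
  assumes "bounded_bilinear B" "smooth_on f S" "smooth_on g S" "y \<in> S"
  shows "partial i (\<lambda>z. B (f z) (g z)) y = B (f y) (partial i g y) + B (partial i f y) (g y)"
  unfolding partial_eqI[OF bounded_bilinear.FDERIV[OF assms(1) smooth_on_has_derivative[OF assms(2,4)]
    smooth_on_has_derivative[OF assms(3,4)]]] by (simp add: partial_def)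

lemmas partial_mult = partial_bilinear[OF bounded_bilinear_mult]
lemmas partial_scaleR = partial_bilinear[OF bounded_bilinear_scaleR]
lemmas partial_inner = partial_bilinear[OF bounded_bilinear_inner]

lemma partial_sum:
  assumes "\<And>k. k \<in> I \<Longrightarrow> smooth_on (f k) S" "y \<in> S"
  shows "partial i (\<lambda>z. \<Sum>k\<in>I. f k z) y = (\<Sum>k\<in>I. partial i (f k) y)"
proof -
  have "((\<lambda>z. \<Sum>k\<in>I. f k z) has_derivative (\<lambda>h. \<Sum>k\<in>I. frechet_derivative (f k) (at y) h)) (at y)"
    by (intro has_derivative_sum smooth_on_has_derivative[OF assms])
  from partial_eqI[OF this] show ?thesis by (simp add: partial_def)
qed

text \<open>\<open>gi\<close> and \<open>chr\<close> are \<^const>\<open>ginv\<close> and \<^const>\<open>christoffel\<close> read off in the coordinates of a chart.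
  \<open>lap\<close> is the trace of the Hessian; that it is the divergence of the gradient is \<open>lap_div\<close> below.\<close>

definition gi :: "(real ^ 'm \<Rightarrow> real ^ 'm ^ 'm) \<Rightarrow> 'm::finite \<Rightarrow> 'm \<Rightarrow> real ^ 'm \<Rightarrow> real" where
  "gi G i j y = matrix_inv (G y) $ i $ j"

definition chr :: "(real ^ 'm \<Rightarrow> real ^ 'm ^ 'm) \<Rightarrow> 'm::finite \<Rightarrow> 'm \<Rightarrow> 'm \<Rightarrow> real ^ 'm \<Rightarrow> real" where
  "chr G k i j y = (\<Sum>l\<in>UNIV. gi G k l y *
     (partial i (\<lambda>z. G z $ j $ l) y + partial j (\<lambda>z. G z $ i $ l) y - partial l (\<lambda>z. G z $ i $ j) y)) / 2"

definition lap :: "(real ^ 'm \<Rightarrow> real ^ 'm ^ 'm) \<Rightarrow> (real ^ 'm::finite \<Rightarrow> 'b::real_normed_vector) \<Rightarrow> real ^ 'm \<Rightarrow> 'b" where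
  "lap G f y = (\<Sum>i\<in>UNIV. \<Sum>j\<in>UNIV. gi G i j y *\<^sub>R
     (partial i (partial j f) y - (\<Sum>k\<in>UNIV. chr G k i j y *\<^sub>R partial k f y)))"

definition dens :: "(real ^ 'm \<Rightarrow> real ^ 'm ^ 'm) \<Rightarrow> real ^ 'm::finite \<Rightarrow> real" where
  "dens G y = sqrt (det (G y))"

text \<open>The trace <du, df> of the paired differentials; for u = f it is the energy density
  |du|^2.\<close>

definition grad_inner :: "(real ^ 'm \<Rightarrow> real ^ 'm ^ 'm) \<Rightarrow> (real ^ 'm::finite \<Rightarrow> 'b::euclidean_space) \<Rightarrow>
    (real ^ 'm \<Rightarrow> 'b) \<Rightarrow> real ^ 'm \<Rightarrow> real" where
  "grad_inner G u f y = (\<Sum>i\<in>UNIV. \<Sum>j\<in>UNIV. gi G i j y * (partial i u y \<bullet> partial j f y))"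

text \<open>The derivative at \<open>s = 0\<close> of the integral of \<open>h (y + s e\<^sub>i)\<close>, which does not depend on \<open>s\<close>.\<close>

lemma integral_partial_eq_0:
  fixes h :: "real ^ 'm::finite \<Rightarrow> real"
  assumes h: "smooth_on h UNIV" and supp: "\<And>y. y \<notin> cbox a b \<Longrightarrow> h y = 0"
    and pz: "\<And>y. y \<notin> cbox a b \<Longrightarrow> partial i h y = 0"
  shows "integral (cbox a b) (partial i h) = 0"
proof -
  let ?e = "axis i 1 :: real ^ 'm" and ?o = "1 :: real ^ 'm"
  \<comment> \<open>Enlarged by 1 in every coordinate, so that translating \<open>h\<close> by at
    most 1 along \<open>?e\<close> keeps the support inside.\<close>
  let ?B = "cbox (a - ?o) (b + ?o)"
  have sub: "cbox a b \<subseteq> cbox (a - ?o + s *\<^sub>R ?e) (b + ?o + s *\<^sub>R ?e)" if "s \<in> {-1..1}" for s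
  proof
    fix x assume x: "x \<in> cbox a b"
    have "(a - ?o + s *\<^sub>R ?e) $ j \<le> x $ j \<and> x $ j \<le> (b + ?o + s *\<^sub>R ?e) $ j" for j
    proof -
      have "\<bar>s * ?e $ j\<bar> \<le> 1" using that by (auto simp: axis_def)
      moreover have "a $ j \<le> x $ j" "x $ j \<le> b $ j" using x by (auto simp: mem_box_cart)
      ultimately show ?thesis by simp linarith
    qed
    then show "x \<in> cbox (a - ?o + s *\<^sub>R ?e) (b + ?o + s *\<^sub>R ?e)" by (simp add: mem_box_cart)
  qed
  have superset: "integral T k = integral (cbox a b) k"
    if "smooth_on k UNIV" "\<And>y. y \<notin> cbox a b \<Longrightarrow> k y = 0" "cbox a b \<subseteq> T" for k :: "real ^ 'm \<Rightarrow> real" and T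
  proof -
    have "continuous_on (cbox a b) k" by (rule continuous_on_subset[OF smooth_on_continuous[OF that(1)]]) simp
    from has_integral_on_superset[OF integrable_integral[OF integrable_continuous[OF this]] that(2,3)]
    show ?thesis by (rule integral_unique)
  qed
  have sub0: "cbox a b \<subseteq> ?B" using sub[of 0] by simp
  have eq: "integral ?B (\<lambda>y. h (y + s *\<^sub>R ?e)) = integral (cbox a b) h" if s: "s \<in> {-1..1}" for s
  proof -
    have "integral ?B (\<lambda>y. h (y + s *\<^sub>R ?e)) = integral (cbox (a - ?o + s *\<^sub>R ?e) (b + ?o + s *\<^sub>R ?e)) h"
      using integral_shift_cbox_plus[of "a - ?o" "b + ?o" h "s *\<^sub>R ?e"] by (simp add: o_def add.commute)
    also have "\<dots> = integral (cbox a b) h"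
      by (rule superset[OF h supp sub[OF s]])
    finally show ?thesis .
  qed
  have "((\<lambda>s. integral ?B (\<lambda>y. h (y + s *\<^sub>R ?e))) has_vector_derivative
      integral ?B (\<lambda>y. partial i h (y + 0 *\<^sub>R ?e))) (at 0 within {-1..1})"
  proof (rule leibniz_rule_vector_derivative[where fx = "\<lambda>s y. partial i h (y + s *\<^sub>R ?e)"])
    fix s :: real and y :: "real ^ 'm"
    note d = smooth_on_has_derivative[OF h UNIV_I, of "y + s *\<^sub>R ?e"]
    have "((\<lambda>s. h (y + s *\<^sub>R ?e)) has_derivative (\<lambda>k. frechet_derivative h (at (y + s *\<^sub>R ?e)) (k *\<^sub>R ?e))) (at s within {-1..1})"
      by (rule has_derivative_compose[of "\<lambda>s. y + s *\<^sub>R ?e" _ s _ h, OF _ d]) (auto intro!: derivative_eq_intros)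
    then show "((\<lambda>s. h (y + s *\<^sub>R ?e)) has_vector_derivative partial i h (y + s *\<^sub>R ?e)) (at s within {-1..1})"
      by (simp add: has_vector_derivative_def partial_def linear_cmul[OF has_derivative_linear[OF d]])
  next
    fix s :: real
    show "(\<lambda>y. h (y + s *\<^sub>R ?e)) integrable_on ?B"
      by (intro integrable_continuous continuous_on_compose2[OF smooth_on_continuous[OF h]] continuous_intros) auto
  next
    show "continuous_on ({-1..1} \<times> ?B) (\<lambda>(s, y). partial i h (y + s *\<^sub>R ?e))"
      unfolding split_def
      by (intro continuous_on_compose2[OF smooth_on_continuous[OF smooth_on_partial[OF h]]] continuous_intros) auto
  qed auto
  moreover have "((\<lambda>s. integral ?B (\<lambda>y. h (y + s *\<^sub>R ?e))) has_vector_derivative 0) (at 0 within {-1..1})"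
    by (rule has_vector_derivative_transform[OF _ _ has_vector_derivative_const]) (use eq in auto)
  ultimately have "integral ?B (partial i h) = 0"
    using vector_derivative_unique_within_closed_interval[of "-1" 1 0] by auto
  moreover have "integral ?B (partial i h) = integral (cbox a b) (partial i h)"
    by (rule superset[OF smooth_on_partial[OF h] pz sub0])
  ultimately show ?thesis by simp
qed

section \<open>Laplacian, divergence theorem and Green's formula for one coordinate metric\<close>

locale coordinate_metric =
  fixes G :: "real ^ 'm::finite \<Rightarrow> real ^ 'm ^ 'm" and X :: "(real ^ 'm) set"
  assumes opn: "open X" and smG: "smooth_on G X" and pd: "\<And>y. y \<in> X \<Longrightarrow> pos_def (G y)"
begin

abbreviation "dG k i j \<equiv> partial k (\<lambda>z. G z $ i $ j)"

lemma inv: "y \<in> X \<Longrightarrow> invertible (G y)"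
  by (intro pos_def_invertible pd)

lemma det_pos: "y \<in> X \<Longrightarrow> det (G y) > 0"
  by (intro pos_def_det_pos pd)

lemma G_sym: "y \<in> X \<Longrightarrow> G y $ i $ j = G y $ j $ i"
  using pd[of y] unfolding pos_def_def transpose_def by (simp add: vec_eq_iff)

lemma smooth_G: "smooth_on (\<lambda>y. G y $ i $ j) X"
  by (intro smooth_on_nth smG opn)

lemma smooth_gi: "smooth_on (gi G i j) X"
  unfolding gi_def[abs_def] by (intro smooth_on_matrix_inv opn smG pd)

lemma smooth_dens: "smooth_on (dens G) X"
proof -
  have "smooth_on (\<lambda>y. det (G y) powr (1 / 2)) X"
    by (intro smooth_on_powr smooth_on_det opn smooth_G det_pos)
  then show ?thesis
    by (rule smooth_on_cong[OF opn, rotated]) (simp add: dens_def powr_half_sqrt less_imp_le det_pos)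
qed

lemma dens_pos: "y \<in> X \<Longrightarrow> dens G y > 0"
  by (simp add: dens_def det_pos)

lemma smooth_chr: "smooth_on (chr G k i j) X"
proof -
  have "smooth_on (\<lambda>y. (1 / 2) *\<^sub>R (\<Sum>l\<in>UNIV. gi G k l y * (dG i j l y + dG j i l y - dG l i j y))) X"
    by (intro smooth_on_scaleR smooth_on_const smooth_on_sum smooth_on_mult smooth_on_diff smooth_on_add
      smooth_gi smooth_on_partial smooth_G opn)
  then show ?thesis by (simp add: chr_def[abs_def])
qed

lemma smooth_lap: "smooth_on f X \<Longrightarrow> smooth_on (lap G f) X"
  unfolding lap_def[abs_def]
  by (intro smooth_on_sum smooth_on_scaleR smooth_on_diff smooth_on_partial smooth_gi smooth_chr opn)

lemma gi_G: "y \<in> X \<Longrightarrow> (\<Sum>b\<in>UNIV. gi G i b y * G y $ b $ c) = (if i = c then 1 else 0)"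
  using matrix_inv_mult(1)[OF inv, of y] by (simp add: gi_def matrix_matrix_mult_def mat_def vec_eq_iff)

lemma G_gi: "y \<in> X \<Longrightarrow> (\<Sum>b\<in>UNIV. G y $ i $ b * gi G b c y) = (if i = c then 1 else 0)"
  using matrix_inv_mult(2)[OF inv, of y] by (simp add: gi_def matrix_matrix_mult_def mat_def vec_eq_iff)

lemma gi_sym:
  assumes "y \<in> X"
  shows "gi G i j y = gi G j i y"
proof -
  let ?A = "G y" and ?C = "matrix_inv (G y)"
  have "transpose ?A = ?A" using pd[OF assms] by (simp add: pos_def_def)
  then have "transpose ?C ** ?A = mat 1"
    using matrix_inv_mult(2)[OF inv[OF assms]] by (metis matrix_transpose_mul transpose_mat)
  then have "transpose ?C ** ?A ** ?C = ?C" by simp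
  then have "transpose ?C = ?C"
    by (simp add: matrix_mul_assoc[symmetric] matrix_inv_mult[OF inv[OF assms]])
  then show ?thesis by (simp add: gi_def transpose_def vec_eq_iff)
qed

lemma dG_sym:
  assumes "y \<in> X"
  shows "dG k i j y = dG k j i y"
  by (rule partial_cong[OF opn assms _ smooth_G]) (rule G_sym)

text \<open>Differentiate G^-1 G = 1 and multiply by G^-1 from the right.\<close>

lemma partial_gi:
  assumes y: "y \<in> X"
  shows "partial k (gi G i j) y = - (\<Sum>a\<in>UNIV. \<Sum>b\<in>UNIV. gi G i a y * dG k a b y * gi G b j y)"
proof -
  have d: "(\<Sum>b\<in>UNIV. partial k (gi G i b) y * G y $ b $ c) = - (\<Sum>b\<in>UNIV. gi G i b y * dG k b c y)" for c
  proof -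
    have "(\<Sum>b\<in>UNIV. gi G i b y * dG k b c y + partial k (gi G i b) y * G y $ b $ c) =
        partial k (\<lambda>z. \<Sum>b\<in>UNIV. gi G i b z * G z $ b $ c) y"
      by (subst partial_sum[OF _ y])
        (auto intro!: smooth_on_mult opn smooth_gi smooth_G simp: partial_mult[OF smooth_gi smooth_G y])
    also have "\<dots> = partial k (\<lambda>z. if i = c then 1 else 0) y"
      by (rule partial_cong[OF opn y]) (auto simp: gi_G intro!: smooth_on_sum smooth_on_mult opn smooth_gi smooth_G)
    also have "\<dots> = 0" by (rule partial_const)
    finally show ?thesis by (simp add: sum.distrib)
  qed
  have "partial k (gi G i j) y = (\<Sum>b\<in>UNIV. partial k (gi G i b) y * (\<Sum>c\<in>UNIV. G y $ b $ c * gi G c j y))"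
    by (simp add: G_gi[OF y] if_distrib cong: if_cong)
  also have "\<dots> = (\<Sum>b\<in>UNIV. \<Sum>c\<in>UNIV. partial k (gi G i b) y * G y $ b $ c * gi G c j y)"
    by (simp add: sum_distrib_left mult.assoc)
  also have "\<dots> = (\<Sum>c\<in>UNIV. \<Sum>b\<in>UNIV. partial k (gi G i b) y * G y $ b $ c * gi G c j y)"
    by (rule sum.swap)
  also have "\<dots> = (\<Sum>c\<in>UNIV. - (\<Sum>b\<in>UNIV. gi G i b y * dG k b c y) * gi G c j y)"
    by (simp only: sum_distrib_right[symmetric] d)
  also have "\<dots> = - (\<Sum>c\<in>UNIV. \<Sum>b\<in>UNIV. gi G i b y * dG k b c y * gi G c j y)"
    by (simp add: sum_distrib_right sum_negf)
  also have "\<dots> = - (\<Sum>b\<in>UNIV. \<Sum>c\<in>UNIV. gi G i b y * dG k b c y * gi G c j y)"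
    by (subst sum.swap) simp
  finally show ?thesis .
qed

text \<open>In the contraction with the symmetric G^-1 the first and the third term of the
  Christoffel symbol cancel.\<close>

lemma chr_trace:
  assumes y: "y \<in> X"
  shows "(\<Sum>i\<in>UNIV. chr G i i k y) = (\<Sum>i\<in>UNIV. \<Sum>l\<in>UNIV. gi G i l y * dG k i l y) / 2"
proof -
  have s: "(\<Sum>i\<in>UNIV. \<Sum>l\<in>UNIV. gi G i l y * dG i k l y) = (\<Sum>i\<in>UNIV. \<Sum>l\<in>UNIV. gi G i l y * dG l i k y)"
    by (subst sum.swap) (simp add: gi_sym[OF y] dG_sym[OF y])
  have "(\<Sum>i\<in>UNIV. chr G i i k y) = ((\<Sum>i\<in>UNIV. \<Sum>l\<in>UNIV. gi G i l y * dG i k l y) +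
      (\<Sum>i\<in>UNIV. \<Sum>l\<in>UNIV. gi G i l y * dG k i l y) - (\<Sum>i\<in>UNIV. \<Sum>l\<in>UNIV. gi G i l y * dG l i k y)) / 2"
    unfolding chr_def sum_divide_distrib[symmetric]
    by (simp add: algebra_simps sum.distrib sum_subtractf)
  then show ?thesis using s by simp
qed

text \<open>By Jacobi's formula the logarithmic derivative of \<open>sqrt (det G)\<close> is half
  the trace of G^-1 dG, which \<open>chr_trace\<close> recognises. This is what turns a Riemannian
  divergence, weighted with the density, into a coordinate divergence.\<close>

lemma partial_dens:
  assumes y: "y \<in> X"
  shows "partial k (dens G) y = dens G y * (\<Sum>i\<in>UNIV. chr G i i k y)"
proof -
  let ?G' = "frechet_derivative G (at y)"
  let ?S = "\<lambda>h. \<Sum>i\<in>UNIV. \<Sum>l\<in>UNIV. ?G' h $ i $ l * matrix_inv (G y) $ l $ i"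
  have dG: "(G has_derivative ?G') (at y)" by (rule smooth_on_has_derivative[OF smG y])
  have "((\<lambda>z. dens G z) has_derivative (\<lambda>h. (det (G y) * ?S h) * (inverse (sqrt (det (G y))) / 2))) (at y)"
    unfolding dens_def[of G] by (rule has_derivative_real_sqrt[OF det_pos[OF y] has_derivative_det[OF dG inv[OF y]]])
  from partial_eqI[OF this, of k]
  have "partial k (dens G) y = (det (G y) * ?S (axis k 1)) * (inverse (dens G y) / 2)"
    by (simp add: dens_def[of G y])
  moreover have "det (G y) = dens G y * dens G y"
    using det_pos[OF y] by (simp add: dens_def)
  ultimately have "partial k (dens G) y = dens G y * (?S (axis k 1) / 2)"
    using dens_pos[OF y] by (simp add: field_simps)
  moreover have "?G' (axis k 1) $ i $ l = dG k i l y" for i l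
  proof -
    have "((\<lambda>z. G z $ i $ l) has_derivative (\<lambda>h. ?G' h $ i $ l)) (at y)"
      by (intro bounded_linear.has_derivative[OF bounded_linear_vec_nth] dG)
    from partial_eqI[OF this] show ?thesis by simp
  qed
  ultimately show ?thesis
    by (simp add: chr_trace[OF y] gi_sym[OF y] mult.commute flip: gi_def)
qed

text \<open>The inverse metric is covariantly constant; this is the contraction of that fact over
  the differentiated index and one index of the metric. With the abbreviations of the proof both
  sides equal - A + C / 2, because B = A by symmetry of G^-1.\<close>

lemma chr_contract:
  assumes y: "y \<in> X"
  shows "(\<Sum>i\<in>UNIV. partial i (gi G i j) y) + (\<Sum>k\<in>UNIV. (\<Sum>i\<in>UNIV. chr G i i k y) * gi G k j y) =
    - (\<Sum>i\<in>UNIV. \<Sum>k\<in>UNIV. gi G i k y * chr G j i k y)"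
proof -
  let ?A = "\<Sum>i\<in>UNIV. \<Sum>k\<in>UNIV. \<Sum>l\<in>UNIV. gi G i k y * dG i k l y * gi G l j y"
  let ?B = "\<Sum>i\<in>UNIV. \<Sum>k\<in>UNIV. \<Sum>l\<in>UNIV. gi G i k y * dG k i l y * gi G l j y"
  let ?C = "\<Sum>i\<in>UNIV. \<Sum>k\<in>UNIV. \<Sum>l\<in>UNIV. gi G i k y * dG l i k y * gi G l j y"
  have 1: "(\<Sum>i\<in>UNIV. partial i (gi G i j) y) = - ?A"
    by (simp add: partial_gi[OF y] sum_negf)
  have "(\<Sum>k\<in>UNIV. (\<Sum>i\<in>UNIV. chr G i i k y) * gi G k j y) =
      (\<Sum>l\<in>UNIV. \<Sum>i\<in>UNIV. \<Sum>k\<in>UNIV. gi G i k y * dG l i k y * gi G l j y) / 2"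
    by (simp add: chr_trace[OF y] sum_divide_distrib sum_distrib_right)
  also have "(\<Sum>l\<in>UNIV. \<Sum>i\<in>UNIV. \<Sum>k\<in>UNIV. gi G i k y * dG l i k y * gi G l j y) = ?C"
    by (subst sum.swap, rule sum.cong[OF refl], rule sum.swap)
  finally have 2: "(\<Sum>k\<in>UNIV. (\<Sum>i\<in>UNIV. chr G i i k y) * gi G k j y) = ?C / 2" .
  have BA: "?B = ?A"
    by (subst sum.swap) (simp add: gi_sym[OF y])
  have "gi G i k y * chr G j i k y = ((\<Sum>l\<in>UNIV. gi G i k y * dG i k l y * gi G l j y) +
     (\<Sum>l\<in>UNIV. gi G i k y * dG k i l y * gi G l j y) - (\<Sum>l\<in>UNIV. gi G i k y * dG l i k y * gi G l j y)) / 2" for i k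
    unfolding chr_def gi_sym[OF y, of j]
    by (simp add: sum_distrib_left sum.distrib[symmetric] sum_subtractf[symmetric] algebra_simps)
  then have "(\<Sum>i\<in>UNIV. \<Sum>k\<in>UNIV. gi G i k y * chr G j i k y) = (?A + ?B - ?C) / 2"
    by (simp only: sum_divide_distrib[symmetric] sum.distrib sum_subtractf)
  with 1 2 BA show ?thesis by (simp add: field_simps)
qed

text \<open>The second-order terms of both sides agree after the product rule; the coefficients of
  the first derivatives of f are matched by \<open>chr_contract\<close>.\<close>

lemma lap_div:
  assumes f: "smooth_on f X" and y: "y \<in> X"
  shows "lap G f y = (\<Sum>i\<in>UNIV. partial i (\<lambda>z. \<Sum>j\<in>UNIV. gi G i j z *\<^sub>R partial j f z) y) +
    (\<Sum>k\<in>UNIV. (\<Sum>i\<in>UNIV. chr G i i k y) *\<^sub>R (\<Sum>j\<in>UNIV. gi G k j y *\<^sub>R partial j f y))"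
proof -
  let ?H = "\<Sum>i\<in>UNIV. \<Sum>j\<in>UNIV. gi G i j y *\<^sub>R partial i (partial j f) y"
  have p: "partial i (\<lambda>z. \<Sum>j\<in>UNIV. gi G i j z *\<^sub>R partial j f z) y =
      (\<Sum>j\<in>UNIV. gi G i j y *\<^sub>R partial i (partial j f) y + partial i (gi G i j) y *\<^sub>R partial j f y)" for i
    by (subst partial_sum[OF _ y])
      (auto intro!: smooth_on_scaleR opn smooth_gi smooth_on_partial f simp: partial_scaleR[OF smooth_gi smooth_on_partial[OF f] y])
  have 1: "(\<Sum>i\<in>UNIV. partial i (\<lambda>z. \<Sum>j\<in>UNIV. gi G i j z *\<^sub>R partial j f z) y) =
      ?H + (\<Sum>j\<in>UNIV. (\<Sum>i\<in>UNIV. partial i (gi G i j) y) *\<^sub>R partial j f y)"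
    unfolding p sum.distrib scaleR_sum_left by (simp add: sum.swap[of "\<lambda>i j. partial i (gi G i j) y *\<^sub>R partial j f y"])
  have 2: "(\<Sum>k\<in>UNIV. (\<Sum>i\<in>UNIV. chr G i i k y) *\<^sub>R (\<Sum>j\<in>UNIV. gi G k j y *\<^sub>R partial j f y)) =
      (\<Sum>j\<in>UNIV. (\<Sum>k\<in>UNIV. (\<Sum>i\<in>UNIV. chr G i i k y) * gi G k j y) *\<^sub>R partial j f y)"
    unfolding scaleR_sum_right scaleR_sum_left[of _ UNIV "partial _ f y"] scaleR_scaleR by (rule sum.swap)
  have "lap G f y = ?H - (\<Sum>i\<in>UNIV. \<Sum>j\<in>UNIV. \<Sum>k\<in>UNIV. (gi G i j y * chr G k i j y) *\<^sub>R partial k f y)"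
    by (simp add: lap_def scaleR_diff_right sum_subtractf scaleR_sum_right)
  also have "(\<Sum>i\<in>UNIV. \<Sum>j\<in>UNIV. \<Sum>k\<in>UNIV. (gi G i j y * chr G k i j y) *\<^sub>R partial k f y) =
      (\<Sum>i\<in>UNIV. \<Sum>k\<in>UNIV. \<Sum>j\<in>UNIV. (gi G i j y * chr G k i j y) *\<^sub>R partial k f y)"
    by (intro sum.cong[OF refl] sum.swap)
  also have "\<dots> = (\<Sum>k\<in>UNIV. \<Sum>i\<in>UNIV. \<Sum>j\<in>UNIV. (gi G i j y * chr G k i j y) *\<^sub>R partial k f y)"
    by (rule sum.swap)
  also have "\<dots> = (\<Sum>k\<in>UNIV. (\<Sum>i\<in>UNIV. \<Sum>j\<in>UNIV. gi G i j y * chr G k i j y) *\<^sub>R partial k f y)"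
    by (simp add: scaleR_sum_left)
  also have "\<dots> = - (\<Sum>k\<in>UNIV. (- (\<Sum>i\<in>UNIV. \<Sum>j\<in>UNIV. gi G i j y * chr G k i j y)) *\<^sub>R partial k f y)"
    by (simp add: sum_negf)
  also have "\<dots> = - ((\<Sum>j\<in>UNIV. (\<Sum>i\<in>UNIV. partial i (gi G i j) y) *\<^sub>R partial j f y) +
      (\<Sum>j\<in>UNIV. (\<Sum>k\<in>UNIV. (\<Sum>i\<in>UNIV. chr G i i k y) * gi G k j y) *\<^sub>R partial j f y))"
    by (simp only: chr_contract[OF y, symmetric] scaleR_add_left sum.distrib)
  finally show ?thesis unfolding 1 2 by simp
qed

text \<open>By \<open>partial_dens\<close> the integrand is the sum of the plain partial derivatives
  of \<open>dens G y * Y i y\<close>, and each of these integrates to zero because the support is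
  compact.\<close>

lemma integral_divergence_eq_0:
  assumes Y: "\<And>i. smooth_on (Y i) X" and C: "closed C" "C \<subseteq> cbox a b" "cbox a b \<subseteq> X"
    and zero: "\<And>i y. y \<in> X - C \<Longrightarrow> Y i y = 0"
  shows "integral (cbox a b) (\<lambda>y. dens G y * ((\<Sum>i\<in>UNIV. partial i (Y i) y) +
    (\<Sum>k\<in>UNIV. (\<Sum>i\<in>UNIV. chr G i i k y) * Y k y))) = 0"
proof -
  \<comment> \<open>The fields are smooth only on \<open>X\<close>, while
    \<open>integral_partial_eq_0\<close> wants functions smooth everywhere; their support in
    \<open>C\<close> makes the extension by zero smooth.\<close>
  define h where "h i y = (if y \<in> X then dens G y * Y i y else 0)" for i y
  have smd: "smooth_on (\<lambda>y. dens G y * Y i y) X" for i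
    by (intro smooth_on_mult opn smooth_dens Y)
  have smX: "smooth_on (h i) X" for i
    by (rule smooth_on_cong[OF opn _ smd[of i]]) (simp add: h_def)
  have sm: "smooth_on (h i) UNIV" for i
    by (rule smooth_on_extend_zero[OF opn C(1) _ smX]) (use C zero in \<open>auto simp: h_def\<close>)
  have h0: "h i y = 0" if "y \<notin> C" for i y
    using that zero by (auto simp: h_def)
  have p0: "partial i (h i) y = 0" if "y \<notin> C" for i y
    using partial_cong[of "- C" y "h i" "\<lambda>_. 0" i] that open_Compl[OF C(1)] h0
    by (simp add: partial_const smooth_on_subset[OF sm])
  have p: "partial i (h i) y = dens G y * (partial i (Y i) y + (\<Sum>j\<in>UNIV. chr G j j i y) * Y i y)"
    if y: "y \<in> X" for i y
  proof -
    have "partial i (h i) y = partial i (\<lambda>y. dens G y * Y i y) y"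
      by (rule partial_cong[OF opn y _ smX]) (simp add: h_def)
    then show ?thesis by (simp add: partial_mult[OF smooth_dens Y y] partial_dens[OF y] distrib_left)
  qed
  have "integral (cbox a b) (\<lambda>y. dens G y * ((\<Sum>i\<in>UNIV. partial i (Y i) y) +
      (\<Sum>k\<in>UNIV. (\<Sum>i\<in>UNIV. chr G i i k y) * Y k y))) =
    integral (cbox a b) (\<lambda>y. \<Sum>i\<in>UNIV. partial i (h i) y)"
  proof (rule Henstock_Kurzweil_Integration.integral_cong)
    fix y assume "y \<in> cbox a b"
    then have y: "y \<in> X" using C by auto
    show "dens G y * ((\<Sum>i\<in>UNIV. partial i (Y i) y) + (\<Sum>k\<in>UNIV. (\<Sum>i\<in>UNIV. chr G i i k y) * Y k y)) =
      (\<Sum>i\<in>UNIV. partial i (h i) y)"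
      unfolding p[OF y] by (simp only: sum.distrib sum_distrib_left[symmetric])
  qed
  also have "\<dots> = (\<Sum>i\<in>UNIV. integral (cbox a b) (partial i (h i)))"
    by (intro Henstock_Kurzweil_Integration.integral_sum integrable_continuous
      continuous_on_subset[OF smooth_on_continuous[OF smooth_on_partial[OF sm]]]) auto
  also have "\<dots> = 0"
    by (intro sum.neutral ballI integral_partial_eq_0[OF sm] h0 p0) (use C(2) in auto)
  finally show ?thesis .
qed

lemma integrable_smooth:
  fixes f :: "real ^ 'm \<Rightarrow> real"
  assumes "smooth_on f X" "cbox a b \<subseteq> X"
  shows "f integrable_on cbox a b"
  by (intro integrable_continuous continuous_on_subset[OF smooth_on_continuous[OF assms(1)] assms(2)])

lemma smooth_grad_inner: "smooth_on u X \<Longrightarrow> smooth_on f X \<Longrightarrow> smooth_on (grad_inner G u f) X"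
  unfolding grad_inner_def[abs_def]
  by (intro smooth_on_sum smooth_on_mult smooth_on_inner smooth_on_partial smooth_gi opn)

lemma grad_inner_commute: "y \<in> X \<Longrightarrow> grad_inner G u f y = grad_inner G f u y"
  unfolding grad_inner_def by (subst sum.swap) (simp add: gi_sym inner_commute)

text \<open>The divergence theorem for the field u . grad f, whose divergence is u . lap f + <du,
  df>. The support may be carried by either function, so the formula can be used with the roles of u
  and f exchanged.\<close>

lemma green:
  fixes u f :: "real ^ 'm \<Rightarrow> 'b::euclidean_space"
  assumes u: "smooth_on u X" and f: "smooth_on f X" and C: "closed C" "C \<subseteq> cbox a b" "cbox a b \<subseteq> X"
    and zero: "(\<forall>y\<in>X - C. u y = 0) \<or> (\<forall>y\<in>X - C. f y = 0)"
  shows "integral (cbox a b) (\<lambda>y. dens G y * (u y \<bullet> lap G f y)) = - integral (cbox a b) (\<lambda>y. dens G y * grad_inner G u f y)"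
proof -
  define Z where "Z i y = (\<Sum>j\<in>UNIV. gi G i j y *\<^sub>R partial j f y)" for i y
  have smZ: "smooth_on (Z i) X" for i
    unfolding Z_def[abs_def] by (intro smooth_on_sum smooth_on_scaleR smooth_gi smooth_on_partial f opn)
  define Y where "Y i y = u y \<bullet> Z i y" for i y
  have smY: "smooth_on (Y i) X" for i
    unfolding Y_def[abs_def] by (intro smooth_on_inner opn u smZ)
  have Y0: "Y i y = 0" if y: "y \<in> X - C" for i y
    using zero
  proof
    assume "\<forall>y\<in>X - C. u y = 0" then show ?thesis using y by (simp add: Y_def)
  next
    assume f0: "\<forall>y\<in>X - C. f y = 0"
    have "partial j f y = 0" for j
      using partial_cong[of "X - C" y f "\<lambda>_. 0" j] y C(1) opn f0
      by (simp add: partial_const smooth_on_subset[OF f] open_Diff)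
    then show ?thesis by (simp add: Y_def Z_def)
  qed
  have pY: "(\<Sum>i\<in>UNIV. partial i (Y i) y) + (\<Sum>k\<in>UNIV. (\<Sum>i\<in>UNIV. chr G i i k y) * Y k y) =
      u y \<bullet> lap G f y + grad_inner G u f y" if y: "y \<in> X" for y
  proof -
    have "partial i (Y i) y = u y \<bullet> partial i (Z i) y + partial i u y \<bullet> Z i y" for i
      unfolding Y_def by (rule partial_inner[OF u smZ y])
    then have "(\<Sum>i\<in>UNIV. partial i (Y i) y) = u y \<bullet> (\<Sum>i\<in>UNIV. partial i (Z i) y) + grad_inner G u f y"
      by (simp add: sum.distrib inner_sum_right grad_inner_def Z_def)
    moreover have "(\<Sum>k\<in>UNIV. (\<Sum>i\<in>UNIV. chr G i i k y) * Y k y) =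
        u y \<bullet> (\<Sum>k\<in>UNIV. (\<Sum>i\<in>UNIV. chr G i i k y) *\<^sub>R Z k y)"
      by (simp add: Y_def inner_sum_right)
    moreover have "lap G f y = (\<Sum>i\<in>UNIV. partial i (Z i) y) + (\<Sum>k\<in>UNIV. (\<Sum>i\<in>UNIV. chr G i i k y) *\<^sub>R Z k y)"
      unfolding lap_div[OF f y] Z_def[abs_def] ..
    ultimately show ?thesis by (simp add: inner_add_right)
  qed
  have i1: "(\<lambda>y. dens G y * (u y \<bullet> lap G f y)) integrable_on cbox a b"
    by (rule integrable_smooth[OF _ C(3)]) (intro smooth_on_mult smooth_on_inner opn u smooth_lap f smooth_dens)
  have i2: "(\<lambda>y. dens G y * grad_inner G u f y) integrable_on cbox a b"
    by (rule integrable_smooth[OF _ C(3)]) (intro smooth_on_mult opn u f smooth_grad_inner smooth_dens)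
  have "integral (cbox a b) (\<lambda>y. dens G y * (u y \<bullet> lap G f y)) + integral (cbox a b) (\<lambda>y. dens G y * grad_inner G u f y) =
      integral (cbox a b) (\<lambda>y. dens G y * (u y \<bullet> lap G f y) + dens G y * grad_inner G u f y)"
    by (rule Henstock_Kurzweil_Integration.integral_add[OF i1 i2, symmetric])
  also have "\<dots> = integral (cbox a b) (\<lambda>y. dens G y * ((\<Sum>i\<in>UNIV. partial i (Y i) y) +
      (\<Sum>k\<in>UNIV. (\<Sum>i\<in>UNIV. chr G i i k y) * Y k y)))"
  proof (rule Henstock_Kurzweil_Integration.integral_cong)
    fix y assume "y \<in> cbox a b"
    then have "y \<in> X" using C by auto
    from pY[OF this] show "dens G y * (u y \<bullet> lap G f y) + dens G y * grad_inner G u f y =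
      dens G y * ((\<Sum>i\<in>UNIV. partial i (Y i) y) + (\<Sum>k\<in>UNIV. (\<Sum>i\<in>UNIV. chr G i i k y) * Y k y))"
      by (simp add: distrib_left)
  qed
  also have "\<dots> = 0" by (rule integral_divergence_eq_0[OF smY C Y0])
  finally show ?thesis by simp
qed

text \<open>Green's formula in both directions, joined by the symmetry of \<open>grad_inner\<close>;
  in the second use the compactly supported function is the differentiated one.\<close>

lemma lap_self_adjoint:
  fixes u f :: "real ^ 'm \<Rightarrow> 'b::euclidean_space"
  assumes u: "smooth_on u X" and f: "smooth_on f X" and C: "closed C" "C \<subseteq> cbox a b" "cbox a b \<subseteq> X"
    and zero: "\<forall>y\<in>X - C. u y = 0"
  shows "integral (cbox a b) (\<lambda>y. dens G y * (u y \<bullet> lap G f y)) = integral (cbox a b) (\<lambda>y. dens G y * (f y \<bullet> lap G u y))"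
proof -
  have "integral (cbox a b) (\<lambda>y. dens G y * grad_inner G u f y) = integral (cbox a b) (\<lambda>y. dens G y * grad_inner G f u y)"
    by (rule Henstock_Kurzweil_Integration.integral_cong) (use C(3) in \<open>simp add: grad_inner_commute subset_iff\<close>)
  then show ?thesis using green[OF u f C] green[OF f u C] zero by simp
qed

end

section \<open>Change of coordinates\<close>

lemma bounded_bilinear_matrix_vector_mult:
  "bounded_bilinear ((*v) :: real ^ 'n ^ 'm \<Rightarrow> real ^ 'n \<Rightarrow> real ^ 'm)"
  by (simp add: bilinear_conv_bounded_bilinear[symmetric] bilinear_def linear_iff
    matrix_vector_right_distrib matrix_vector_mult_add_rdistrib vec.scale scaleR_matrix_vector_assoc
    matrix_vector_mult_scaleR)

lemma smooth_on_derivative_expand: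
  fixes f :: "real ^ 'm::finite \<Rightarrow> 'b::real_normed_vector"
  assumes "smooth_on f S" "x \<in> S"
  shows "frechet_derivative f (at x) v = (\<Sum>b\<in>UNIV. v $ b *\<^sub>R partial b f x)"
proof -
  note l = smooth_on_linear_derivative[OF assms]
  have "v = (\<Sum>b\<in>UNIV. v $ b *\<^sub>R axis b 1)"
    using basis_expansion[of v] by (simp add: scalar_mult_eq_scaleR)
  then have "frechet_derivative f (at x) v = frechet_derivative f (at x) (\<Sum>b\<in>UNIV. v $ b *\<^sub>R axis b 1)"
    by simp
  also have "\<dots> = (\<Sum>b\<in>UNIV. v $ b *\<^sub>R partial b f x)"
    by (simp add: linear_sum[OF l] linear_cmul[OF l] partial_def)
  finally show ?thesis .
qed

lemma partial_commute:
  fixes f :: "real ^ 'm::finite \<Rightarrow> 'b::euclidean_space"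
  assumes "open S" "smooth_on f S" "x \<in> S"
  shows "partial i (partial j f) x = partial j (partial i f) x"
  unfolding partial_def by (rule second_derivative_commute[OF assms])

lemma partial_nth:
  assumes "smooth_on f S" "x \<in> S"
  shows "partial i (\<lambda>z. f z $ a) x = partial i f x $ a"
  using partial_eqI[OF bounded_linear.has_derivative[OF bounded_linear_vec_nth smooth_on_has_derivative[OF assms]], of i a]
  by (simp add: partial_def)

context coordinate_metric begin

abbreviation "DG u y \<equiv> frechet_derivative G (at y) u"

text \<open>The Christoffel symbols as a vector-valued bilinear form in u and v, which allows an
  index-free comparison in two coordinate systems.\<close>

definition chr_vec :: "real ^ 'm \<Rightarrow> real ^ 'm \<Rightarrow> real ^ 'm \<Rightarrow> real ^ 'm" where
  "chr_vec u v y = (\<chi> c. \<Sum>a\<in>UNIV. \<Sum>b\<in>UNIV. u $ a * v $ b * chr G c a b y)"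

text \<open>Lowering the upper index cancels G^-1 and leaves the Christoffel symbols of the first
  kind.\<close>

lemma lower_chr:
  assumes y: "y \<in> X"
  shows "(\<Sum>c\<in>UNIV. G y $ l $ c * chr G c i j y) = (dG i j l y + dG j i l y - dG l i j y) / 2"
proof -
  let ?K = "\<lambda>m. (dG i j m y + dG j i m y - dG m i j y) / 2"
  have "(\<Sum>c\<in>UNIV. G y $ l $ c * chr G c i j y) = (\<Sum>c\<in>UNIV. \<Sum>m\<in>UNIV. G y $ l $ c * gi G c m y * ?K m)"
    by (simp add: chr_def sum_divide_distrib sum_distrib_left mult.assoc)
  also have "\<dots> = (\<Sum>m\<in>UNIV. (\<Sum>c\<in>UNIV. G y $ l $ c * gi G c m y) * ?K m)"
    by (subst sum.swap) (simp only: sum_distrib_right)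
  also have "\<dots> = ?K l" by (simp add: G_gi[OF y] if_distrib if_distribR cong: if_cong)
  finally show ?thesis .
qed

lemma DG_form:
  assumes y: "y \<in> X"
  shows "v \<bullet> (DG u y *v w) = (\<Sum>a\<in>UNIV. \<Sum>b\<in>UNIV. \<Sum>c\<in>UNIV. u $ a * v $ b * w $ c * dG a b c y)"
proof -
  have "DG u y $ b $ c = (\<Sum>a\<in>UNIV. u $ a * dG a b c y)" for b c
  proof -
    have "DG u y $ b $ c = (\<Sum>a\<in>UNIV. u $ a *\<^sub>R partial a G y) $ b $ c"
      by (simp only: smooth_on_derivative_expand[OF smG y])
    also have "\<dots> = (\<Sum>a\<in>UNIV. u $ a * partial a G y $ b $ c)" by simp
    also have "\<dots> = (\<Sum>a\<in>UNIV. u $ a * dG a b c y)"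
      by (simp only: partial_nth[OF smooth_on_nth[OF opn smG] y] partial_nth[OF smG y])
    finally show ?thesis .
  qed
  then have "v \<bullet> (DG u y *v w) = (\<Sum>b\<in>UNIV. \<Sum>c\<in>UNIV. \<Sum>a\<in>UNIV. u $ a * v $ b * w $ c * dG a b c y)"
    by (simp add: inner_vec_def matrix_vector_mult_def sum_distrib_left sum_distrib_right mult_ac)
  also have "\<dots> = (\<Sum>b\<in>UNIV. \<Sum>a\<in>UNIV. \<Sum>c\<in>UNIV. u $ a * v $ b * w $ c * dG a b c y)"
    by (intro sum.cong[OF refl] sum.swap)
  also have "\<dots> = (\<Sum>a\<in>UNIV. \<Sum>b\<in>UNIV. \<Sum>c\<in>UNIV. u $ a * v $ b * w $ c * dG a b c y)"
    by (rule sum.swap)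
  finally show ?thesis .
qed

text \<open>\<open>lower_chr\<close> contracted with three vectors: the Koszul formula for constant
  vector fields, whose Lie brackets vanish.\<close>

lemma koszul:
  assumes y: "y \<in> X"
  shows "w \<bullet> (G y *v chr_vec u v y) = (v \<bullet> (DG u y *v w) + u \<bullet> (DG v y *v w) - u \<bullet> (DG w y *v v)) / 2"
proof -
  let ?S = "\<lambda>f. \<Sum>a\<in>UNIV. \<Sum>b\<in>UNIV. \<Sum>c\<in>UNIV. u $ a * v $ b * w $ c * f a b c"
  have 1: "v \<bullet> (DG u y *v w) = ?S (\<lambda>a b c. dG a b c y)" by (rule DG_form[OF y])
  have 2: "u \<bullet> (DG v y *v w) = ?S (\<lambda>a b c. dG b a c y)"
    unfolding DG_form[OF y] by (subst sum.swap) (simp add: mult_ac)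
  have "u \<bullet> (DG w y *v v) = (\<Sum>c\<in>UNIV. \<Sum>a\<in>UNIV. \<Sum>b\<in>UNIV. u $ a * v $ b * w $ c * dG c a b y)"
    unfolding DG_form[OF y] by (simp add: mult_ac)
  also have "\<dots> = (\<Sum>a\<in>UNIV. \<Sum>c\<in>UNIV. \<Sum>b\<in>UNIV. u $ a * v $ b * w $ c * dG c a b y)" by (rule sum.swap)
  also have "\<dots> = ?S (\<lambda>a b c. dG c a b y)" by (intro sum.cong[OF refl] sum.swap)
  finally have 3: "u \<bullet> (DG w y *v v) = ?S (\<lambda>a b c. dG c a b y)" .
  have "(G y *v chr_vec u v y) $ c = (\<Sum>a\<in>UNIV. \<Sum>b\<in>UNIV. u $ a * v $ b * ((dG a b c y + dG b a c y - dG c a b y) / 2))" for c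
  proof -
    have "(G y *v chr_vec u v y) $ c = (\<Sum>d\<in>UNIV. \<Sum>a\<in>UNIV. \<Sum>b\<in>UNIV. u $ a * v $ b * (G y $ c $ d * chr G d a b y))"
      by (simp add: matrix_vector_mult_def chr_vec_def sum_distrib_left mult_ac)
    also have "\<dots> = (\<Sum>a\<in>UNIV. \<Sum>d\<in>UNIV. \<Sum>b\<in>UNIV. u $ a * v $ b * (G y $ c $ d * chr G d a b y))" by (rule sum.swap)
    also have "\<dots> = (\<Sum>a\<in>UNIV. \<Sum>b\<in>UNIV. \<Sum>d\<in>UNIV. u $ a * v $ b * (G y $ c $ d * chr G d a b y))"
      by (intro sum.cong[OF refl] sum.swap)
    finally show ?thesis by (simp only: sum_distrib_left[symmetric] lower_chr[OF y])
  qed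
  then have "w \<bullet> (G y *v chr_vec u v y) = (\<Sum>c\<in>UNIV. \<Sum>a\<in>UNIV. \<Sum>b\<in>UNIV.
      u $ a * v $ b * w $ c * ((dG a b c y + dG b a c y - dG c a b y) / 2))"
    by (simp add: inner_vec_def sum_distrib_left mult_ac)
  also have "\<dots> = (\<Sum>a\<in>UNIV. \<Sum>c\<in>UNIV. \<Sum>b\<in>UNIV.
      u $ a * v $ b * w $ c * ((dG a b c y + dG b a c y - dG c a b y) / 2))" by (rule sum.swap)
  also have "\<dots> = ?S (\<lambda>a b c. (dG a b c y + dG b a c y - dG c a b y) / 2)" by (intro sum.cong[OF refl] sum.swap)
  also have "\<dots> = (?S (\<lambda>a b c. dG a b c y) + ?S (\<lambda>a b c. dG b a c y) - ?S (\<lambda>a b c. dG c a b y)) / 2"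
    by (simp add: sum_divide_distrib sum.distrib[symmetric] sum_subtractf[symmetric] algebra_simps)
  finally show ?thesis unfolding 1 2 3 .
qed

end

lemma inner_axis_matrix_axis: "axis i 1 \<bullet> ((A :: real ^ 'n ^ 'n) *v axis j 1) = A $ i $ j"
  by (simp add: matrix_vector_mul_component inner_axis' inner_axis)

section \<open>Isometries between coordinate domains\<close>

locale metric_change = A: coordinate_metric A W + B: coordinate_metric B Z
  for A B :: "real ^ 'm::finite \<Rightarrow> real ^ 'm ^ 'm" and W Z :: "(real ^ 'm) set" +
  fixes T :: "real ^ 'm \<Rightarrow> real ^ 'm"
  assumes smT: "smooth_on T W" and TW: "T ` W \<subseteq> Z"
    and iso: "\<And>y v w. y \<in> W \<Longrightarrow>
      v \<bullet> (A y *v w) = frechet_derivative T (at y) v \<bullet> (B (T y) *v frechet_derivative T (at y) w)"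
begin

lemma A_eq: "y \<in> W \<Longrightarrow> A y $ i $ j = partial i T y \<bullet> (B (T y) *v partial j T y)"
  using iso[of y "axis i 1" "axis j 1"] by (simp add: inner_axis_matrix_axis partial_def)

definition jac :: "real ^ 'm \<Rightarrow> real ^ 'm ^ 'm" where
  "jac y = (\<chi> a i. partial i T y $ a)"

lemma A_jac: "y \<in> W \<Longrightarrow> A y = transpose (jac y) ** B (T y) ** jac y"
  by (simp add: vec_eq_iff A_eq jac_def matrix_matrix_mult_def transpose_def matrix_vector_mult_def
      inner_vec_def sum_distrib_left sum_distrib_right mult_ac) (intro allI, rule sum.swap)

lemma TZ: "y \<in> W \<Longrightarrow> T y \<in> Z"
  using TW by auto

lemma det_A: "y \<in> W \<Longrightarrow> det (A y) = (det (jac y))\<^sup>2 * det (B (T y))"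
  by (simp add: A_jac det_mul power2_eq_square mult_ac)

lemma det_jac_nz: "y \<in> W \<Longrightarrow> det (jac y) \<noteq> 0"
  using det_A[of y] A.det_pos[of y] by auto

lemma dens_A: "y \<in> W \<Longrightarrow> dens A y = \<bar>det (jac y)\<bar> * dens B (T y)"
  by (simp add: dens_def det_A real_sqrt_mult)

text \<open>This inverts A = J^T B J, with J the Jacobian matrix. The left-hand side times B is the
  identity after cancelling the invertible J, so it is the inverse of B.\<close>

lemma matrix_inv_transform:
  assumes y: "y \<in> W"
  shows "jac y ** matrix_inv (A y) ** transpose (jac y) = matrix_inv (B (T y))"
proof -
  let ?M = "jac y" and ?C = "matrix_inv (A y)" and ?B = "B (T y)" and ?D = "matrix_inv (B (T y))"
  have iM: "invertible ?M" using det_jac_nz[OF y] by (simp add: invertible_det_nz)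
  have "(?M ** ?C ** transpose ?M ** ?B) ** ?M = ?M ** (?C ** A y)"
    by (simp add: A_jac[OF y] matrix_mul_assoc)
  also have "\<dots> = ?M" by (simp add: matrix_inv_mult[OF A.inv[OF y]])
  finally have "((?M ** ?C ** transpose ?M ** ?B) ** ?M) ** matrix_inv ?M = ?M ** matrix_inv ?M" by simp
  then have 1: "?M ** ?C ** transpose ?M ** ?B = mat 1"
    by (simp only: matrix_mul_assoc[symmetric] matrix_inv_mult[OF iM] matrix_mul_rid)
  have "?M ** ?C ** transpose ?M = (?M ** ?C ** transpose ?M) ** (?B ** ?D)"
    by (simp add: matrix_inv_mult[OF B.inv[OF TZ[OF y]]])
  also have "\<dots> = (?M ** ?C ** transpose ?M ** ?B) ** ?D" by (simp only: matrix_mul_assoc)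
  also have "\<dots> = ?D" by (simp add: 1)
  finally show ?thesis .
qed

lemma gi_transform:
  assumes y: "y \<in> W"
  shows "gi B a b (T y) = (\<Sum>i\<in>UNIV. \<Sum>j\<in>UNIV. gi A i j y * (partial i T y $ a * partial j T y $ b))"
proof -
  have "gi B a b (T y) = (jac y ** matrix_inv (A y) ** transpose (jac y)) $ a $ b"
    by (simp add: gi_def matrix_inv_transform[OF y])
  also have "\<dots> = (\<Sum>j\<in>UNIV. \<Sum>i\<in>UNIV. gi A i j y * (partial i T y $ a * partial j T y $ b))"
    by (simp add: matrix_matrix_mult_def jac_def transpose_def gi_def sum_distrib_left sum_distrib_right mult_ac)
  also have "\<dots> = (\<Sum>i\<in>UNIV. \<Sum>j\<in>UNIV. gi A i j y * (partial i T y $ a * partial j T y $ b))" by (rule sum.swap)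
  finally show ?thesis .
qed

text \<open>The trace of a pulled-back covariant 2-tensor is the trace of the tensor at the image
  point. Both the energy density (q made of first derivatives) and the Laplacian (q the Hessian) are
  traces of this kind.\<close>

lemma trace_transform:
  fixes q :: "'m \<Rightarrow> 'm \<Rightarrow> 'b::real_vector"
  assumes y: "y \<in> W"
  shows "(\<Sum>i\<in>UNIV. \<Sum>j\<in>UNIV. gi A i j y *\<^sub>R
      (\<Sum>a\<in>UNIV. \<Sum>b\<in>UNIV. (partial i T y $ a * partial j T y $ b) *\<^sub>R q a b)) =
    (\<Sum>a\<in>UNIV. \<Sum>b\<in>UNIV. gi B a b (T y) *\<^sub>R q a b)"
proof -
  let ?t = "\<lambda>i j a b. (gi A i j y * (partial i T y $ a * partial j T y $ b)) *\<^sub>R q a b"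
  have "(\<Sum>i\<in>UNIV. \<Sum>j\<in>UNIV. gi A i j y *\<^sub>R
      (\<Sum>a\<in>UNIV. \<Sum>b\<in>UNIV. (partial i T y $ a * partial j T y $ b) *\<^sub>R q a b)) =
      (\<Sum>i\<in>UNIV. \<Sum>j\<in>UNIV. \<Sum>a\<in>UNIV. \<Sum>b\<in>UNIV. ?t i j a b)"
    by (simp add: scaleR_sum_right)
  also have "\<dots> = (\<Sum>i\<in>UNIV. \<Sum>a\<in>UNIV. \<Sum>j\<in>UNIV. \<Sum>b\<in>UNIV. ?t i j a b)"
    by (intro sum.cong[OF refl] sum.swap)
  also have "\<dots> = (\<Sum>a\<in>UNIV. \<Sum>i\<in>UNIV. \<Sum>j\<in>UNIV. \<Sum>b\<in>UNIV. ?t i j a b)"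
    by (rule sum.swap)
  also have "\<dots> = (\<Sum>a\<in>UNIV. \<Sum>i\<in>UNIV. \<Sum>b\<in>UNIV. \<Sum>j\<in>UNIV. ?t i j a b)"
    by (intro sum.cong[OF refl] sum.swap)
  also have "\<dots> = (\<Sum>a\<in>UNIV. \<Sum>b\<in>UNIV. \<Sum>i\<in>UNIV. \<Sum>j\<in>UNIV. ?t i j a b)"
    by (intro sum.cong[OF refl] sum.swap)
  also have "\<dots> = (\<Sum>a\<in>UNIV. \<Sum>b\<in>UNIV. gi B a b (T y) *\<^sub>R q a b)"
    by (simp add: gi_transform[OF y] scaleR_sum_left)
  finally show ?thesis .
qed

lemma smooth_T_compose: "smooth_on f Z \<Longrightarrow> smooth_on (\<lambda>z. f (T z)) W"
  by (rule smooth_on_compose[OF A.opn TW smT])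

lemma partial_compose:
  assumes f: "smooth_on f Z" and y: "y \<in> W"
  shows "partial i (\<lambda>z. f (T z)) y = (\<Sum>b\<in>UNIV. partial i T y $ b *\<^sub>R partial b f (T y))"
proof -
  have "((\<lambda>z. f (T z)) has_derivative (\<lambda>v. frechet_derivative f (at (T y)) (frechet_derivative T (at y) v))) (at y)"
    by (rule has_derivative_compose[OF smooth_on_has_derivative[OF smT y] smooth_on_has_derivative[OF f TZ[OF y]]])
  from partial_eqI[OF this, of i] show ?thesis
    by (simp only: smooth_on_derivative_expand[OF f TZ[OF y]] partial_def[of i T])
qed

lemma grad_inner_transform:
  assumes u: "smooth_on u Z" and f: "smooth_on f Z" and y: "y \<in> W"
  shows "grad_inner A (\<lambda>z. u (T z)) (\<lambda>z. f (T z)) y = grad_inner B u f (T y)"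
proof -
  have "partial i (\<lambda>z. u (T z)) y \<bullet> partial j (\<lambda>z. f (T z)) y =
      (\<Sum>a\<in>UNIV. \<Sum>b\<in>UNIV. (partial i T y $ a * partial j T y $ b) *\<^sub>R (partial a u (T y) \<bullet> partial b f (T y)))" for i j
    unfolding partial_compose[OF u y] partial_compose[OF f y] inner_sum_left inner_sum_right
    by (simp add: mult_ac) (rule sum.swap)
  then show ?thesis
    using trace_transform[OF y, of "\<lambda>a b. partial a u (T y) \<bullet> partial b f (T y)"]
    by (simp add: grad_inner_def)
qed

text \<open>The product rule for <d_i T, B d_j T>: the outer terms carry the second derivatives of
  T, the middle one differentiates B along \<open>partial l T\<close>.\<close>

lemma partial_A:
  assumes y: "y \<in> W"
  shows "partial l (\<lambda>z. A z $ i $ j) y = partial l (partial i T) y \<bullet> (B (T y) *v partial j T y) +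
    partial i T y \<bullet> (B.DG (partial l T y) (T y) *v partial j T y) +
    partial i T y \<bullet> (B (T y) *v partial l (partial j T) y)"
proof -
  note sm = smooth_on_partial[OF smT] smooth_T_compose[OF B.smG]
  have smv: "smooth_on (\<lambda>z. B (T z) *v partial j T z) W"
    by (rule smooth_on_bilinear[OF bounded_bilinear_matrix_vector_mult A.opn sm(2,1)])
  have pB: "partial l (\<lambda>z. B (T z)) y = B.DG (partial l T y) (T y)"
    by (simp add: partial_compose[OF B.smG y] smooth_on_derivative_expand[OF B.smG TZ[OF y]])
  have "partial l (\<lambda>z. A z $ i $ j) y = partial l (\<lambda>z. partial i T z \<bullet> (B (T z) *v partial j T z)) y"
    by (rule partial_cong[OF A.opn y A_eq A.smooth_G])
  also have "\<dots> = partial i T y \<bullet> partial l (\<lambda>z. B (T z) *v partial j T z) y +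
      partial l (partial i T) y \<bullet> (B (T y) *v partial j T y)"
    by (rule partial_inner[OF sm(1) smv y])
  also have "partial l (\<lambda>z. B (T z) *v partial j T z) y =
      B (T y) *v partial l (partial j T) y + B.DG (partial l T y) (T y) *v partial j T y"
    unfolding partial_bilinear[OF bounded_bilinear_matrix_vector_mult sm(2,1) y] pB ..
  finally show ?thesis by (simp add: inner_add_right)
qed

text \<open>By the Koszul formula both sides have the same inner products with the columns of the Jacobian
  matrix, which span the space.\<close>

lemma chr_transform:
  assumes y: "y \<in> W"
  shows "(\<Sum>k\<in>UNIV. chr A k i j y *\<^sub>R partial k T y) =
    partial i (partial j T) y + B.chr_vec (partial i T y) (partial j T y) (T y)"
proof -
  let ?m = "\<lambda>i. partial i T y" and ?B = "B (T y)" and ?H = "\<lambda>i j. partial i (partial j T) y"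
  let ?L = "\<Sum>k\<in>UNIV. chr A k i j y *\<^sub>R ?m k" and ?R = "?H i j + B.chr_vec (?m i) (?m j) (T y)"
  have H: "?H i j = ?H j i" for i j by (rule partial_commute[OF A.opn smT y])
  have Bs: "u \<bullet> (?B *v v) = v \<bullet> (?B *v u)" for u v
  proof -
    have "transpose ?B = ?B" using B.pd[OF TZ[OF y]] by (simp add: pos_def_def)
    then have "?B *v u = u v* ?B" using transpose_matrix_vector[of ?B u] by simp
    then show ?thesis by (simp add: dot_lmul_matrix inner_commute[of v])
  qed
  have Ds: "u \<bullet> (B.DG w (T y) *v v) = v \<bullet> (B.DG w (T y) *v u)" for u v w
    unfolding B.DG_form[OF TZ[OF y]]
    by (rule sum.cong[OF refl], rule trans[OF sum.swap]) (simp add: B.dG_sym[OF TZ[OF y]] mult_ac)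
  have eq: "?m l \<bullet> (?B *v (?L - ?R)) = 0" for l
  proof -
    have "?m l \<bullet> (?B *v ?L) = (\<Sum>k\<in>UNIV. A y $ l $ k * chr A k i j y)"
      by (simp add: matrix_vector_mult_scaleR linear_sum[OF matrix_vector_mul_linear] inner_sum_right A_eq[OF y] mult.commute)
    also have "\<dots> = (partial i (\<lambda>z. A z $ j $ l) y + partial j (\<lambda>z. A z $ i $ l) y - partial l (\<lambda>z. A z $ i $ j) y) / 2"
      by (rule A.lower_chr[OF y])
    \<comment> \<open>Of the six terms with second derivatives of T, four cancel by the symmetry of
      B and of second derivatives, and the other two coincide. The three terms that differentiate B
      form the Koszul expression.\<close>
    also have "\<dots> = ?m l \<bullet> (?B *v ?H i j) + ?m l \<bullet> (?B *v B.chr_vec (?m i) (?m j) (T y))"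
      unfolding partial_A[OF y] B.koszul[OF TZ[OF y]]
      using H[of i j] H[of i l] H[of j l] Bs[of "?H i j" "?m l"] Bs[of "?m j" "?H i l"] Bs[of "?m j" "?H l i"] Bs[of "?H l j" "?m i"]
      by (simp add: field_simps)
    finally show ?thesis by (simp add: matrix_vector_mult_diff_distrib matrix_vector_right_distrib inner_diff_right inner_add_right)
  qed
  have "transpose (jac y) *v (?B *v (?L - ?R)) = 0"
  proof -
    have "(transpose (jac y) *v w) $ l = ?m l \<bullet> w" for w l
      by (simp add: jac_def transpose_def matrix_vector_mult_def inner_vec_def)
    then show ?thesis using eq by (simp add: vec_eq_iff)
  qed
  moreover have "invertible (transpose (jac y))" "invertible ?B"
    using det_jac_nz[OF y] B.inv[OF TZ[OF y]] by (auto simp: invertible_det_nz)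
  ultimately have "?L - ?R = 0"
    unfolding invertible_left_inverse matrix_left_invertible_ker by blast
  then show ?thesis by simp
qed

text \<open>The second derivatives of f o T contain the non-tensorial term Df applied to the second
  derivative of T. By \<open>chr_transform\<close> the Christoffel part contains the same term, so
  it cancels in the Hessian, which is therefore pulled back as a tensor; its trace is handled by
  \<open>trace_transform\<close>.\<close>

lemma lap_transform:
  fixes f :: "real ^ 'm \<Rightarrow> 'b::euclidean_space"
  assumes f: "smooth_on f Z" and y: "y \<in> W"
  shows "lap A (\<lambda>z. f (T z)) y = lap B f (T y)"
proof -
  let ?m = "\<lambda>i. partial i T y"
  let ?q = "\<lambda>a b. partial a (partial b f) (T y) - (\<Sum>c\<in>UNIV. chr B c a b (T y) *\<^sub>R partial c f (T y))"
  let ?D = "frechet_derivative f (at (T y))"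
  note D = smooth_on_derivative_expand[OF f TZ[OF y], symmetric]
  note lD = smooth_on_linear_derivative[OF f TZ[OF y]]
  have "partial i (partial j (\<lambda>z. f (T z))) y - (\<Sum>k\<in>UNIV. chr A k i j y *\<^sub>R partial k (\<lambda>z. f (T z)) y) =
      (\<Sum>a\<in>UNIV. \<Sum>b\<in>UNIV. (?m i $ a * ?m j $ b) *\<^sub>R ?q a b)" for i j
  proof -
    note smTb = smooth_on_nth[OF A.opn smooth_on_partial[OF smT]]
    note smfb = smooth_T_compose[OF smooth_on_partial[OF f]]
    have smt: "smooth_on (\<lambda>z. partial j T z $ b *\<^sub>R partial b f (T z)) W" for b
      by (rule smooth_on_scaleR[OF A.opn smTb smfb])
    have "partial i (partial j (\<lambda>z. f (T z))) y = partial i (\<lambda>z. \<Sum>b\<in>UNIV. partial j T z $ b *\<^sub>R partial b f (T z)) y"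
      by (rule partial_cong[OF A.opn y partial_compose[OF f] smooth_on_partial[OF smooth_T_compose[OF f]]])
    also have "\<dots> = (\<Sum>b\<in>UNIV. partial i (\<lambda>z. partial j T z $ b *\<^sub>R partial b f (T z)) y)"
      by (rule partial_sum[OF smt y])
    also have "\<dots> = (\<Sum>b\<in>UNIV. ?m j $ b *\<^sub>R (\<Sum>a\<in>UNIV. ?m i $ a *\<^sub>R partial a (partial b f) (T y))
        + partial i (partial j T) y $ b *\<^sub>R partial b f (T y))"
      by (simp only: partial_scaleR[OF smTb smfb y] partial_nth[OF smooth_on_partial[OF smT] y]
        partial_compose[OF smooth_on_partial[OF f] y])
    also have "\<dots> = (\<Sum>a\<in>UNIV. \<Sum>b\<in>UNIV. (?m i $ a * ?m j $ b) *\<^sub>R partial a (partial b f) (T y)) + ?D (partial i (partial j T) y)"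
      unfolding D sum.distrib scaleR_sum_right scaleR_scaleR
      by (subst sum.swap) (simp add: mult.commute)
    finally have 1: "partial i (partial j (\<lambda>z. f (T z))) y =
      (\<Sum>a\<in>UNIV. \<Sum>b\<in>UNIV. (?m i $ a * ?m j $ b) *\<^sub>R partial a (partial b f) (T y)) + ?D (partial i (partial j T) y)" .
    have "(\<Sum>k\<in>UNIV. chr A k i j y *\<^sub>R partial k (\<lambda>z. f (T z)) y) = ?D (\<Sum>k\<in>UNIV. chr A k i j y *\<^sub>R ?m k)"
      by (simp add: partial_compose[OF f y] D linear_sum[OF lD] linear_cmul[OF lD])
    also have "\<dots> = ?D (partial i (partial j T) y) + ?D (B.chr_vec (?m i) (?m j) (T y))"
      by (simp only: chr_transform[OF y] linear_add[OF lD])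
    also have "?D (B.chr_vec (?m i) (?m j) (T y)) =
        (\<Sum>c\<in>UNIV. \<Sum>a\<in>UNIV. \<Sum>b\<in>UNIV. (?m i $ a * ?m j $ b) *\<^sub>R (chr B c a b (T y) *\<^sub>R partial c f (T y)))"
      by (simp add: D[symmetric] B.chr_vec_def scaleR_sum_left)
    also have "\<dots> = (\<Sum>a\<in>UNIV. \<Sum>c\<in>UNIV. \<Sum>b\<in>UNIV. (?m i $ a * ?m j $ b) *\<^sub>R (chr B c a b (T y) *\<^sub>R partial c f (T y)))"
      by (rule sum.swap)
    also have "\<dots> = (\<Sum>a\<in>UNIV. \<Sum>b\<in>UNIV. \<Sum>c\<in>UNIV. (?m i $ a * ?m j $ b) *\<^sub>R (chr B c a b (T y) *\<^sub>R partial c f (T y)))"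
      by (intro sum.cong[OF refl] sum.swap)
    also have "\<dots> = (\<Sum>a\<in>UNIV. \<Sum>b\<in>UNIV. (?m i $ a * ?m j $ b) *\<^sub>R (\<Sum>c\<in>UNIV. chr B c a b (T y) *\<^sub>R partial c f (T y)))"
      by (simp only: scaleR_sum_right)
    finally show ?thesis unfolding 1 by (simp add: scaleR_diff_right sum_subtractf)
  qed
  then show ?thesis using trace_transform[OF y, of ?q] by (simp add: lap_def)
qed

end

section \<open>Change of variables\<close>

text \<open>A bridge from the gauge integral, in which the change of variables theorem is phrased,
  to the \<open>nn_integral\<close> over \<open>lborel\<close> that defines the volume measure.
  Borel measurability of the cut-off function moves integrability from the completed measure to
  \<open>lborel\<close>.\<close>

lemma nn_integral_lebesgue_on_eq:
  fixes f :: "'a::euclidean_space \<Rightarrow> real"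
  assumes S: "S \<in> sets borel" and m: "(\<lambda>x. indicator S x * f x) \<in> borel_measurable borel"
    and nn: "\<And>x. x \<in> S \<Longrightarrow> f x \<ge> 0" and ai: "f absolutely_integrable_on S"
  shows "(\<integral>\<^sup>+x. ennreal (f x) * indicator S x \<partial>lborel) = ennreal (integral S f)"
proof -
  have "integrable lborel (\<lambda>x. indicator S x * f x)"
    using ai m unfolding set_integrable_def by (simp add: integrable_completion)
  then have "(\<integral>\<^sup>+x. ennreal (indicator S x * f x) \<partial>lborel) = ennreal (\<integral>x. indicator S x * f x \<partial>lborel)"
    by (rule nn_integral_eq_integral) (use nn in \<open>auto simp: indicator_def\<close>)
  also have "(\<integral>x. indicator S x * f x \<partial>lborel) = (LINT x:S|lebesgue. f x)"
    using m by (simp add: set_lebesgue_integral_def integral_completion)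
  also have "\<dots> = integral S f" by (rule set_lebesgue_integral_eq_integral(2)[OF ai])
  also have "(\<integral>\<^sup>+x. ennreal (indicator S x * f x) \<partial>lborel) = (\<integral>\<^sup>+x. ennreal (f x) * indicator S x \<partial>lborel)"
    by (rule nn_integral_cong) (simp add: indicator_def)
  finally show ?thesis .
qed

text \<open>The integrals over \<open>S\<close> may be infinite, so the change of variables theorem
  for integrable functions is applied on the intersections of \<open>S\<close> with a compact
  exhaustion of \<open>W\<close>, where the continuous integrand is integrable; then the exhaustion
  tends to \<open>W\<close>.\<close>

lemma nn_integral_substitution_wellorder:
  fixes T :: "real ^ 'n::{finite, wellorder} \<Rightarrow> real ^ 'n::_" and f :: "real ^ 'n::_ \<Rightarrow> real"
  assumes W: "open W" and inj: "inj_on T W"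
    and der: "\<And>x. x \<in> W \<Longrightarrow> (T has_derivative T' x) (at x)"
    and bor: "\<And>S. S \<in> sets borel \<Longrightarrow> S \<subseteq> W \<Longrightarrow> T ` S \<in> sets borel"
    and cont: "continuous_on W (\<lambda>x. \<bar>det (matrix (T' x))\<bar> * f (T x))"
    and f: "continuous_on (T ` W) f" "\<And>x. x \<in> W \<Longrightarrow> f (T x) \<ge> 0"
    and S: "S \<in> sets borel" "S \<subseteq> W"
  shows "(\<integral>\<^sup>+x. ennreal (\<bar>det (matrix (T' x))\<bar> * f (T x)) * indicator S x \<partial>lborel) =
    (\<integral>\<^sup>+x. ennreal (f x) * indicator (T ` S) x \<partial>lborel)"
proof -
  let ?p = "\<lambda>x. \<bar>det (matrix (T' x))\<bar> * f (T x)"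
  have Wb: "W \<in> sets borel" using W by auto
  have TWb: "T ` W \<in> sets borel" by (rule bor[OF Wb]) simp
  have pm: "(\<lambda>x. indicator A x * ?p x) \<in> borel_measurable borel" if "A \<in> sets borel" "A \<subseteq> W" for A
    using borel_measurable_continuous_on_indicator[OF that(1) continuous_on_subset[OF cont that(2)]] by simp
  have fm: "(\<lambda>x. indicator A x * f x) \<in> borel_measurable borel" if "A \<in> sets borel" "A \<subseteq> T ` W" for A
    using borel_measurable_continuous_on_indicator[OF that(1) continuous_on_subset[OF f(1) that(2)]] by simp
  obtain C :: "nat \<Rightarrow> (real ^ 'n::_) set" where C: "\<And>n. compact (C n)" "\<And>n. C n \<subseteq> W"
    "\<And>n. C n \<subseteq> interior (C (Suc n))" "\<Union>(range C) = W"
    using open_Union_compact_subsets[OF W] by metis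
  define A where "A n = S \<inter> C n" for n
  have Ab: "A n \<in> sets borel" "A n \<subseteq> W" "T ` A n \<in> sets borel" "T ` A n \<subseteq> T ` W" for n
  proof -
    show "A n \<in> sets borel" using S(1) borel_compact[OF C(1)] by (auto simp: A_def)
    show "A n \<subseteq> W" using S(2) by (auto simp: A_def)
    with \<open>A n \<in> sets borel\<close> show "T ` A n \<in> sets borel" by (rule bor)
    show "T ` A n \<subseteq> T ` W" using \<open>A n \<subseteq> W\<close> by auto
  qed
  have "incseq C" using C(3) interior_subset by (intro incseq_SucI) blast
  then have Ainc: "incseq A" unfolding A_def incseq_def by blast
  then have Tinc: "incseq (\<lambda>n. T ` A n)" by (simp add: incseq_def image_mono)
  have AS: "(\<Union>n. A n) = S" using S(2) C(4) by (auto simp: A_def)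
  have eq: "(\<integral>\<^sup>+x. ennreal (?p x) * indicator (A n) x \<partial>lborel) =
      (\<integral>\<^sup>+x. ennreal (f x) * indicator (T ` A n) x \<partial>lborel)" for n
  proof -
    have "set_integrable lborel (C n) ?p"
      unfolding set_integrable_def
      by (rule borel_integrable_compact[OF C(1) continuous_on_subset[OF cont C(2)]])
    then have "set_integrable lborel (A n) ?p"
      by (rule set_integrable_subset) (use Ab in \<open>auto simp: A_def\<close>)
    then have ai: "?p absolutely_integrable_on A n"
      using pm[OF Ab(1,2)] unfolding set_integrable_def by (simp add: integrable_completion)
    \<comment> \<open>The theorem speaks about vector-valued integrands, hence the detour through
      \<open>real ^ 1\<close>.\<close>
    have "((\<lambda>x. \<bar>det (matrix (T' x))\<bar> *\<^sub>R vec (f (T x)) :: real ^ 1) absolutely_integrable_on A n \<and>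
         integral (A n) (\<lambda>x. \<bar>det (matrix (T' x))\<bar> *\<^sub>R vec (f (T x)) :: real ^ 1) = vec (integral (A n) ?p)) \<longleftrightarrow>
        ((\<lambda>x. vec (f x) :: real ^ 1) absolutely_integrable_on T ` A n \<and>
         integral (T ` A n) (\<lambda>x. vec (f x) :: real ^ 1) = vec (integral (A n) ?p))"
    proof (rule has_absolute_integral_change_of_variables)
      show "A n \<in> sets lebesgue" using Ab(1)[of n] by simp
      show "(T has_derivative T' x) (at x within A n)" if "x \<in> A n" for x
        using der[of x] that Ab(2)[of n] by (auto intro: has_derivative_at_withinI)
      show "inj_on T (A n)" by (rule inj_on_subset[OF inj Ab(2)])
    qed
    with ai have ai': "f absolutely_integrable_on T ` A n" and int: "integral (T ` A n) f = integral (A n) ?p"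
      by (simp_all add: absolutely_integrable_on_1_iff integral_on_1_eq)
    show ?thesis
      by (subst (1 2) nn_integral_lebesgue_on_eq) (use Ab[of n] f(2) ai ai' int pm fm in auto)
  qed
  \<comment> \<open>As measures with these densities, both sides pass to the limit by continuity
    from below along \<open>A n\<close> and its image.\<close>
  let ?M = "density lborel (\<lambda>x. ennreal (indicator W x * ?p x))"
  let ?N = "density lborel (\<lambda>x. ennreal (indicator (T ` W) x * f x))"
  have mM: "(\<lambda>x. ennreal (indicator W x * ?p x)) \<in> borel_measurable lborel"
    using pm[OF Wb] by simp
  have mN: "(\<lambda>x. ennreal (indicator (T ` W) x * f x)) \<in> borel_measurable lborel"
    using fm[OF TWb] by simp
  have M: "emeasure ?M A = (\<integral>\<^sup>+x. ennreal (?p x) * indicator A x \<partial>lborel)" if "A \<in> sets borel" "A \<subseteq> W" for A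
    using that by (subst emeasure_density[OF mM]) (auto intro!: nn_integral_cong simp: indicator_def)
  have N: "emeasure ?N A = (\<integral>\<^sup>+x. ennreal (f x) * indicator A x \<partial>lborel)" if "A \<in> sets borel" "A \<subseteq> T ` W" for A
    using that by (subst emeasure_density[OF mN]) (auto intro!: nn_integral_cong simp: indicator_def)
  have "emeasure ?M S = (SUP n. emeasure ?M (A n))"
    unfolding AS[symmetric] by (rule SUP_emeasure_incseq[symmetric]) (use Ab Ainc in auto)
  also have "\<dots> = (SUP n. emeasure ?N (T ` A n))"
    using eq by (simp add: M[OF Ab(1,2)] N[OF Ab(3,4)])
  also have "\<dots> = emeasure ?N (\<Union>n. T ` A n)"
    by (rule SUP_emeasure_incseq) (use Ab Tinc in auto)
  also have "(\<Union>n. T ` A n) = T ` S" unfolding AS[symmetric] by auto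
  finally show ?thesis
    using M[OF S] N[OF bor[OF S]] S(2) by (simp add: image_mono)
qed

section \<open>Change of variables for arbitrary finite index types\<close>

text \<open>The change of variables theorem of the library needs an index type of class
  \<^class>\<open>wellorder\<close>; the type \<open>'a wo\<close> is a well-ordered copy of an arbitrary finite type.\<close>

typedef 'a wo = "UNIV :: 'a set" morphisms un_wo to_wo ..

text \<open>Any injection will do: the order is pulled back along it, so that well-foundedness is
  inherited from the naturals.\<close>

definition wo_rank :: "'a::finite wo \<Rightarrow> nat" where
  "wo_rank = (SOME f. inj f)"

lemma bij_un_wo: "bij un_wo"
  by (metis UNIV_I bij_betw_def inj_on_def surj_def to_wo_inverse un_wo_inject)

instance wo :: (finite) finite
proof
  have "inj (un_wo :: 'a wo \<Rightarrow> 'a)" using bij_un_wo bij_is_inj by auto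
  then show "finite (UNIV :: 'a wo set)" by (rule finite_imageD[rotated]) simp
qed

lemma inj_wo_rank: "inj (wo_rank :: 'a::finite wo \<Rightarrow> nat)"
proof -
  have "\<exists>f :: 'a wo \<Rightarrow> nat. inj f" using finite_imp_inj_to_nat_seg[OF finite[of UNIV]] by blast
  then show ?thesis unfolding wo_rank_def by (rule someI_ex)
qed

instantiation wo :: (finite) wellorder
begin

definition less_eq_wo :: "'a wo \<Rightarrow> 'a wo \<Rightarrow> bool" where "x \<le> y \<longleftrightarrow> wo_rank x \<le> wo_rank y"
definition less_wo :: "'a wo \<Rightarrow> 'a wo \<Rightarrow> bool" where "x < y \<longleftrightarrow> wo_rank x < wo_rank y"

instance
proof
  fix P :: "'a wo \<Rightarrow> bool" and a :: "'a wo"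
  assume step: "\<And>x. (\<And>y. y < x \<Longrightarrow> P y) \<Longrightarrow> P x"
  show "P a"
    by (induction a rule: measure_induct[of wo_rank]) (rule step, simp add: less_wo_def)
qed (auto simp: less_eq_wo_def less_wo_def dest: injD[OF inj_wo_rank])

end

definition reindex :: "real ^ 'm::finite \<Rightarrow> real ^ 'm wo" where "reindex v = (\<chi> i. v $ un_wo i)"
definition unindex :: "real ^ 'm wo \<Rightarrow> real ^ 'm::finite" where "unindex v = (\<chi> i. v $ to_wo i)"

lemma unindex_reindex [simp]: "unindex (reindex v) = v"
  and reindex_unindex [simp]: "reindex (unindex w) = w"
  by (simp_all add: reindex_def unindex_def vec_eq_iff to_wo_inverse un_wo_inverse)

lemma linear_reindex: "linear reindex" and linear_unindex: "linear unindex"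
  by (simp_all add: linear_iff reindex_def unindex_def vec_eq_iff)

text \<open>Renaming coordinates maps boxes to boxes with the same side lengths, and Lebesgue
  measure is determined by its values on boxes.\<close>

lemma distr_unindex: "distr lborel borel unindex = (lborel :: (real ^ 'm::finite) measure)"
proof (rule lborel_eqI[symmetric])
  have c: "continuous_on UNIV (unindex :: real ^ 'm wo \<Rightarrow> real ^ 'm)"
    by (rule linear_continuous_on) (simp add: linear_unindex linear_conv_bounded_linear[symmetric])
  have m: "(unindex :: real ^ 'm wo \<Rightarrow> real ^ 'm) \<in> measurable lborel borel"
    using borel_measurable_continuous_onI[OF c] by simp
  fix l u :: "real ^ 'm"
  assume lu: "\<And>b. b \<in> Basis \<Longrightarrow> l \<bullet> b \<le> u \<bullet> b"
  have B: "(\<Prod>b\<in>Basis. w \<bullet> b) = (\<Prod>i\<in>UNIV. w $ i)" for w :: "real ^ 'k::finite"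
  proof -
    have "(\<Prod>b\<in>Basis. w \<bullet> b) = (\<Prod>b\<in>range (\<lambda>i. axis i 1 :: real ^ 'k). w \<bullet> b)"
      by (rule prod.cong) (auto simp: Basis_vec_def)
    also have "\<dots> = (\<Prod>i\<in>UNIV. w \<bullet> axis i 1)"
      by (rule prod.reindex[unfolded o_def]) (auto simp: inj_on_def axis_eq_axis)
    finally show ?thesis by (simp add: inner_axis)
  qed
  have v: "unindex -` box l u = box (reindex l) (reindex u)"
  proof -
    have "unindex w \<in> box l u \<longleftrightarrow> w \<in> box (reindex l) (reindex u)" for w
    proof -
      have "(\<forall>i. l $ i < w $ to_wo i \<and> w $ to_wo i < u $ i) \<longleftrightarrow> (\<forall>j. l $ un_wo j < w $ j \<and> w $ j < u $ un_wo j)"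
        by (metis UNIV_I to_wo_inverse un_wo_inverse)
      then show ?thesis by (simp add: mem_box_cart unindex_def reindex_def)
    qed
    then show ?thesis by auto
  qed
  have lu': "reindex l \<bullet> b \<le> reindex u \<bullet> b" if "b \<in> Basis" for b
  proof -
    have "l $ i \<le> u $ i" for i using lu[of "axis i 1"] by (simp add: inner_axis axis_in_Basis_iff)
    then show ?thesis using that by (auto simp: Basis_vec_def inner_axis reindex_def)
  qed
  have "emeasure (distr lborel borel unindex) (box l u) = emeasure lborel (box (reindex l) (reindex u))"
    using m by (subst emeasure_distr) (auto simp: v)
  also have "\<dots> = ennreal (\<Prod>b\<in>Basis. (reindex u - reindex l) \<bullet> b)"
    using lu' by (simp add: emeasure_lborel_box_eq)
  also have "(\<Prod>b\<in>Basis. (reindex u - reindex l) \<bullet> b) = (\<Prod>i\<in>UNIV. (u - l) $ un_wo i)"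
    unfolding B by (simp add: reindex_def)
  also have "\<dots> = (\<Prod>i\<in>UNIV. (u - l) $ i)"
    using prod.reindex_bij_betw[OF bij_un_wo, of "\<lambda>i. (u - l) $ i"] by simp
  finally show "emeasure (distr lborel borel unindex) (box l u) = (\<Prod>b\<in>Basis. (u - l) \<bullet> b)"
    by (simp add: B)
qed simp

text \<open>Transporting permutations along the bijection of index types is a bijection that
  preserves signs, so it matches the two Leibniz sums term by term.\<close>

lemma det_reindex: "det (\<chi> i j. A $ un_wo i $ un_wo j) = det (A :: real ^ 'm::finite ^ 'm)"
proof -
  let ?f = "to_wo :: 'm \<Rightarrow> 'm wo"
  have bf: "bij ?f" by (metis UNIV_I bij_betw_def inj_on_def surj_def to_wo_inverse un_wo_inverse)
  have inv: "map_permutation UNIV un_wo (map_permutation UNIV ?f p) = p" if "p permutes UNIV" for p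
    by (rule map_permutation_compose_inv[OF bf that]) (simp add: to_wo_inverse)
  have inv': "map_permutation UNIV ?f (map_permutation UNIV un_wo q) = q" if "q permutes UNIV" for q
    by (rule map_permutation_compose_inv[OF bij_un_wo that]) (simp add: un_wo_inverse)
  have bp: "bij_betw (map_permutation UNIV ?f) {p. p permutes UNIV} {p. p permutes UNIV}"
    by (rule bij_betw_byWitness[where f' = "map_permutation UNIV un_wo"])
      (auto simp: inv inv' map_permutation_permutes[OF bf] map_permutation_permutes[OF bij_un_wo])
  have "det (\<chi> i j. A $ un_wo i $ un_wo j) = (\<Sum>p | p permutes UNIV. of_int (sign (map_permutation UNIV ?f p)) *
      (\<Prod>i\<in>UNIV. A $ un_wo i $ un_wo (map_permutation UNIV ?f p i)))"
    unfolding det_def by (subst sum.reindex_bij_betw[OF bp, symmetric]) simp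
  also have "\<dots> = det A"
    unfolding det_def
  proof (intro sum.cong refl arg_cong2[where f = "(*)"])
    fix p :: "'m \<Rightarrow> 'm" assume "p \<in> {p. p permutes UNIV}"
    then have p: "p permutes UNIV" by simp
    show "(of_int (sign (map_permutation UNIV ?f p)) :: real) = of_int (sign p)"
      using sign_map_permutation[OF bij_is_inj[OF bf] p] by simp
    show "(\<Prod>i\<in>UNIV. A $ un_wo i $ un_wo (map_permutation UNIV ?f p i)) = (\<Prod>i\<in>UNIV. A $ i $ p i)"
      by (subst prod.reindex_bij_betw[OF bf, symmetric])
        (simp add: map_permutation_apply[OF bij_is_inj[OF bf]] to_wo_inverse)
  qed
  finally show ?thesis .
qed

lemma nn_integral_unindex:
  assumes "h \<in> borel_measurable borel"
  shows "(\<integral>\<^sup>+x. h x \<partial>lborel) = (\<integral>\<^sup>+x. h (unindex x) \<partial>lborel)"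
proof -
  have m: "(unindex :: real ^ 'm wo \<Rightarrow> real ^ 'm) \<in> measurable lborel borel"
    using borel_measurable_continuous_onI[OF linear_continuous_on[of unindex UNIV]]
    by (simp add: linear_unindex linear_conv_bounded_linear[symmetric])
  show ?thesis
    by (subst distr_unindex[symmetric], subst nn_integral_distr[OF m]) (use assms in auto)
qed

text \<open>Conjugate T with the renaming of coordinates. Neither the Jacobian determinant nor
  Lebesgue measure changes, by \<open>det_reindex\<close> and \<open>distr_unindex\<close>.\<close>

lemma nn_integral_substitution:
  fixes T :: "real ^ 'm::finite \<Rightarrow> real ^ 'm" and f :: "real ^ 'm \<Rightarrow> real"
  assumes W: "open W" and inj: "inj_on T W"
    and der: "\<And>x. x \<in> W \<Longrightarrow> (T has_derivative T' x) (at x)"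
    and bor: "\<And>S. S \<in> sets borel \<Longrightarrow> S \<subseteq> W \<Longrightarrow> T ` S \<in> sets borel"
    and cont: "continuous_on W (\<lambda>x. \<bar>det (matrix (T' x))\<bar> * f (T x))"
    and f: "continuous_on (T ` W) f" "\<And>x. x \<in> W \<Longrightarrow> f (T x) \<ge> 0"
    and S: "S \<in> sets borel" "S \<subseteq> W"
  shows "(\<integral>\<^sup>+x. ennreal (\<bar>det (matrix (T' x))\<bar> * f (T x)) * indicator S x \<partial>lborel) =
    (\<integral>\<^sup>+x. ennreal (f x) * indicator (T ` S) x \<partial>lborel)"
proof -
  let ?T = "\<lambda>x. reindex (T (unindex x))" and ?T' = "\<lambda>x h. reindex (T' (unindex x) (unindex h))"
  have bl: "bounded_linear (reindex :: real ^ 'm \<Rightarrow> _)" "bounded_linear (unindex :: _ \<Rightarrow> real ^ 'm)"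
    by (simp_all add: linear_reindex linear_unindex linear_conv_bounded_linear[symmetric])
  have c: "continuous_on A (reindex :: real ^ 'm \<Rightarrow> _)" "continuous_on B (unindex :: _ \<Rightarrow> real ^ 'm)" for A B
    by (rule linear_continuous_on[OF bl(1)], rule linear_continuous_on[OF bl(2)])
  have im: "reindex ` A = unindex -` A" for A :: "(real ^ 'm) set"
    by (auto intro: image_eqI[of _ _ "unindex _"])
  have im': "unindex ` B = reindex -` B" for B :: "(real ^ 'm wo) set"
    by (auto intro: image_eqI[of _ _ "reindex _"])
  have b: "reindex ` A \<in> sets borel" if "A \<in> sets borel" for A :: "(real ^ 'm) set"
    using measurable_sets[OF borel_measurable_continuous_onI[OF c(2)] that] by (simp add: im)
  have b': "unindex ` B \<in> sets borel" if "B \<in> sets borel" for B :: "(real ^ 'm wo) set"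
    using measurable_sets[OF borel_measurable_continuous_onI[OF c(1)] that] by (simp add: im')
  have Timg: "?T ` (reindex ` A) = reindex ` (T ` A)" for A by (simp add: image_image)
  have det: "det (matrix (?T' x)) = det (matrix (T' (unindex x)))" for x
  proof -
    have "matrix (?T' x) = (\<chi> i j. matrix (T' (unindex x)) $ un_wo i $ un_wo j)"
    proof -
      have u: "unindex (axis j 1) = (axis (un_wo j) 1 :: real ^ 'm)" for j
        by (auto simp: unindex_def axis_def vec_eq_iff to_wo_inverse un_wo_inverse)
      show ?thesis by (simp add: matrix_def vec_eq_iff reindex_def u)
    qed
    then show ?thesis by (simp add: det_reindex)
  qed
  have TWb: "T ` W \<in> sets borel" by (rule bor) (use W in auto)
  have "(\<integral>\<^sup>+x. ennreal (\<bar>det (matrix (?T' x))\<bar> * f (unindex (?T x))) * indicator (reindex ` S) x \<partial>lborel) =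
      (\<integral>\<^sup>+x. ennreal (f (unindex x)) * indicator (?T ` (reindex ` S)) x \<partial>lborel)"
  proof (rule nn_integral_substitution_wellorder[where W = "reindex ` W" and f = "\<lambda>x. f (unindex x)" and T = ?T and T' = ?T'])
    show "open (reindex ` W)"
      unfolding im by (rule open_vimage[OF W c(2)])
    show "inj_on ?T (reindex ` W)"
      using inj by (auto simp: inj_on_def dest!: arg_cong[where f = unindex])
    show "(?T has_derivative ?T' x) (at x)" if "x \<in> reindex ` W" for x
    proof -
      have "unindex x \<in> W" using that by auto
      from has_derivative_compose[OF bounded_linear_imp_has_derivative[OF bl(2)] der[OF this]]
      show ?thesis by (rule bounded_linear.has_derivative[OF bl(1)])
    qed
    show "?T ` A \<in> sets borel" if "A \<in> sets borel" "A \<subseteq> reindex ` W" for A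
    proof -
      have "A = reindex ` (unindex ` A)" by (simp add: image_image)
      then have "?T ` A = reindex ` (T ` (unindex ` A))" by (metis Timg)
      moreover have "unindex ` A \<subseteq> W" using that(2) by auto
      ultimately show ?thesis using b[OF bor[OF b'[OF that(1)]]] by simp
    qed
    show "continuous_on (reindex ` W) (\<lambda>x. \<bar>det (matrix (?T' x))\<bar> * f (unindex (?T x)))"
      unfolding det unindex_reindex
      by (rule continuous_on_compose2[OF cont c(2)]) auto
    show "continuous_on (?T ` (reindex ` W)) (\<lambda>x. f (unindex x))"
      unfolding Timg by (rule continuous_on_compose2[OF f(1) c(2)]) auto
    show "0 \<le> f (unindex (?T x))" if "x \<in> reindex ` W" for x using that f(2) by auto
  qed (use S b in auto)
  then have eq: "(\<integral>\<^sup>+x. ennreal (\<bar>det (matrix (T' (unindex x)))\<bar> * f (T (unindex x))) * indicator S (unindex x) \<partial>lborel) =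
      (\<integral>\<^sup>+x. ennreal (f (unindex x)) * indicator (T ` S) (unindex x) \<partial>lborel)"
    unfolding Timg det unindex_reindex by (simp add: im indicator_def)
  have "(\<lambda>x. indicator S x *\<^sub>R (\<bar>det (matrix (T' x))\<bar> * f (T x))) \<in> borel_measurable borel"
    by (rule borel_measurable_continuous_on_indicator[OF S(1) continuous_on_subset[OF cont S(2)]])
  then have "(\<lambda>x. ennreal (indicator S x *\<^sub>R (\<bar>det (matrix (T' x))\<bar> * f (T x)))) \<in> borel_measurable borel" by simp
  also have "(\<lambda>x. ennreal (indicator S x *\<^sub>R (\<bar>det (matrix (T' x))\<bar> * f (T x)))) =
      (\<lambda>x. ennreal (\<bar>det (matrix (T' x))\<bar> * f (T x)) * indicator S x)" by (auto simp: indicator_def)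
  finally have m1: "(\<lambda>x. ennreal (\<bar>det (matrix (T' x))\<bar> * f (T x)) * indicator S x) \<in> borel_measurable borel" .
  have "(\<lambda>x. indicator (T ` S) x *\<^sub>R f x) \<in> borel_measurable borel"
    by (rule borel_measurable_continuous_on_indicator[OF bor[OF S] continuous_on_subset[OF f(1)]]) (use S in auto)
  then have "(\<lambda>x. ennreal (indicator (T ` S) x *\<^sub>R f x)) \<in> borel_measurable borel" by simp
  also have "(\<lambda>x. ennreal (indicator (T ` S) x *\<^sub>R f x)) = (\<lambda>x. ennreal (f x) * indicator (T ` S) x)"
    by (auto simp: indicator_def)
  finally have m2: "(\<lambda>x. ennreal (f x) * indicator (T ` S) x) \<in> borel_measurable borel" .
  show ?thesis unfolding nn_integral_unindex[OF m1] nn_integral_unindex[OF m2] by (rule eq)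
qed

section \<open>Riemannian manifolds\<close>

lemma coordinate_metric_subset:
  "coordinate_metric G X \<Longrightarrow> open W \<Longrightarrow> W \<subseteq> X \<Longrightarrow> coordinate_metric G W"
  unfolding coordinate_metric_def by (auto intro: smooth_on_subset)

text \<open>Tonelli's theorem with counting measure as one factor; it gives countable additivity of
  a measure assembled from countably many pieces.\<close>

lemma suminf_swap_ennreal:
  fixes a :: "nat \<Rightarrow> nat \<Rightarrow> ennreal"
  shows "(\<Sum>n. \<Sum>i. a n i) = (\<Sum>i. \<Sum>n. a n i)"
  using nn_integral_suminf[of "\<lambda>i n. a n i" "count_space UNIV"]
  by (simp add: nn_integral_count_space_nat)

locale riemannian =
  fixes \<A> :: "('a::{t2_space, second_countable_topology}, 'm::finite) chart set"
    and g :: "('a, 'm) metric"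
  assumes riem: "riemannian_manifold \<A> g"
begin

definition cod :: "('a, 'm) chart \<Rightarrow> (real ^ 'm) set" where "cod c = snd c ` fst c"

abbreviation loc_metric :: "('a, 'm) chart \<Rightarrow> real ^ 'm \<Rightarrow> real ^ 'm ^ 'm" where
  "loc_metric c \<equiv> g c \<circ> chart_inv c"

lemma atlas: "smooth_atlas \<A>"
  using riem by (simp add: riemannian_manifold_def)

lemma charts_cover: "(\<Union>c\<in>\<A>. fst c) = UNIV"
  using atlas by (simp add: smooth_atlas_def)

lemma
  assumes "c \<in> \<A>"
  shows open_dom: "open (fst c)" and open_cod: "open (cod c)"
    and chart_homeo: "homeomorphism (fst c) (cod c) (snd c) (chart_inv c)"
proof -
  have "\<forall>(U, x)\<in>\<A>. open U \<and> open (x ` U) \<and> homeomorphism U (x ` U) x (chart_inv (U, x))"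
    using atlas by (simp add: smooth_atlas_def)
  from bspec[OF this assms] show "open (fst c)" "open (cod c)"
    "homeomorphism (fst c) (cod c) (snd c) (chart_inv c)"
    by (auto simp: cod_def split_beta)
qed

lemma chart_inv_chart: "c \<in> \<A> \<Longrightarrow> p \<in> fst c \<Longrightarrow> chart_inv c (snd c p) = p"
  using homeomorphism_apply1[OF chart_homeo] .

lemma chart_chart_inv: "c \<in> \<A> \<Longrightarrow> y \<in> cod c \<Longrightarrow> snd c (chart_inv c y) = y"
  using homeomorphism_apply2[OF chart_homeo] .

lemma chart_inv_dom:
  assumes "c \<in> \<A>" "y \<in> cod c"
  shows "chart_inv c y \<in> fst c"
  using homeomorphism_image2[OF chart_homeo[OF assms(1)]] assms(2) by blast

lemma chart_cod: "p \<in> fst c \<Longrightarrow> snd c p \<in> cod c"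
  by (simp add: cod_def)

lemma continuous_chart_inv: "c \<in> \<A> \<Longrightarrow> continuous_on (cod c) (chart_inv c)"
  using homeomorphism_cont2[OF chart_homeo] .

lemma continuous_chart: "c \<in> \<A> \<Longrightarrow> continuous_on (fst c) (snd c)"
  using homeomorphism_cont1[OF chart_homeo] .

lemma chart_image: "c \<in> \<A> \<Longrightarrow> S \<subseteq> fst c \<Longrightarrow> snd c ` S = {y \<in> cod c. chart_inv c y \<in> S}"
  by (force simp: chart_inv_chart chart_chart_inv cod_def image_iff)

lemma open_chart_image:
  assumes "c \<in> \<A>" "open S" "S \<subseteq> fst c"
  shows "open (snd c ` S)"
proof -
  have "open (cod c \<inter> chart_inv c -` S)"
    by (rule continuous_open_preimage[OF continuous_chart_inv open_cod]) (use assms in auto)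
  then show ?thesis using chart_image[OF assms(1,3)] by (simp add: Int_def vimage_def)
qed

text \<open>The image under the chart is a preimage under the inverse chart, which is continuous on
  the open set \<open>cod c\<close>.\<close>

lemma borel_chart_image:
  assumes "c \<in> \<A>" "S \<in> sets borel" "S \<subseteq> fst c"
  shows "snd c ` S \<in> sets borel"
proof -
  have "chart_inv c \<in> measurable (restrict_space borel (cod c)) borel"
    using borel_measurable_continuous_on_restrict[OF continuous_chart_inv[OF assms(1)]] .
  from measurable_sets[OF this assms(2)]
  have "chart_inv c -` S \<inter> cod c \<in> sets (restrict_space borel (cod c))"
    by (simp add: space_restrict_space)
  then have "chart_inv c -` S \<inter> cod c \<in> sets borel"
    using open_cod[OF assms(1)] by (simp add: sets_restrict_space_iff)
  moreover have "snd c ` S = chart_inv c -` S \<inter> cod c" using chart_image[OF assms(1,3)] by auto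
  ultimately show ?thesis by simp
qed

lemma metric_chart: "c \<in> \<A> \<Longrightarrow> coordinate_metric (loc_metric c) (cod c)"
proof
  assume c: "c \<in> \<A>"
  show "open (cod c)" by (rule open_cod[OF c])
  show "smooth_on (loc_metric c) (cod c)" using riem c by (simp add: riemannian_manifold_def cod_def)
  show "pos_def (loc_metric c y)" if "y \<in> cod c" for y
    using riem c chart_inv_dom[OF c that] by (auto simp: riemannian_manifold_def pos_def_def)
qed

lemma smooth_transition:
  assumes "c \<in> \<A>" "d \<in> \<A>"
  shows "smooth_on (snd d \<circ> chart_inv c) (snd c ` (fst c \<inter> fst d))"
proof -
  have "\<forall>(U, x)\<in>\<A>. \<forall>(V, y)\<in>\<A>. smooth_on (y \<circ> chart_inv (U, x)) (x ` (U \<inter> V))"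
    using atlas by (simp add: smooth_atlas_def)
  from bspec[OF this assms(1)] have "\<forall>(V, y)\<in>\<A>. smooth_on (y \<circ> chart_inv c) (snd c ` (fst c \<inter> V))"
    by (simp add: split_beta)
  from bspec[OF this assms(2)] show ?thesis by (simp add: split_beta)
qed

text \<open>Through this interpretation every statement on independence of the chart is reduced to
  \<open>metric_change\<close>.\<close>

lemma transition:
  assumes c: "c \<in> \<A>" and d: "d \<in> \<A>"
  shows "metric_change (loc_metric c) (loc_metric d) (snd c ` (fst c \<inter> fst d)) (cod d) (snd d \<circ> chart_inv c)"
proof (intro metric_change.intro coordinate_metric_subset[OF metric_chart[OF c]] metric_chart[OF d] metric_change_axioms.intro)
  show "open (snd c ` (fst c \<inter> fst d))"
    by (rule open_chart_image[OF c open_Int[OF open_dom[OF c] open_dom[OF d]]]) auto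
  show "snd c ` (fst c \<inter> fst d) \<subseteq> cod c" by (auto simp: cod_def)
  show "smooth_on (snd d \<circ> chart_inv c) (snd c ` (fst c \<inter> fst d))" by (rule smooth_transition[OF c d])
  show "(snd d \<circ> chart_inv c) ` (snd c ` (fst c \<inter> fst d)) \<subseteq> cod d"
    by (auto simp: chart_inv_chart[OF c] cod_def)
  fix y and v w :: "real ^ 'm"
  assume "y \<in> snd c ` (fst c \<inter> fst d)"
  then obtain p where p: "p \<in> fst c \<inter> fst d" "y = snd c p" by auto
  have "v \<bullet> (g c p *v w) = frechet_derivative (snd d \<circ> chart_inv c) (at (snd c p)) v \<bullet>
      (g d p *v frechet_derivative (snd d \<circ> chart_inv c) (at (snd c p)) w)"
    using riem c d p(1) unfolding riemannian_manifold_def Let_def by blast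
  then show "v \<bullet> (loc_metric c y *v w) = frechet_derivative (snd d \<circ> chart_inv c) (at y) v \<bullet>
      (loc_metric d ((snd d \<circ> chart_inv c) y) *v frechet_derivative (snd d \<circ> chart_inv c) (at y) w)"
    using p by (simp add: chart_inv_chart c d)
qed

section \<open>The volume measure\<close>

text \<open>The indicator cuts off \<open>dens\<close> outside \<open>cod c\<close>, where
  \<open>chart_inv\<close> has arbitrary values.\<close>

definition chart_measure :: "('a, 'm) chart \<Rightarrow> (real ^ 'm) measure" where
  "chart_measure c = density lborel (\<lambda>y. ennreal (indicator (cod c) y * dens (loc_metric c) y))"

lemma measurable_dens:
  assumes "c \<in> \<A>"
  shows "(\<lambda>y. ennreal (indicator (cod c) y * dens (loc_metric c) y)) \<in> borel_measurable lborel"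
proof -
  interpret coordinate_metric "loc_metric c" "cod c" by (rule metric_chart[OF assms])
  have "(\<lambda>y. indicator (cod c) y *\<^sub>R dens (loc_metric c) y) \<in> borel_measurable borel"
    by (rule borel_measurable_continuous_on_indicator[OF _ smooth_on_continuous[OF smooth_dens]]) (use opn in auto)
  then show ?thesis by simp
qed

lemma emeasure_chart_measure:
  assumes "c \<in> \<A>" "S \<in> sets borel" "S \<subseteq> cod c"
  shows "emeasure (chart_measure c) S = (\<integral>\<^sup>+y. ennreal (dens (loc_metric c) y) * indicator S y \<partial>lborel)"
  unfolding chart_measure_def using assms
  by (subst emeasure_density[OF measurable_dens]) (auto intro!: nn_integral_cong simp: indicator_def)

text \<open>The factor |det J| by which the densities of the two charts differ
  (\<open>dens_A\<close>) is exactly the one in the change of variables formula.\<close>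

lemma emeasure_chart_measure_change:
  assumes c: "c \<in> \<A>" and d: "d \<in> \<A>" and S: "S \<in> sets borel" "S \<subseteq> fst c \<inter> fst d"
  shows "emeasure (chart_measure c) (snd c ` S) = emeasure (chart_measure d) (snd d ` S)"
proof -
  let ?T = "snd d \<circ> chart_inv c" and ?W = "snd c ` (fst c \<inter> fst d)"
  interpret metric_change "loc_metric c" "loc_metric d" ?W "cod d" ?T
    by (rule transition[OF c d])
  let ?T' = "\<lambda>x. frechet_derivative ?T (at x)"
  have jac: "matrix (?T' x) = jac x" for x by (simp add: jac_def matrix_def partial_def vec_eq_iff)
  have Timg: "?T ` (snd c ` Q) = snd d ` Q" if "Q \<subseteq> fst c" for Q
    using that by (force simp: chart_inv_chart[OF c] image_iff)
  have dA: "dens (loc_metric c) x = \<bar>det (matrix (?T' x))\<bar> * dens (loc_metric d) (?T x)" if "x \<in> ?W" for x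
    unfolding jac by (rule dens_A[OF that])
  have "emeasure (chart_measure c) (snd c ` S) =
      (\<integral>\<^sup>+x. ennreal (dens (loc_metric c) x) * indicator (snd c ` S) x \<partial>lborel)"
    by (rule emeasure_chart_measure[OF c]) (use S c borel_chart_image in \<open>auto simp: cod_def\<close>)
  also have "\<dots> = (\<integral>\<^sup>+x. ennreal (\<bar>det (matrix (?T' x))\<bar> * dens (loc_metric d) (?T x)) * indicator (snd c ` S) x \<partial>lborel)"
  proof (rule nn_integral_cong)
    fix x
    show "ennreal (dens (loc_metric c) x) * indicator (snd c ` S) x =
        ennreal (\<bar>det (matrix (?T' x))\<bar> * dens (loc_metric d) (?T x)) * indicator (snd c ` S) x"
    proof (cases "x \<in> snd c ` S")
      case True
      then have "x \<in> ?W" using S(2) by auto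
      from dA[OF this] show ?thesis by (simp only:)
    qed simp
  qed
  also have "\<dots> = (\<integral>\<^sup>+x. ennreal (dens (loc_metric d) x) * indicator (?T ` (snd c ` S)) x \<partial>lborel)"
  proof (rule nn_integral_substitution[where W = ?W])
    show "open ?W" by (rule A.opn)
    show "inj_on ?T ?W"
      by (rule inj_onI) (auto simp: chart_inv_chart[OF c] dest!: arg_cong[where f = "chart_inv d"] simp: chart_inv_chart[OF d])
    show "(?T has_derivative ?T' x) (at x)" if "x \<in> ?W" for x
      by (rule smooth_on_has_derivative[OF smT that])
    \<comment> \<open>Pull \<open>Q\<close> back to the manifold, where it is Borel by continuity of
      the chart \<open>c\<close>, and push it forward with \<open>d\<close>, which preserves Borel
      sets.\<close>
    show "?T ` Q \<in> sets borel" if Q: "Q \<in> sets borel" "Q \<subseteq> ?W" for Q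
    proof -
      let ?Q = "snd c -` Q \<inter> (fst c \<inter> fst d)"
      have o: "open (fst c \<inter> fst d)" by (rule open_Int[OF open_dom[OF c] open_dom[OF d]])
      have "snd c \<in> measurable (restrict_space borel (fst c \<inter> fst d)) borel"
        by (rule borel_measurable_continuous_on_restrict) (rule continuous_on_subset[OF continuous_chart[OF c]], auto)
      from measurable_sets[OF this Q(1)] have "?Q \<in> sets (restrict_space borel (fst c \<inter> fst d))"
        by (simp add: space_restrict_space)
      then have b: "?Q \<in> sets borel" using o by (simp add: sets_restrict_space_iff)
      have "Q = snd c ` ?Q" using Q(2) by auto
      then have "?T ` Q = snd d ` ?Q" using Timg[of ?Q] by auto
      then show ?thesis using borel_chart_image[OF d b] by auto
    qed
    show "continuous_on ?W (\<lambda>x. \<bar>det (matrix (?T' x))\<bar> * dens (loc_metric d) (?T x))"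
      by (rule continuous_on_eq[OF smooth_on_continuous[OF A.smooth_dens] dA])
    show "continuous_on (?T ` ?W) (dens (loc_metric d))"
      by (rule continuous_on_subset[OF smooth_on_continuous[OF B.smooth_dens] TW])
    show "0 \<le> dens (loc_metric d) (?T x)" if "x \<in> ?W" for x
      using B.dens_pos[OF TZ[OF that]] by simp
    show "snd c ` S \<in> sets borel" by (rule borel_chart_image[OF c S(1)]) (use S in auto)
    show "snd c ` S \<subseteq> ?W" using S by auto
  qed
  also have "?T ` (snd c ` S) = snd d ` S" by (rule Timg) (use S in auto)
  also have "(\<integral>\<^sup>+x. ennreal (dens (loc_metric d) x) * indicator (snd d ` S) x \<partial>lborel) =
      emeasure (chart_measure d) (snd d ` S)"
    by (rule emeasure_chart_measure[OF d, symmetric]) (use S d borel_chart_image in \<open>auto simp: cod_def\<close>)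
  finally show ?thesis .
qed

lemma emeasure_chart_UN:
  assumes c: "c \<in> \<A>" and S: "\<And>n::nat. S n \<in> sets borel" "\<And>n. S n \<subseteq> fst c" "disjoint_family S"
  shows "emeasure (chart_measure c) (snd c ` (\<Union>n. S n)) = (\<Sum>n. emeasure (chart_measure c) (snd c ` S n))"
proof -
  have "snd c ` S m \<inter> snd c ` S n = {}" if "m \<noteq> n" for m n
  proof -
    have "S m \<inter> S n = {}" using S(3) that by (auto simp: disjoint_family_on_def)
    moreover have "inj_on (snd c) (fst c)" by (rule inj_on_inverseI[of _ "chart_inv c"]) (rule chart_inv_chart[OF c])
    ultimately show ?thesis using inj_on_image_Int[OF _ S(2)[of m] S(2)[of n]] by (metis image_empty)
  qed
  then have "disjoint_family (\<lambda>n. snd c ` S n)" by (auto simp: disjoint_family_on_def)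
  moreover have "range (\<lambda>n. snd c ` S n) \<subseteq> sets (chart_measure c)"
    using borel_chart_image[OF c S(1,2)] by (auto simp: chart_measure_def)
  ultimately show ?thesis unfolding image_UN by (subst suminf_emeasure) auto
qed

text \<open>\<^const>\<open>volume_measure\<close> is chosen by \<open>SOME\<close>, so nothing is known about the bienergy before the
  existence of such a measure is proved.\<close>

lemma volume_measure_exists: "\<exists>\<mu>. is_volume_measure \<A> g \<mu>"
proof -
  \<comment> \<open>Second countability reduces the cover by chart domains to a countable one, so
    that the measure can be a countable sum.\<close>
  obtain F where F: "F \<subseteq> fst ` \<A>" "countable F" "\<Union>F = UNIV"
    using Lindelof[of "fst ` \<A>"] open_dom charts_cover by (metis imageE)
  have "F \<noteq> {}" using F(3) by auto
  define U where "U n = from_nat_into F n" for n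
  have UF: "U n \<in> F" for n unfolding U_def by (rule from_nat_into[OF \<open>F \<noteq> {}\<close>])
  have Ucov: "(\<Union>n. U n) = UNIV"
    using F(3) range_from_nat_into[OF \<open>F \<noteq> {}\<close> F(2)] by (simp add: U_def[abs_def])
  have "\<exists>c. c \<in> \<A> \<and> fst c = U n" for n
  proof -
    have "U n \<in> fst ` \<A>" using UF[of n] F(1) by blast
    then obtain c where "U n = fst c" "c \<in> \<A>" by (rule imageE)
    then show ?thesis by (intro exI[of _ c]) simp
  qed
  then obtain ch where ch: "\<And>n. ch n \<in> \<A>" "\<And>n. fst (ch n) = U n" by metis
  have Uopen: "open (U n)" for n using open_dom[OF ch(1)] ch(2) by metis
  define D where "D = disjointed U"
  have "range (disjointed U) \<subseteq> sets borel"
    by (rule sets.range_disjointed_sets) (use Uopen in auto)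
  then have Db: "D n \<in> sets borel" for n by (auto simp: D_def)
  have DU: "D n \<subseteq> fst (ch n)" for n unfolding D_def ch(2) by (rule disjointed_subset)
  have Dcov: "(\<Union>n. D n) = UNIV" unfolding D_def by (simp add: UN_disjointed_eq Ucov)
  have Dd: "disjoint_family D" unfolding D_def by (rule disjoint_family_disjointed)
  let ?N = "\<lambda>c B. emeasure (chart_measure c) (snd c ` B)"
  \<comment> \<open>The manifold is cut into countably many disjoint Borel pieces
    \<open>D n\<close>, each inside one chart domain, and each piece is measured in its own
    chart.\<close>
  define V where "V B = (\<Sum>n. ?N (ch n) (B \<inter> D n))" for B
  define \<mu> where "\<mu> = measure_of UNIV (sets borel) V"
  have sets: "sets \<mu> = sets borel"
    unfolding \<mu>_def by (metis sets.sigma_sets_eq sets_measure_of space_borel subset_Pow_Union sets.space_closed)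
  have em: "emeasure \<mu> B = V B" if "B \<in> sets borel" for B
  proof (rule emeasure_measure_of[OF \<mu>_def])
    show "sets borel \<subseteq> Pow UNIV" by simp
    show "B \<in> sets \<mu>" using that sets by simp
    show "positive (sets \<mu>) V" by (simp add: positive_def V_def)
    show "countably_additive (sets \<mu>) V"
      unfolding countably_additive_def
    proof (intro allI impI)
      fix S :: "nat \<Rightarrow> 'a set"
      assume S: "range S \<subseteq> sets \<mu>" "disjoint_family S"
      have "V (\<Union>i. S i) = (\<Sum>n. \<Sum>i. ?N (ch n) (S i \<inter> D n))"
        unfolding V_def
      proof (rule suminf_cong)
        fix n
        have "(\<Union>i. S i) \<inter> D n = (\<Union>i. S i \<inter> D n)" by auto
        moreover have "?N (ch n) (\<Union>i. S i \<inter> D n) = (\<Sum>i. ?N (ch n) (S i \<inter> D n))"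
          by (rule emeasure_chart_UN[OF ch(1)])
            (use S sets Db DU in \<open>auto simp: disjoint_family_on_def intro!: sets.Int dest: subsetD[OF DU]\<close>)
        ultimately show "?N (ch n) ((\<Union>i. S i) \<inter> D n) = (\<Sum>i. ?N (ch n) (S i \<inter> D n))" by simp
      qed
      also have "\<dots> = (\<Sum>i. V (S i))" unfolding V_def by (rule suminf_swap_ennreal)
      finally show "(\<Sum>i. V (S i)) = V (\<Union>i. S i)" by simp
    qed
  qed
  have "emeasure \<mu> B = (\<integral>\<^sup>+ y. ennreal (sqrt (det (g c (chart_inv c y)))) * indicator (snd c ` B) y \<partial>lborel)"
    if c: "c \<in> \<A>" and B: "B \<in> sets borel" "B \<subseteq> fst c" for c B
  proof -
    \<comment> \<open>This part of \<open>B\<close> lies in both chart domains, so it may be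
      measured in \<open>c\<close> instead of \<open>ch n\<close>; then the pieces are added up
      again inside \<open>c\<close>.\<close>
    have "?N (ch n) (B \<inter> D n) = ?N c (B \<inter> D n)" for n
      by (rule emeasure_chart_measure_change[OF ch(1) c]) (use B Db DU in auto)
    then have "V B = (\<Sum>n. ?N c (B \<inter> D n))" by (simp add: V_def)
    also have "\<dots> = ?N c (\<Union>n. B \<inter> D n)"
    proof (rule emeasure_chart_UN[OF c, symmetric])
      show "disjoint_family (\<lambda>n. B \<inter> D n)" using Dd unfolding disjoint_family_on_def by blast
    qed (use B Db in auto)
    also have "(\<Union>n. B \<inter> D n) = B" using Dcov by auto
    also have "?N c B = (\<integral>\<^sup>+ y. ennreal (sqrt (det (g c (chart_inv c y)))) * indicator (snd c ` B) y \<partial>lborel)"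
      using emeasure_chart_measure[OF c borel_chart_image[OF c B]] B(2) by (auto simp: dens_def cod_def)
    finally show ?thesis using em[OF B(1)] by simp
  qed
  then have "is_volume_measure \<A> g \<mu>" using sets by (simp add: is_volume_measure_def)
  then show ?thesis by blast
qed

lemma is_volume_measure: "is_volume_measure \<A> g (volume_measure \<A> g)"
  unfolding volume_measure_def by (rule someI_ex[OF volume_measure_exists])

text \<open>The volume measure restricted to the image of the box is the push-forward, under the
  inverse chart, of Lebesgue measure on the box weighted with the density. The integral is then
  transported by the rules for densities and push-forwards.\<close>

lemma integral_volume_box:
  fixes h :: "'a \<Rightarrow> real"
  assumes c: "c \<in> \<A>" and box: "cbox a b \<subseteq> cod c" and h: "continuous_on (cod c) (h \<circ> chart_inv c)"
  shows "(LINT p:chart_inv c ` cbox a b|volume_measure \<A> g. h p) =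
    integral (cbox a b) (\<lambda>y. dens (loc_metric c) y * h (chart_inv c y))"
proof -
  interpret coordinate_metric "loc_metric c" "cod c" by (rule metric_chart[OF c])
  let ?\<mu> = "volume_measure \<A> g" and ?K = "chart_inv c ` cbox a b"
  have sets: "sets ?\<mu> = sets borel" using is_volume_measure by (simp add: is_volume_measure_def)
  have Kd: "?K \<subseteq> fst c" using chart_inv_dom[OF c] box by auto
  have Kb: "?K \<in> sets borel"
    by (intro borel_compact compact_continuous_image continuous_on_subset[OF continuous_chart_inv[OF c] box] compact_cbox)
  \<comment> \<open>A globally measurable replacement for \<open>chart_inv c\<close>, which is
    controlled only on \<open>cod c\<close>.\<close>
  define ci where "ci y = (if y \<in> cod c then chart_inv c y else undefined)" for y
  have mci: "ci \<in> measurable borel borel"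
    unfolding ci_def
    by (rule measurable_If_restrict_space_iff[THEN iffD2])
      (use opn borel_measurable_continuous_on_restrict[OF continuous_chart_inv[OF c]] in auto)
  let ?M = "density lborel (\<lambda>y. ennreal (indicator (cbox a b) y * dens (loc_metric c) y))"
  have md: "(\<lambda>y. indicator (cbox a b) y * dens (loc_metric c) y) \<in> borel_measurable borel"
    using borel_measurable_continuous_on_indicator[OF _ continuous_on_subset[OF smooth_on_continuous[OF smooth_dens] box]]
    by simp
  have mK: "(indicator ?K :: 'a \<Rightarrow> real) \<in> borel_measurable ?\<mu>"
    using Kb sets by (intro borel_measurable_indicator) simp
  have eqM: "density ?\<mu> (\<lambda>p. ennreal (indicator ?K p)) = distr ?M borel ci"
  proof (rule measure_eqI)
    show "sets (density ?\<mu> (\<lambda>p. ennreal (indicator ?K p))) = sets (distr ?M borel ci)" using sets by simp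
    fix B assume "B \<in> sets (density ?\<mu> (\<lambda>p. ennreal (indicator ?K p)))"
    then have B: "B \<in> sets borel" using sets by simp
    have "emeasure (density ?\<mu> (\<lambda>p. ennreal (indicator ?K p))) B = emeasure ?\<mu> (?K \<inter> B)"
    proof -
      have "emeasure (density ?\<mu> (\<lambda>p. ennreal (indicator ?K p))) B = (\<integral>\<^sup>+p. ennreal (indicator ?K p) * indicator B p \<partial>?\<mu>)"
        by (rule emeasure_density) (use mK B sets in auto)
      also have "\<dots> = (\<integral>\<^sup>+p. indicator (?K \<inter> B) p \<partial>?\<mu>)"
        by (rule nn_integral_cong) (auto simp: indicator_def)
      also have "\<dots> = emeasure ?\<mu> (?K \<inter> B)" using Kb B sets by simp
      finally show ?thesis .
    qed
    also have "\<dots> = (\<integral>\<^sup>+ y. ennreal (dens (loc_metric c) y) * indicator (snd c ` (?K \<inter> B)) y \<partial>lborel)"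
    proof -
      have "\<forall>c\<in>\<A>. \<forall>B\<in>sets borel. B \<subseteq> fst c \<longrightarrow> emeasure ?\<mu> B =
          (\<integral>\<^sup>+ y. ennreal (sqrt (det (g c (chart_inv c y)))) * indicator (snd c ` B) y \<partial>lborel)"
        using is_volume_measure by (simp add: is_volume_measure_def)
      from bspec[OF bspec[OF this c] sets.Int[OF Kb B]] show ?thesis using Kd by (auto simp: dens_def)
    qed
    also have "\<dots> = (\<integral>\<^sup>+ y. ennreal (indicator (cbox a b) y * dens (loc_metric c) y) * indicator (ci -` B) y \<partial>lborel)"
    proof (rule nn_integral_cong)
      fix y
      have "y \<in> snd c ` (?K \<inter> B) \<longleftrightarrow> y \<in> cbox a b \<and> ci y \<in> B"
      proof
        assume "y \<in> snd c ` (?K \<inter> B)"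
        then obtain z where z: "z \<in> cbox a b" "chart_inv c z \<in> B" "y = snd c (chart_inv c z)" by auto
        then show "y \<in> cbox a b \<and> ci y \<in> B" using box chart_chart_inv[OF c, of z] by (auto simp: ci_def)
      next
        assume y: "y \<in> cbox a b \<and> ci y \<in> B"
        then have "y \<in> cod c" using box by auto
        then show "y \<in> snd c ` (?K \<inter> B)"
          using y chart_chart_inv[OF c, of y] by (auto simp: ci_def intro!: image_eqI[of _ _ "chart_inv c y"])
      qed
      then show "ennreal (dens (loc_metric c) y) * indicator (snd c ` (?K \<inter> B)) y =
          ennreal (indicator (cbox a b) y * dens (loc_metric c) y) * indicator (ci -` B) y"
        by (simp add: indicator_def)
    qed
    also have "\<dots> = emeasure ?M (ci -` B)"
      by (rule emeasure_density[symmetric]) (use md measurable_sets[OF mci B] in auto)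
    also have "\<dots> = emeasure (distr ?M borel ci) B"
      using mci B by (subst emeasure_distr) auto
    finally show "emeasure (density ?\<mu> (\<lambda>p. ennreal (indicator ?K p))) B = emeasure (distr ?M borel ci) B" .
  qed
  \<comment> \<open>Nothing is known about measurability of \<open>h\<close> outside the chart
    domain; the cut-off function is Borel and agrees with \<open>h\<close> on the region of
    integration.\<close>
  define h' where "h' p = indicator ?K p *\<^sub>R h p" for p
  have "continuous_on (fst c) (\<lambda>p. (h \<circ> chart_inv c) (snd c p))"
    by (rule continuous_on_compose2[OF h continuous_chart[OF c]]) (auto simp: cod_def)
  then have "continuous_on (fst c) h"
    by (rule continuous_on_cong[THEN iffD1, rotated 2]) (simp_all add: chart_inv_chart[OF c])
  then have mh: "h' \<in> borel_measurable borel"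
    unfolding h'_def[abs_def] by (intro borel_measurable_continuous_on_indicator Kb) (rule continuous_on_subset[OF _ Kd])
  have "(LINT p:?K|?\<mu>. h p) = (\<integral>p. indicator ?K p *\<^sub>R h' p \<partial>?\<mu>)"
    unfolding set_lebesgue_integral_def by (rule Bochner_Integration.integral_cong) (simp_all add: h'_def indicator_def)
  also have "\<dots> = (\<integral>p. h' p \<partial>density ?\<mu> (\<lambda>p. ennreal (indicator ?K p)))"
    by (rule integral_density[symmetric]) (use mh mK measurable_cong_sets[OF sets refl] in auto)
  also have "\<dots> = (\<integral>y. h' (ci y) \<partial>?M)"
    unfolding eqM by (rule integral_distr) (use mci mh in auto)
  also have "\<dots> = (\<integral>y. (indicator (cbox a b) y * dens (loc_metric c) y) *\<^sub>R h' (ci y) \<partial>lborel)"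
    by (rule integral_density)
      (use md measurable_compose[OF mci mh] box in \<open>auto simp: indicator_def intro!: less_imp_le[OF dens_pos]\<close>)
  also have "\<dots> = (LINT y:cbox a b|lborel. dens (loc_metric c) y * h (chart_inv c y))"
    unfolding set_lebesgue_integral_def
    by (rule Bochner_Integration.integral_cong) (use box in \<open>auto simp: indicator_def h'_def ci_def\<close>)
  also have "\<dots> = integral (cbox a b) (\<lambda>y. dens (loc_metric c) y * h (chart_inv c y))"
  proof (rule set_borel_integral_eq_integral(2))
    have "continuous_on (cbox a b) (\<lambda>y. dens (loc_metric c) y * h (chart_inv c y))"
      by (rule continuous_on_subset[OF _ box], intro continuous_on_mult smooth_on_continuous[OF smooth_dens])
        (use h in \<open>simp add: o_def\<close>)
    then show "set_integrable lborel (cbox a b) (\<lambda>y. dens (loc_metric c) y * h (chart_inv c y))"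
      unfolding set_integrable_def by (rule borel_integrable_compact[OF compact_cbox])
  qed
  finally show ?thesis .
qed

end

section \<open>Maps into the unit sphere in coordinates\<close>

lemma lap_cong:
  assumes "open S" "y \<in> S" "\<And>z. z \<in> S \<Longrightarrow> f z = h z" "smooth_on f S"
  shows "lap G f y = lap G h y"
proof -
  have 1: "partial k f z = partial k h z" if "z \<in> S" for k z
    by (rule partial_cong[OF assms(1) that assms(3,4)])
  have "partial i (partial j f) y = partial i (partial j h) y" for i j
    by (rule partial_cong[OF assms(1,2) 1 smooth_on_partial[OF assms(4)]])
  then show ?thesis unfolding lap_def using 1[OF assms(2)] by simp
qed

lemma grad_inner_cong:
  assumes "open S" "y \<in> S" "\<And>z. z \<in> S \<Longrightarrow> u z = u' z" "\<And>z. z \<in> S \<Longrightarrow> f z = f' z"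
    "smooth_on u S" "smooth_on f S"
  shows "grad_inner G u f y = grad_inner G u' f' y"
  unfolding grad_inner_def
  using partial_cong[OF assms(1,2,3,5)] partial_cong[OF assms(1,2,4,6)] by simp

context coordinate_metric begin

lemma lap_nth:
  assumes "smooth_on f X" "y \<in> X"
  shows "lap G (\<lambda>z. f z $ a) y = lap G f y $ a"
proof -
  have 1: "partial k (\<lambda>z. f z $ a) z = partial k f z $ a" if "z \<in> X" for k z
    by (rule partial_nth[OF assms(1) that])
  have "partial i (partial j (\<lambda>z. f z $ a)) y = partial i (\<lambda>z. partial j f z $ a) y" for i j
    by (rule partial_cong[OF opn assms(2) 1 smooth_on_partial[OF smooth_on_nth[OF opn assms(1)]]])
  then have 2: "partial i (partial j (\<lambda>z. f z $ a)) y = partial i (partial j f) y $ a" for i j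
    using partial_nth[OF smooth_on_partial[OF assms(1)] assms(2)] by simp
  show ?thesis unfolding lap_def 2 1[OF assms(2)] by simp
qed

text \<open>With z = G^-1 v the form becomes z . G z.\<close>

lemma gi_form_pos:
  assumes y: "y \<in> X" and v: "v \<noteq> 0"
  shows "(\<Sum>i\<in>UNIV. \<Sum>j\<in>UNIV. gi G i j y * (v $ i * v $ j)) > 0"
proof -
  define z where "z = matrix_inv (G y) *v v"
  have Gz: "G y *v z = v"
    by (simp add: z_def matrix_vector_mul_assoc matrix_inv_mult[OF inv[OF y]])
  then have "z \<noteq> 0" using v by auto
  then have "z \<bullet> (G y *v z) > 0" using pd[OF y] by (auto simp: pos_def_def)
  then have "v \<bullet> z > 0" by (simp add: Gz inner_commute)
  then show ?thesis
    by (simp add: z_def inner_vec_def matrix_vector_mult_def gi_def sum_distrib_left mult_ac)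
qed

text \<open>Component by component in the target, the energy is a sum of values of the positive
  definite form G^-1, so every summand vanishes. This settles the case of zero energy
  density.\<close>

lemma grad_inner_self:
  fixes u :: "real ^ 'm \<Rightarrow> real ^ 'k"
  assumes y: "y \<in> X" and z: "grad_inner G u u y = 0"
  shows "partial i u y = 0"
proof -
  define v where "v a = (\<chi> i. partial i u y $ a)" for a
  let ?q = "\<lambda>a. \<Sum>i\<in>UNIV. \<Sum>j\<in>UNIV. gi G i j y * (v a $ i * v a $ j)"
  have "grad_inner G u u y = (\<Sum>i\<in>UNIV. \<Sum>j\<in>UNIV. \<Sum>a\<in>UNIV. gi G i j y * (v a $ i * v a $ j))"
    by (simp add: grad_inner_def inner_vec_def v_def sum_distrib_left)
  also have "\<dots> = (\<Sum>i\<in>UNIV. \<Sum>a\<in>UNIV. \<Sum>j\<in>UNIV. gi G i j y * (v a $ i * v a $ j))"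
    by (intro sum.cong[OF refl] sum.swap)
  also have "\<dots> = (\<Sum>a\<in>UNIV. ?q a)" by (rule sum.swap)
  finally have s: "(\<Sum>a\<in>UNIV. ?q a) = 0" using z by simp
  have nn: "?q a \<ge> 0" for a
    using gi_form_pos[OF y, of "v a"] by (cases "v a = 0") auto
  have "?q a = 0" for a using s nn by (simp add: sum_nonneg_eq_0_iff)
  then have "v a = 0" for a using gi_form_pos[OF y, of "v a"] by force
  then show ?thesis by (simp add: v_def vec_eq_iff)
qed

end

locale sphere_map = coordinate_metric G X for G :: "real ^ 'm::finite \<Rightarrow> real ^ 'm ^ 'm" and X +
  fixes u :: "real ^ 'm \<Rightarrow> real ^ 'k"
  assumes smu: "smooth_on u X" and unit: "\<And>y. y \<in> X \<Longrightarrow> u y \<bullet> u y = 1"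
begin

lemma inner_partial: "y \<in> X \<Longrightarrow> partial i u y \<bullet> u y = 0"
proof -
  assume y: "y \<in> X"
  have "partial i (\<lambda>z. u z \<bullet> u z) y = partial i (\<lambda>z. 1) y"
    by (rule partial_cong[OF opn y unit smooth_on_inner[OF opn smu smu]])
  then show ?thesis by (simp add: partial_inner[OF smu smu y] partial_const inner_commute)
qed

lemma inner_partial2: "y \<in> X \<Longrightarrow> partial i (partial j u) y \<bullet> u y = - (partial i u y \<bullet> partial j u y)"
proof -
  assume y: "y \<in> X"
  note sp = smooth_on_partial[OF smu]
  have "partial i (\<lambda>z. partial j u z \<bullet> u z) y = partial i (\<lambda>z. 0) y"
    by (rule partial_cong[OF opn y inner_partial smooth_on_inner[OF opn sp smu]])
  then have "partial j u y \<bullet> partial i u y + partial i (partial j u) y \<bullet> u y = 0"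
    by (simp only: partial_inner[OF sp smu y] partial_const)
  then show ?thesis by (simp add: inner_commute)
qed

text \<open>Written without the projection, so that its square expands into the Laplacian and the
  energy density; \<open>tension_alt\<close> identifies it with the trace of the projected
  Hessian.\<close>

definition tension :: "real ^ 'm \<Rightarrow> real ^ 'k" where
  "tension y = lap G u y + grad_inner G u u y *\<^sub>R u y"

text \<open>The derivatives of |u|^2 = 1 make the first-order terms orthogonal to u and turn the
  normal part of each second derivative into minus an inner product of first derivatives.\<close>

lemma inner_lap: "y \<in> X \<Longrightarrow> lap G u y \<bullet> u y = - grad_inner G u u y"
  by (simp add: lap_def grad_inner_def inner_sum_left inner_diff_left inner_partial inner_partial2 sum_negf)

lemma inner_tension: "y \<in> X \<Longrightarrow> tension y \<bullet> u y = 0"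
  by (simp add: tension_def inner_add_left inner_lap unit)

lemma norm_tension:
  assumes y: "y \<in> X"
  shows "(norm (tension y))\<^sup>2 = lap G u y \<bullet> lap G u y - (grad_inner G u u y)\<^sup>2"
proof -
  have "(norm (tension y))\<^sup>2 = lap G u y \<bullet> lap G u y + 2 * grad_inner G u u y * (lap G u y \<bullet> u y) + (grad_inner G u u y)\<^sup>2 * (u y \<bullet> u y)"
    unfolding power2_norm_eq_inner tension_def
    by (simp add: inner_add_left inner_add_right inner_commute power2_eq_square)
  then show ?thesis by (simp add: inner_lap[OF y] unit[OF y] power2_eq_square)
qed

text \<open>The projection removes the normal part of each second derivative, which is - <d_i u, d_j
  u> u by \<open>inner_partial2\<close>; the trace of what it removes is - e u.\<close>

lemma tension_alt:
  assumes y: "y \<in> X"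
  shows "tension y = (\<Sum>i\<in>UNIV. \<Sum>j\<in>UNIV. gi G i j y *\<^sub>R
    (sphere_proj (u y) (partial i (partial j u) y) - (\<Sum>k\<in>UNIV. chr G k i j y *\<^sub>R partial k u y)))"
  by (simp add: tension_def lap_def grad_inner_def sphere_proj_def inner_partial2[OF y] scaleR_diff_right
    scaleR_add_right sum.distrib sum_subtractf scaleR_sum_left)

end

section \<open>Time-dependent maps\<close>

text \<open>Defined on time slices, so that \<open>lap\<close> and \<open>grad_inner\<close> of a
  slice unfold to expressions in \<open>spartial\<close>; for smooth F it is also a directional
  derivative in the product space (\<open>spartial_eq\<close>).\<close>

definition spartial :: "'m::finite \<Rightarrow> (real \<times> (real ^ 'm) \<Rightarrow> 'b::real_normed_vector) \<Rightarrow> real \<times> (real ^ 'm) \<Rightarrow> 'b" where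
  "spartial i F z = partial i (\<lambda>y. F (fst z, y)) (snd z)"

definition tder :: "(real \<times> (real ^ 'm::finite) \<Rightarrow> 'b::real_normed_vector) \<Rightarrow> real \<times> (real ^ 'm) \<Rightarrow> 'b" where
  "tder F z = frechet_derivative F (at z) (1, 0)"

lemma spartial_eq:
  assumes "smooth_on F S" "z \<in> S"
  shows "spartial i F z = frechet_derivative F (at z) (0, axis i 1)"
proof -
  have "((\<lambda>y. F (fst z, y)) has_derivative (\<lambda>v. frechet_derivative F (at z) (0, v))) (at (snd z))"
    by (rule has_derivative_compose[of "\<lambda>y. (fst z, y)" "\<lambda>v. (0, v)" "snd z" UNIV F])
      (use smooth_on_has_derivative[OF assms] in \<open>auto intro!: derivative_eq_intros\<close>)
  from partial_eqI[OF this] show ?thesis by (simp add: spartial_def)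
qed

lemma smooth_on_tder: "smooth_on F S \<Longrightarrow> smooth_on (tder F) S"
  using smooth_on_derivative[of F S "(1, 0)"] by (simp add: tder_def[abs_def])

lemma smooth_on_spartial: "open S \<Longrightarrow> smooth_on F S \<Longrightarrow> smooth_on (spartial i F) S"
  by (rule smooth_on_cong[OF _ _ smooth_on_derivative[of F S "(0, axis i 1)"]]) (simp_all add: spartial_eq)

lemma has_vector_derivative_tder:
  assumes "smooth_on F S" "(t, y) \<in> S"
  shows "((\<lambda>t. F (t, y)) has_vector_derivative tder F (t, y)) (at t)"
proof -
  note d = smooth_on_has_derivative[OF assms]
  have "((\<lambda>t. F (t, y)) has_derivative (\<lambda>k. frechet_derivative F (at (t, y)) (k, 0))) (at t)"
    by (rule has_derivative_compose[of "\<lambda>t. (t, y)" "\<lambda>k. (k, 0)" t UNIV F, OF _ d])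
      (auto intro!: derivative_eq_intros)
  moreover have "frechet_derivative F (at (t, y)) (k, 0) = k *\<^sub>R tder F (t, y)" for k
    using linear_cmul[OF has_derivative_linear[OF d], of k "(1, 0)"] by (simp add: tder_def)
  ultimately show ?thesis by (simp add: has_vector_derivative_def)
qed

text \<open>Both operators are directional derivatives in the product space, so this is an instance
  of the symmetry of second derivatives.\<close>

lemma spartial_tder:
  fixes F :: "real \<times> (real ^ 'm::finite) \<Rightarrow> 'b::euclidean_space"
  assumes "open S" "smooth_on F S" "z \<in> S"
  shows "tder (spartial i F) z = spartial i (tder F) z"
proof -
  have "tder (spartial i F) z = tder (\<lambda>z. frechet_derivative F (at z) (0, axis i 1)) z"
    unfolding tder_def
  proof (rule arg_cong[where f = "\<lambda>D. D (1, 0)"])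
    show "frechet_derivative (spartial i F) (at z) = frechet_derivative (\<lambda>z. frechet_derivative F (at z) (0, axis i 1)) (at z)"
    proof (rule frechet_derivative_transform_within_open[OF _ assms(1,3)])
      show "spartial i F differentiable at z"
        using smooth_on_has_derivative[OF smooth_on_spartial[OF assms(1,2)] assms(3)] by (auto simp: differentiable_def)
    qed (rule spartial_eq[OF assms(2)])
  qed
  also have "\<dots> = frechet_derivative (tder F) (at z) (0, axis i 1)"
    unfolding tder_def[abs_def] by (rule second_derivative_commute[OF assms])
  also have "\<dots> = spartial i (tder F) z" by (rule spartial_eq[OF smooth_on_tder[OF assms(2)] assms(3), symmetric])
  finally show ?thesis .
qed

lemma smooth_on_slice:
  fixes F :: "real \<times> (real ^ 'm::finite) \<Rightarrow> 'b::real_normed_vector"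
  assumes "open X" "smooth_on F (I \<times> X)" "t \<in> I"
  shows "smooth_on (\<lambda>y. F (t, y)) X"
  by (rule smooth_on_compose[OF assms(1) _ smooth_on_Pair[OF assms(1) smooth_on_const smooth_on_id[OF assms(1)]] assms(2)])
    (use assms(3) in auto)

lemma smooth_on_snd_compose:
  fixes f :: "real ^ 'm::finite \<Rightarrow> 'b::real_normed_vector"
  assumes "open I" "open X" "smooth_on f X"
  shows "smooth_on (\<lambda>z :: real \<times> (real ^ 'm). f (snd z)) (I \<times> X)"
  by (rule smooth_on_compose[OF _ _ smooth_on_snd assms(3)]) (use assms in \<open>auto intro: open_Times\<close>)

context coordinate_metric begin

lemma smooth_lap_time:
  fixes F :: "real \<times> (real ^ 'm) \<Rightarrow> 'b::euclidean_space"
  assumes I: "open I" and F: "smooth_on F (I \<times> X)"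
  shows "smooth_on (\<lambda>z. lap G (\<lambda>y. F (fst z, y)) (snd z)) (I \<times> X)"
proof -
  have o: "open (I \<times> X)" by (rule open_Times[OF I opn])
  have eq: "(\<lambda>z. lap G (\<lambda>y. F (fst z, y)) (snd z)) = (\<lambda>z. \<Sum>i\<in>UNIV. \<Sum>j\<in>UNIV. gi G i j (snd z) *\<^sub>R
      (spartial i (spartial j F) z - (\<Sum>k\<in>UNIV. chr G k i j (snd z) *\<^sub>R spartial k F z)))"
    by (simp add: lap_def spartial_def[abs_def])
  show ?thesis unfolding eq
    by (intro smooth_on_sum smooth_on_scaleR smooth_on_diff smooth_on_spartial o F
      smooth_on_snd_compose[OF I opn] smooth_gi smooth_chr)
qed

lemma smooth_grad_inner_time:
  fixes F H :: "real \<times> (real ^ 'm) \<Rightarrow> 'b::euclidean_space"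
  assumes I: "open I" and F: "smooth_on F (I \<times> X)" and H: "smooth_on H (I \<times> X)"
  shows "smooth_on (\<lambda>z. grad_inner G (\<lambda>y. F (fst z, y)) (\<lambda>y. H (fst z, y)) (snd z)) (I \<times> X)"
proof -
  have o: "open (I \<times> X)" by (rule open_Times[OF I opn])
  have eq: "(\<lambda>z. grad_inner G (\<lambda>y. F (fst z, y)) (\<lambda>y. H (fst z, y)) (snd z)) =
      (\<lambda>z. \<Sum>i\<in>UNIV. \<Sum>j\<in>UNIV. gi G i j (snd z) * (spartial i F z \<bullet> spartial j H z))"
    by (simp add: grad_inner_def spartial_def[abs_def])
  show ?thesis unfolding eq
    by (intro smooth_on_sum smooth_on_mult smooth_on_inner smooth_on_spartial o F H
      smooth_on_snd_compose[OF I opn] smooth_gi)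
qed

text \<open>The coefficients of the Laplacian do not depend on time, and time derivatives commute
  with spatial ones.\<close>

lemma lap_has_time_derivative:
  fixes F :: "real \<times> (real ^ 'm) \<Rightarrow> 'b::euclidean_space"
  assumes I: "open I" and F: "smooth_on F (I \<times> X)" and t: "t \<in> I" and y: "y \<in> X"
  shows "((\<lambda>t. lap G (\<lambda>y. F (t, y)) y) has_vector_derivative lap G (\<lambda>y. tder F (t, y)) y) (at t)"
proof -
  have o: "open (I \<times> X)" by (rule open_Times[OF I opn])
  have ty: "(t, y) \<in> I \<times> X" using t y by simp
  have 1: "((\<lambda>t. spartial k H (t, y)) has_vector_derivative spartial k (tder H) (t, y)) (at t)"
    if "smooth_on H (I \<times> X)" for k and H :: "real \<times> (real ^ 'm) \<Rightarrow> 'b"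
    using has_vector_derivative_tder[OF smooth_on_spartial[OF o that] ty] spartial_tder[OF o that ty] by simp
  have 2: "spartial i (tder (spartial j F)) (t, y) = spartial i (spartial j (tder F)) (t, y)" for i j
    unfolding spartial_def[of i]
    by (simp, rule partial_cong[OF opn y _ smooth_on_slice[OF opn smooth_on_tder[OF smooth_on_spartial[OF o F]] t]])
      (use t in \<open>simp add: spartial_tder[OF o F]\<close>)
  have "((\<lambda>t. \<Sum>i\<in>UNIV. \<Sum>j\<in>UNIV. gi G i j y *\<^sub>R
      (spartial i (spartial j F) (t, y) - (\<Sum>k\<in>UNIV. chr G k i j y *\<^sub>R spartial k F (t, y)))) has_vector_derivative
      (\<Sum>i\<in>UNIV. \<Sum>j\<in>UNIV. gi G i j y *\<^sub>R
      (spartial i (tder (spartial j F)) (t, y) - (\<Sum>k\<in>UNIV. chr G k i j y *\<^sub>R spartial k (tder F) (t, y))))) (at t)"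
    by (intro has_vector_derivative_sum has_vector_derivative_diff 1 F smooth_on_spartial o
      bounded_linear.has_vector_derivative[OF bounded_linear_scaleR_right])
  then show ?thesis unfolding 2 by (simp add: lap_def spartial_def[abs_def])
qed

lemma grad_inner_has_time_derivative:
  fixes F :: "real \<times> (real ^ 'm) \<Rightarrow> 'b::euclidean_space"
  assumes I: "open I" and F: "smooth_on F (I \<times> X)" and t: "t \<in> I" and y: "y \<in> X"
  shows "((\<lambda>t. grad_inner G (\<lambda>y. F (t, y)) (\<lambda>y. F (t, y)) y) has_real_derivative
    2 * grad_inner G (\<lambda>y. tder F (t, y)) (\<lambda>y. F (t, y)) y) (at t)"
proof -
  have o: "open (I \<times> X)" by (rule open_Times[OF I opn])
  have ty: "(t, y) \<in> I \<times> X" using t y by simp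
  have 1: "((\<lambda>t. spartial k F (t, y)) has_vector_derivative spartial k (tder F) (t, y)) (at t)" for k
    using has_vector_derivative_tder[OF smooth_on_spartial[OF o F] ty] spartial_tder[OF o F ty] by simp
  have "((\<lambda>t. \<Sum>i\<in>UNIV. \<Sum>j\<in>UNIV. gi G i j y * (spartial i F (t, y) \<bullet> spartial j F (t, y))) has_vector_derivative
      (\<Sum>i\<in>UNIV. \<Sum>j\<in>UNIV. gi G i j y * (spartial i F (t, y) \<bullet> spartial j (tder F) (t, y) +
        spartial i (tder F) (t, y) \<bullet> spartial j F (t, y)))) (at t)"
    by (intro has_vector_derivative_sum bounded_linear.has_vector_derivative[OF bounded_linear_mult_right]
      bounded_bilinear.has_vector_derivative[OF bounded_bilinear_inner] 1)
  then have "((\<lambda>t. grad_inner G (\<lambda>y. F (t, y)) (\<lambda>y. F (t, y)) y) has_vector_derivative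
      (grad_inner G (\<lambda>y. F (t, y)) (\<lambda>y. tder F (t, y)) y + grad_inner G (\<lambda>y. tder F (t, y)) (\<lambda>y. F (t, y)) y)) (at t)"
    by (simp add: grad_inner_def spartial_def[abs_def] distrib_left sum.distrib)
  then show ?thesis
    by (simp add: grad_inner_commute[OF y, of "\<lambda>y. F (t, y)"] has_real_derivative_iff_has_vector_derivative)
qed

end

section \<open>Global and local expressions\<close>

context riemannian begin

lemma chart_at: "chart_at \<A> p \<in> \<A>" "p \<in> fst (chart_at \<A> p)"
proof -
  have "p \<in> (\<Union>c\<in>\<A>. fst c)" by (simp only: charts_cover UNIV_I)
  then have "\<exists>c. c \<in> \<A> \<and> p \<in> fst c" by blast
  from someI_ex[OF this] show "chart_at \<A> p \<in> \<A>" "p \<in> fst (chart_at \<A> p)"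
    by (auto simp: chart_at_def)
qed

lemma smooth_map_chart: "smooth_map \<A> f \<Longrightarrow> c \<in> \<A> \<Longrightarrow> smooth_on (f \<circ> chart_inv c) (cod c)"
  by (simp add: smooth_map_def cod_def)

lemma pd_partial: "pd c i f p = partial i (f \<circ> chart_inv c) (snd c p)"
  by (simp add: pd_def partial_def)

lemma ginv_gi: "c \<in> \<A> \<Longrightarrow> p \<in> fst c \<Longrightarrow> ginv g c i j p = gi (loc_metric c) i j (snd c p)"
  by (simp add: ginv_def gi_def chart_inv_chart)

lemma christoffel_chr: "c \<in> \<A> \<Longrightarrow> p \<in> fst c \<Longrightarrow> christoffel g c k i j p = chr (loc_metric c) k i j (snd c p)"
  by (simp add: christoffel_def chr_def ginv_gi pd_partial o_def)

lemma lap_chart_change: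
  fixes f :: "'a \<Rightarrow> 'b::euclidean_space"
  assumes c: "c \<in> \<A>" and d: "d \<in> \<A>" and p: "p \<in> fst c" "p \<in> fst d" and f: "smooth_map \<A> f"
  shows "lap (loc_metric c) (f \<circ> chart_inv c) (snd c p) = lap (loc_metric d) (f \<circ> chart_inv d) (snd d p)"
proof -
  interpret metric_change "loc_metric c" "loc_metric d" "snd c ` (fst c \<inter> fst d)" "cod d" "snd d \<circ> chart_inv c"
    by (rule transition[OF c d])
  have y: "snd c p \<in> snd c ` (fst c \<inter> fst d)" using p by auto
  note fd = smooth_map_chart[OF f d]
  have "lap (loc_metric c) (f \<circ> chart_inv c) (snd c p) =
      lap (loc_metric c) (\<lambda>z. (f \<circ> chart_inv d) ((snd d \<circ> chart_inv c) z)) (snd c p)"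
    by (rule sym, rule lap_cong[OF A.opn y _ smooth_T_compose[OF fd]])
      (auto simp: chart_inv_chart[OF c] chart_inv_chart[OF d])
  also have "\<dots> = lap (loc_metric d) (f \<circ> chart_inv d) ((snd d \<circ> chart_inv c) (snd c p))"
    by (rule lap_transform[OF fd y])
  finally show ?thesis by (simp add: chart_inv_chart[OF c p(1)])
qed

lemma grad_inner_chart_change:
  fixes f :: "'a \<Rightarrow> 'b::euclidean_space"
  assumes c: "c \<in> \<A>" and d: "d \<in> \<A>" and p: "p \<in> fst c" "p \<in> fst d" and f: "smooth_map \<A> f"
  shows "grad_inner (loc_metric c) (f \<circ> chart_inv c) (f \<circ> chart_inv c) (snd c p) =
    grad_inner (loc_metric d) (f \<circ> chart_inv d) (f \<circ> chart_inv d) (snd d p)"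
proof -
  interpret metric_change "loc_metric c" "loc_metric d" "snd c ` (fst c \<inter> fst d)" "cod d" "snd d \<circ> chart_inv c"
    by (rule transition[OF c d])
  have y: "snd c p \<in> snd c ` (fst c \<inter> fst d)" using p by auto
  note fd = smooth_map_chart[OF f d]
  let ?h = "\<lambda>z. (f \<circ> chart_inv d) ((snd d \<circ> chart_inv c) z)"
  have "grad_inner (loc_metric c) ?h ?h (snd c p) =
      grad_inner (loc_metric c) (f \<circ> chart_inv c) (f \<circ> chart_inv c) (snd c p)"
    by (rule grad_inner_cong[OF A.opn y _ _ smooth_T_compose[OF fd] smooth_T_compose[OF fd]])
      (auto simp: chart_inv_chart[OF c] chart_inv_chart[OF d])
  then show ?thesis using grad_inner_transform[OF fd fd y] by (simp add: chart_inv_chart[OF c p(1)])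
qed

text \<open>In the chart selected by \<open>chart_at\<close> the divergence of the gradient is the
  trace of the Hessian by \<open>lap_div\<close>; that trace can then be moved to the given
  chart.\<close>

lemma laplacian_lap:
  assumes c: "c \<in> \<A>" and p: "p \<in> fst c" and f: "smooth_map \<A> f"
  shows "laplacian \<A> g f p = lap (loc_metric c) (f \<circ> chart_inv c) (snd c p)"
proof -
  let ?d = "chart_at \<A> p"
  note d = chart_at[of p]
  interpret coordinate_metric "loc_metric ?d" "cod ?d" by (rule metric_chart[OF d(1)])
  let ?f = "f \<circ> chart_inv ?d" and ?G = "loc_metric ?d" and ?y = "snd ?d p"
  have y: "?y \<in> cod ?d" by (rule chart_cod[OF d(2)])
  note sf = smooth_map_chart[OF f d(1)]
  have grad: "gradient_in g ?d f i q = (\<Sum>j\<in>UNIV. gi ?G i j (snd ?d q) * partial j ?f (snd ?d q))"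
    if "q \<in> fst ?d" for i q
    using that by (simp add: gradient_in_def ginv_gi[OF d(1)] pd_partial)
  have pdg: "pd ?d i (gradient_in g ?d f i) p = partial i (\<lambda>z. \<Sum>j\<in>UNIV. gi ?G i j z *\<^sub>R partial j ?f z) ?y" for i
    unfolding pd_partial
  proof (rule sym, rule partial_cong[OF opn y])
    show "(\<Sum>j\<in>UNIV. gi ?G i j z *\<^sub>R partial j ?f z) = (gradient_in g ?d f i \<circ> chart_inv ?d) z" if "z \<in> cod ?d" for z
      using grad[OF chart_inv_dom[OF d(1) that]] by (simp add: chart_chart_inv[OF d(1) that])
    show "smooth_on (\<lambda>z. \<Sum>j\<in>UNIV. gi ?G i j z *\<^sub>R partial j ?f z) (cod ?d)"
      by (intro smooth_on_sum smooth_on_scaleR smooth_gi smooth_on_partial sf opn)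
  qed
  have "laplacian \<A> g f p = (\<Sum>i\<in>UNIV. pd ?d i (gradient_in g ?d f i) p) +
      (\<Sum>i\<in>UNIV. \<Sum>k\<in>UNIV. chr ?G i i k ?y * (\<Sum>j\<in>UNIV. gi ?G k j ?y * partial j ?f ?y))"
    by (simp add: laplacian_def Let_def divergence_in_def sum.distrib christoffel_chr[OF d] grad[OF d(2)])
  also have "(\<Sum>i\<in>UNIV. \<Sum>k\<in>UNIV. chr ?G i i k ?y * (\<Sum>j\<in>UNIV. gi ?G k j ?y * partial j ?f ?y)) =
      (\<Sum>k\<in>UNIV. (\<Sum>i\<in>UNIV. chr ?G i i k ?y) *\<^sub>R (\<Sum>j\<in>UNIV. gi ?G k j ?y *\<^sub>R partial j ?f ?y))"
    by (subst sum.swap) (simp add: sum_distrib_right)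
  finally have "laplacian \<A> g f p = lap ?G ?f ?y" unfolding lap_div[OF sf y] pdg .
  then show ?thesis using lap_chart_change[OF c d(1) p d(2) f] by simp
qed

lemma smooth_map_nth: "smooth_map \<A> f \<Longrightarrow> smooth_map \<A> (\<lambda>q. f q $ a)"
  unfolding smooth_map_def o_def
  by (intro ballI smooth_on_nth) (use open_cod in \<open>auto simp: cod_def\<close>)

lemma vec_laplacian_lap:
  assumes c: "c \<in> \<A>" and p: "p \<in> fst c" and f: "smooth_map \<A> f"
  shows "vec_laplacian \<A> g f p = lap (loc_metric c) (f \<circ> chart_inv c) (snd c p)"
proof -
  have "laplacian \<A> g (\<lambda>q. f q $ a) p = lap (loc_metric c) (f \<circ> chart_inv c) (snd c p) $ a" for a
    using laplacian_lap[OF c p smooth_map_nth[OF f]]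
      coordinate_metric.lap_nth[OF metric_chart[OF c] smooth_map_chart[OF f c] chart_cod[OF p]] by (simp add: o_def)
  then show ?thesis by (simp add: vec_laplacian_def vec_eq_iff)
qed

lemma vec_laplacian_chart:
  assumes c: "c \<in> \<A>" and f: "smooth_map \<A> f" and y: "y \<in> cod c"
  shows "(vec_laplacian \<A> g f \<circ> chart_inv c) y = lap (loc_metric c) (f \<circ> chart_inv c) y"
  using vec_laplacian_lap[OF c chart_inv_dom[OF c y] f] by (simp add: chart_chart_inv[OF c y])

text \<open>Required for applying the Laplacian a second time. The chart selected by
  \<open>chart_at\<close> may jump from point to point, so smoothness is read off from the
  expression in one fixed chart.\<close>

lemma smooth_map_vec_laplacian:
  assumes f: "smooth_map \<A> f"
  shows "smooth_map \<A> (vec_laplacian \<A> g f)"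
  unfolding smooth_map_def
proof
  fix c assume c: "c \<in> \<A>"
  interpret coordinate_metric "loc_metric c" "cod c" by (rule metric_chart[OF c])
  show "smooth_on (vec_laplacian \<A> g f \<circ> chart_inv c) (snd c ` fst c)"
    unfolding cod_def[symmetric]
    by (rule smooth_on_cong[OF opn vec_laplacian_chart[OF c f, symmetric] smooth_lap[OF smooth_map_chart[OF f c]]])
qed

lemma vec_bilaplacian_lap:
  assumes c: "c \<in> \<A>" and f: "smooth_map \<A> f" and y: "y \<in> cod c"
  shows "vec_laplacian \<A> g (vec_laplacian \<A> g f) (chart_inv c y) =
    lap (loc_metric c) (lap (loc_metric c) (f \<circ> chart_inv c)) y"
proof -
  interpret coordinate_metric "loc_metric c" "cod c" by (rule metric_chart[OF c])
  note sm = smooth_map_vec_laplacian[OF f]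
  have "vec_laplacian \<A> g (vec_laplacian \<A> g f) (chart_inv c y) =
      lap (loc_metric c) (vec_laplacian \<A> g f \<circ> chart_inv c) y"
    using vec_laplacian_chart[OF c sm y] by simp
  also have "\<dots> = lap (loc_metric c) (lap (loc_metric c) (f \<circ> chart_inv c)) y"
    by (rule lap_cong[OF opn y vec_laplacian_chart[OF c f] smooth_map_chart[OF sm c]])
  finally show ?thesis .
qed

lemma sphere_map_chart:
  assumes c: "c \<in> \<A>" and f: "smooth_sphere_map \<A> f"
  shows "sphere_map (loc_metric c) (cod c) (f \<circ> chart_inv c)"
proof (intro sphere_map.intro sphere_map_axioms.intro metric_chart c)
  show "smooth_on (f \<circ> chart_inv c) (cod c)"
    using f c by (simp add: smooth_sphere_map_def smooth_map_chart)
  fix y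
  have "f (chart_inv c y) \<in> sphere 0 1" using f unfolding smooth_sphere_map_def by blast
  then have "norm (f (chart_inv c y)) = 1" by simp
  then show "(f \<circ> chart_inv c) y \<bullet> (f \<circ> chart_inv c) y = 1" by (simp add: norm_eq_1)
qed

text \<open>In the chart selected by \<open>chart_at\<close> the definition is the right-hand side
  of \<open>tension_alt\<close>; the form Delta u + e u consists of quantities already known to be
  independent of the chart.\<close>

lemma tension_field_chart:
  assumes c: "c \<in> \<A>" and p: "p \<in> fst c" and f: "smooth_sphere_map \<A> f"
  shows "tension_field \<A> g f p = sphere_map.tension (loc_metric c) (f \<circ> chart_inv c) (snd c p)"
proof -
  let ?d = "chart_at \<A> p"
  note d = chart_at[of p]
  have sm: "smooth_map \<A> f" using f by (simp add: smooth_sphere_map_def)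
  interpret D: sphere_map "loc_metric ?d" "cod ?d" "f \<circ> chart_inv ?d" by (rule sphere_map_chart[OF d(1) f])
  interpret C: sphere_map "loc_metric c" "cod c" "f \<circ> chart_inv c" by (rule sphere_map_chart[OF c f])
  have y: "snd ?d p \<in> cod ?d" by (rule chart_cod[OF d(2)])
  have "pd ?d i (pd ?d j f) p = partial i (partial j (f \<circ> chart_inv ?d)) (snd ?d p)" for i j
    unfolding pd_partial[of _ i]
    by (rule sym, rule partial_cong[OF D.opn y _ smooth_on_partial[OF D.smu]])
      (simp add: pd_partial chart_chart_inv[OF d(1)])
  then have "tension_field \<A> g f p = D.tension (snd ?d p)"
    by (simp add: tension_field_def tension_in_def second_fundamental_form_in_def pullback_deriv_in_def
      D.tension_alt[OF y] ginv_gi[OF d] christoffel_chr[OF d] pd_partial[of _ _ f] chart_inv_chart[OF d])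
  also have "\<dots> = C.tension (snd c p)"
    unfolding D.tension_def C.tension_def
    by (simp add: lap_chart_change[OF d(1) c d(2) p sm] grad_inner_chart_change[OF d(1) c d(2) p sm]
      chart_inv_chart[OF d] chart_inv_chart[OF c p])
  finally show ?thesis .
qed

lemma energy_density_chart:
  assumes c: "c \<in> \<A>" and p: "p \<in> fst c" and f: "smooth_map \<A> f"
  shows "energy_density \<A> g f p = grad_inner (loc_metric c) (f \<circ> chart_inv c) (f \<circ> chart_inv c) (snd c p)"
proof -
  note d = chart_at[of p]
  show ?thesis
    unfolding grad_inner_chart_change[OF c d(1) p d(2) f]
    by (simp add: energy_density_def energy_density_in_def grad_inner_def ginv_gi[OF d] pd_partial)
qed

end

section \<open>The first variation\<close>

context coordinate_metric begin

text \<open>Differentiation under the integral sign. The energy density has derivative 2 <dV, du>,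
  with V the velocity, hence the factor 4 in the derivative of its square.\<close>

lemma first_variation:
  fixes F :: "real \<times> (real ^ 'm) \<Rightarrow> 'b::euclidean_space"
  assumes I: "open I" "0 \<in> I" and F: "smooth_on F (I \<times> X)" and box: "cbox a b \<subseteq> X"
  shows "((\<lambda>t. integral (cbox a b) (\<lambda>y. dens G y *
      (lap G (\<lambda>y. F (t, y)) y \<bullet> lap G (\<lambda>y. F (t, y)) y - (grad_inner G (\<lambda>y. F (t, y)) (\<lambda>y. F (t, y)) y)\<^sup>2)))
    has_real_derivative integral (cbox a b) (\<lambda>y. dens G y *
      (2 * (lap G (\<lambda>y. F (0, y)) y \<bullet> lap G (\<lambda>y. tder F (0, y)) y) -
       4 * grad_inner G (\<lambda>y. F (0, y)) (\<lambda>y. F (0, y)) y * grad_inner G (\<lambda>y. tder F (0, y)) (\<lambda>y. F (0, y)) y))) (at 0)"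
proof -
  \<comment> \<open>The Leibniz rule is applied over a convex set of parameters around 0.\<close>
  obtain \<delta> where \<delta>: "\<delta> > 0" "ball 0 \<delta> \<subseteq> I" using I by (meson openE)
  let ?U = "ball 0 \<delta> :: real set"
  let ?l = "\<lambda>t. lap G (\<lambda>y. F (t, y))" and ?e = "\<lambda>t. grad_inner G (\<lambda>y. F (t, y)) (\<lambda>y. F (t, y))"
  let ?dl = "\<lambda>t. lap G (\<lambda>y. tder F (t, y))" and ?de = "\<lambda>t. grad_inner G (\<lambda>y. tder F (t, y)) (\<lambda>y. F (t, y))"
  let ?q = "\<lambda>t y. dens G y * (?l t y \<bullet> ?l t y - (?e t y)\<^sup>2)"
  let ?dq = "\<lambda>t y. dens G y * (2 * (?l t y \<bullet> ?dl t y) - 4 * ?e t y * ?de t y)"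
  have o: "open (I \<times> X)" by (rule open_Times[OF I(1) opn])
  have "((\<lambda>t. integral (cbox a b) (?q t)) has_field_derivative integral (cbox a b) (?dq 0)) (at 0 within ?U)"
  proof (rule leibniz_rule_field_derivative)
    fix t y assume "t \<in> ?U" "y \<in> cbox a b"
    then have t: "t \<in> I" and y: "y \<in> X" using \<delta>(2) box by auto
    have 1: "((\<lambda>t. ?l t y \<bullet> ?l t y) has_real_derivative 2 * (?l t y \<bullet> ?dl t y)) (at t)"
      using bounded_bilinear.has_vector_derivative[OF bounded_bilinear_inner
          lap_has_time_derivative[OF I(1) F t y] lap_has_time_derivative[OF I(1) F t y]]
      by (simp add: has_real_derivative_iff_has_vector_derivative inner_commute)
    have 2: "((\<lambda>t. (?e t y)\<^sup>2) has_real_derivative 2 * ?e t y * (2 * ?de t y)) (at t)"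
      using DERIV_power[OF grad_inner_has_time_derivative[OF I(1) F t y], of 2] by (simp add: mult_ac)
    have "((\<lambda>t. ?q t y) has_real_derivative dens G y * (2 * (?l t y \<bullet> ?dl t y) - 2 * ?e t y * (2 * ?de t y))) (at t)"
      by (intro DERIV_cmult DERIV_diff 1 2)
    then show "((\<lambda>t. ?q t y) has_field_derivative ?dq t y) (at t within ?U)"
      by (rule has_field_derivative_at_within[OF DERIV_cong]) simp
  next
    fix t assume "t \<in> ?U"
    then have t: "t \<in> I" using \<delta>(2) by auto
    note s = smooth_on_slice[OF opn F t]
    show "?q t integrable_on cbox a b"
      unfolding power2_eq_square
      by (rule integrable_smooth[OF _ box]) (intro smooth_on_mult smooth_on_diff smooth_on_inner smooth_dens
        smooth_lap smooth_grad_inner s opn)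
  next
    have "smooth_on (\<lambda>z. dens G (snd z) * ((2 *\<^sub>R (lap G (\<lambda>y. F (fst z, y)) (snd z) \<bullet> lap G (\<lambda>y. tder F (fst z, y)) (snd z))) -
        4 *\<^sub>R (grad_inner G (\<lambda>y. F (fst z, y)) (\<lambda>y. F (fst z, y)) (snd z) *
          grad_inner G (\<lambda>y. tder F (fst z, y)) (\<lambda>y. F (fst z, y)) (snd z)))) (I \<times> X)"
      by (intro smooth_on_mult[OF o] smooth_on_diff[OF o] smooth_on_scaleR[OF o smooth_on_const] smooth_on_inner[OF o]
        smooth_lap_time smooth_grad_inner_time I F smooth_on_tder smooth_on_snd_compose opn smooth_dens)
    from continuous_on_subset[OF smooth_on_continuous[OF this], of "?U \<times> cbox a b"]
    show "continuous_on (?U \<times> cbox a b) (\<lambda>(t, y). ?dq t y)"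
      using \<delta>(2) box by (auto simp: split_def mult.assoc)
  qed (use \<delta>(1) in auto)
  then show ?thesis using at_within_open[of 0 ?U] \<delta>(1) by simp
qed

end

section \<open>Normalisation onto the unit sphere\<close>

text \<open>The radial projection v / |v|, written as a real power of \<open>v \<bullet> v\<close>
  so that its smoothness follows from that of \<open>powr\<close>.\<close>

definition sphere_retract :: "'b::real_inner \<Rightarrow> 'b" where
  "sphere_retract v = (v \<bullet> v) powr (- 1 / 2) *\<^sub>R v"

lemma norm_sphere_retract:
  assumes "v \<noteq> 0"
  shows "norm (sphere_retract v) = 1"
proof -
  have "(v \<bullet> v) powr (- 1 / 2) = inverse (norm v)"
    using assms by (simp add: powr_minus powr_half_sqrt norm_eq_sqrt_inner)
  then show ?thesis using assms by (simp add: sphere_retract_def)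
qed

lemma sphere_retract_unit: "v \<bullet> v = 1 \<Longrightarrow> sphere_retract v = v"
  by (simp add: sphere_retract_def)

lemma smooth_on_sphere_retract:
  fixes f :: "'a::euclidean_space \<Rightarrow> 'b::euclidean_space"
  assumes "open S" "smooth_on f S" "\<And>x. x \<in> S \<Longrightarrow> f x \<noteq> 0"
  shows "smooth_on (\<lambda>x. sphere_retract (f x)) S"
  unfolding sphere_retract_def
  by (intro smooth_on_scaleR smooth_on_powr smooth_on_inner assms) (use assms(3) in auto)

text \<open>At a unit vector v the derivative of s = |v + t w|^2 is 2 w . v, and that of s^(-1/2) is
  therefore - w . v: the radial projection differentiates to the tangential projection.\<close>

lemma sphere_retract_has_vector_derivative:
  fixes v w :: "'b::real_inner"
  assumes "v \<bullet> v = 1"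
  shows "((\<lambda>t. sphere_retract (v + t *\<^sub>R w)) has_vector_derivative (w - (w \<bullet> v) *\<^sub>R v)) (at 0)"
proof -
  let ?s = "\<lambda>t. (v + t *\<^sub>R w) \<bullet> (v + t *\<^sub>R w)"
  have l: "((\<lambda>t. v + t *\<^sub>R w) has_vector_derivative w) (at 0)"
    by (auto intro!: derivative_eq_intros)
  have "(?s has_real_derivative 2 * (w \<bullet> v)) (at 0)"
    using bounded_bilinear.has_vector_derivative[OF bounded_bilinear_inner l l]
    by (simp add: has_real_derivative_iff_has_vector_derivative inner_commute)
  from DERIV_chain2[OF has_real_derivative_powr[of "?s 0" "- 1 / 2"] this]
  have "((\<lambda>t. ?s t powr (- 1 / 2)) has_real_derivative - (w \<bullet> v)) (at 0)"
    using assms by simp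
  then have "((\<lambda>t. ?s t powr (- 1 / 2)) has_vector_derivative - (w \<bullet> v)) (at 0)"
    by (simp add: has_real_derivative_iff_has_vector_derivative)
  from bounded_bilinear.has_vector_derivative[OF bounded_bilinear_scaleR this l]
  show ?thesis using assms by (simp add: sphere_retract_def)
qed

section \<open>Variations of the bienergy supported in a chart box\<close>

context riemannian begin

text \<open>\<open>norm_tension\<close> expresses the integrand through functions that are smooth in
  the chart; this also supplies the continuity under which the volume integral becomes an integral
  over the box.\<close>

lemma bienergy_box:
  assumes c: "c \<in> \<A>" and box: "cbox a b \<subseteq> cod c" and f: "smooth_sphere_map \<A> f"
  shows "bienergy \<A> g (chart_inv c ` cbox a b) f = 1 / 2 * integral (cbox a b) (\<lambda>y. dens (loc_metric c) y *
    (lap (loc_metric c) (f \<circ> chart_inv c) y \<bullet> lap (loc_metric c) (f \<circ> chart_inv c) y -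
      (grad_inner (loc_metric c) (f \<circ> chart_inv c) (f \<circ> chart_inv c) y)\<^sup>2))"
proof -
  interpret sphere_map "loc_metric c" "cod c" "f \<circ> chart_inv c" by (rule sphere_map_chart[OF c f])
  let ?G = "loc_metric c" and ?u = "f \<circ> chart_inv c"
  have t: "(norm (tension_field \<A> g f (chart_inv c y)))\<^sup>2 = lap ?G ?u y \<bullet> lap ?G ?u y - (grad_inner ?G ?u ?u y)\<^sup>2"
    if y: "y \<in> cod c" for y
    using norm_tension[OF y] tension_field_chart[OF c chart_inv_dom[OF c y] f] by (simp add: chart_chart_inv[OF c y])
  have "smooth_on (\<lambda>y. lap ?G ?u y \<bullet> lap ?G ?u y - grad_inner ?G ?u ?u y * grad_inner ?G ?u ?u y) (cod c)"
    by (intro smooth_on_diff smooth_on_mult smooth_on_inner smooth_lap smooth_grad_inner smu opn)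
  then have "continuous_on (cod c) ((\<lambda>p. (norm (tension_field \<A> g f p))\<^sup>2) \<circ> chart_inv c)"
    by (rule continuous_on_eq[OF smooth_on_continuous]) (simp add: t power2_eq_square[symmetric])
  then have "bienergy \<A> g (chart_inv c ` cbox a b) f =
      1 / 2 * integral (cbox a b) (\<lambda>y. dens ?G y * (norm (tension_field \<A> g f (chart_inv c y)))\<^sup>2)"
    unfolding bienergy_def by (simp add: integral_volume_box[OF c box])
  also have "integral (cbox a b) (\<lambda>y. dens ?G y * (norm (tension_field \<A> g f (chart_inv c y)))\<^sup>2) =
      integral (cbox a b) (\<lambda>y. dens ?G y * (lap ?G ?u y \<bullet> lap ?G ?u y - (grad_inner ?G ?u ?u y)\<^sup>2))"
    by (rule Henstock_Kurzweil_Integration.integral_cong) (use t box in auto)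
  finally show ?thesis .
qed

text \<open>Near a point of the domain of \<open>c\<close> the function is \<eta> composed with a
  coordinate change. Any other point has a neighbourhood off the image of the box on which the
  function is zero, because that compact image is closed in the Hausdorff space.\<close>

lemma extended_bump_smooth:
  assumes c: "c \<in> \<A>" and d: "d \<in> \<A>" and box: "cbox a b \<subseteq> cod c" and \<eta>: "smooth_on \<eta> UNIV"
    and zero: "\<And>y. y \<notin> cbox a b \<Longrightarrow> \<eta> y = 0"
  shows "smooth_on ((\<lambda>p. if p \<in> fst c then \<eta> (snd c p) else 0 :: real) \<circ> chart_inv d) (cod d)"
    (is "smooth_on (?h \<circ> _) _")
proof (rule smooth_on_local)
  let ?K = "chart_inv c ` cbox a b"
  fix y assume y: "y \<in> cod d"
  show "\<exists>T. open T \<and> y \<in> T \<and> smooth_on (?h \<circ> chart_inv d) T"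
  proof (cases "chart_inv d y \<in> fst c")
    case True
    let ?W = "snd d ` (fst d \<inter> fst c)"
    interpret metric_change "loc_metric d" "loc_metric c" ?W "cod c" "snd c \<circ> chart_inv d"
      by (rule transition[OF d c])
    have "smooth_on (\<lambda>z. \<eta> ((snd c \<circ> chart_inv d) z)) ?W"
      by (rule smooth_T_compose[OF smooth_on_subset[OF \<eta>]]) simp
    then have "smooth_on (?h \<circ> chart_inv d) ?W"
      by (rule smooth_on_cong[OF A.opn, rotated]) (auto simp: chart_inv_chart[OF d])
    moreover have "y \<in> ?W"
      using True chart_inv_dom[OF d y] chart_chart_inv[OF d y] by (auto intro!: image_eqI[of _ _ "chart_inv d y"])
    ultimately show ?thesis using A.opn by blast
  next
    case False
    let ?W = "snd d ` (fst d - ?K)"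
    have "closed ?K"
      by (intro compact_imp_closed compact_continuous_image continuous_on_subset[OF continuous_chart_inv[OF c] box] compact_cbox)
    then have o: "open ?W" by (intro open_chart_image[OF d] open_Diff open_dom[OF d]) auto
    have "?h p = 0" if "p \<notin> ?K" for p
    proof (cases "p \<in> fst c")
      case True
      then have "snd c p \<notin> cbox a b" using that chart_inv_chart[OF c True] by (metis imageI)
      then show ?thesis by (simp add: zero)
    qed simp
    then have "0 = (?h \<circ> chart_inv d) z" if "z \<in> ?W" for z
      using that chart_inv_chart[OF d] by force
    then have "smooth_on (?h \<circ> chart_inv d) ?W"
      by (rule smooth_on_cong[OF o _ smooth_on_const])
    moreover have "chart_inv d y \<notin> ?K" using False chart_inv_dom[OF c] box by auto
    then have "y \<in> ?W"
      using chart_inv_dom[OF d y] chart_chart_inv[OF d y] by (auto intro!: image_eqI[of _ _ "chart_inv d y"])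
    ultimately show ?thesis using o by blast
  qed
qed

text \<open>Normalising requires phi + t h w to be nonzero. As |phi| = 1 and |h| is at most 1, the
  choice of \<epsilon> makes the perturbation shorter than 1; the summand 1 in the denominator
  admits w = 0.\<close>

lemma variation_in_direction:
  fixes w :: "real ^ 'k" and \<phi> :: "'a \<Rightarrow> real ^ 'k"
  assumes c: "c \<in> \<A>" and box: "cbox a b \<subseteq> cod c" and \<eta>: "smooth_on \<eta> UNIV" "\<And>y. \<bar>\<eta> y\<bar> \<le> 1"
    and zero: "\<And>y. y \<notin> cbox a b \<Longrightarrow> \<eta> y = 0" and \<phi>: "smooth_sphere_map \<A> \<phi>"
  defines "h \<equiv> \<lambda>p. if p \<in> fst c then \<eta> (snd c p) else 0"
  defines "\<epsilon> \<equiv> 1 / (norm w + 1)"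
  shows "compactly_supported_variation \<A> \<phi> \<epsilon> (chart_inv c ` cbox a b) (\<lambda>t p. sphere_retract (\<phi> p + t *\<^sub>R (h p *\<^sub>R w)))"
    and "\<And>t d. d \<in> \<A> \<Longrightarrow> smooth_on (\<lambda>z. sphere_retract (\<phi> (chart_inv d (snd z)) + fst z *\<^sub>R (h (chart_inv d (snd z)) *\<^sub>R w)))
      ({-\<epsilon><..<\<epsilon>} \<times> cod d)"
proof -
  let ?K = "chart_inv c ` cbox a b" and ?I = "{-\<epsilon><..<\<epsilon>}"
  let ?\<Phi> = "\<lambda>t p. sphere_retract (\<phi> p + t *\<^sub>R (h p *\<^sub>R w))"
  have u: "norm (\<phi> p) = 1" for p
  proof -
    have "\<phi> p \<in> sphere 0 1" using \<phi> unfolding smooth_sphere_map_def by blast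
    then show ?thesis by simp
  qed
  have nz: "\<phi> p + t *\<^sub>R (h p *\<^sub>R w) \<noteq> 0" if "t \<in> ?I" for t p
  proof
    assume "\<phi> p + t *\<^sub>R (h p *\<^sub>R w) = 0"
    then have "\<phi> p = - (t *\<^sub>R (h p *\<^sub>R w))" by (simp add: eq_neg_iff_add_eq_0)
    then have "1 = \<bar>t\<bar> * (\<bar>h p\<bar> * norm w)" using u[of p] by (simp add: abs_mult mult.assoc)
    moreover have "\<bar>h p\<bar> * norm w \<le> norm w"
      using \<eta>(2) by (intro mult_left_le_one_le) (auto simp: h_def)
    then have "\<bar>t\<bar> * (\<bar>h p\<bar> * norm w) \<le> \<epsilon> * norm w"
      using that by (intro mult_mono) auto
    moreover have "\<epsilon> * norm w < 1" by (simp add: \<epsilon>_def divide_simps add_nonneg_pos)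
    ultimately show False by simp
  qed
  show sm: "smooth_on (\<lambda>z. ?\<Phi> (fst z) (chart_inv d (snd z))) (?I \<times> cod d)" if d: "d \<in> \<A>" for d
  proof -
    have o: "open (?I \<times> cod d)" by (intro open_Times open_cod[OF d]) auto
    have "smooth_on (\<phi> \<circ> chart_inv d) (cod d)" using \<phi> d by (simp add: smooth_sphere_map_def smooth_map_chart)
    then have 1: "smooth_on (\<lambda>z. \<phi> (chart_inv d (snd z))) (?I \<times> cod d)"
      using smooth_on_snd_compose[OF _ open_cod[OF d], of ?I] by (simp add: o_def)
    have "smooth_on (h \<circ> chart_inv d) (cod d)"
      unfolding h_def by (rule extended_bump_smooth[OF c d box \<eta>(1) zero])
    then have 2: "smooth_on (\<lambda>z. h (chart_inv d (snd z))) (?I \<times> cod d)"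
      using smooth_on_snd_compose[OF _ open_cod[OF d], of ?I] by (simp add: o_def)
    show ?thesis
    proof (rule smooth_on_sphere_retract[OF o])
      show "smooth_on (\<lambda>z. \<phi> (chart_inv d (snd z)) + fst z *\<^sub>R (h (chart_inv d (snd z)) *\<^sub>R w)) (?I \<times> cod d)"
        by (intro smooth_on_add smooth_on_scaleR o 1 2 smooth_on_fst smooth_on_const)
    qed (intro nz, auto)
  qed
  have h0: "h p = 0" if "p \<notin> ?K" for p
  proof (cases "p \<in> fst c")
    case True
    then have "snd c p \<notin> cbox a b" using that chart_inv_chart[OF c True] by (metis imageI)
    then show ?thesis by (simp add: zero h_def)
  qed (simp add: h_def)
  have nu: "sphere_retract (\<phi> p) = \<phi> p" for p by (rule sphere_retract_unit) (simp add: u flip: norm_eq_1)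
  show "compactly_supported_variation \<A> \<phi> \<epsilon> ?K ?\<Phi>"
    unfolding compactly_supported_variation_def
  proof (intro conjI ballI allI impI)
    show "compact ?K"
      by (intro compact_continuous_image continuous_on_subset[OF continuous_chart_inv[OF c] box] compact_cbox)
    show "smooth_on (\<lambda>(t, y). ?\<Phi> t (chart_inv d y)) (?I \<times> snd d ` fst d)" if "d \<in> \<A>" for d
      using sm[OF that] by (simp add: split_def cod_def)
    show "range (?\<Phi> t) \<subseteq> sphere 0 1" if "t \<in> ?I" for t
      using norm_sphere_retract[OF nz[OF that]] by auto
    show "?\<Phi> 0 = \<phi>" by (simp add: nu)
    show "?\<Phi> t p = \<phi> p" if "p \<notin> ?K" for t p by (simp add: nu h0[OF that])
  qed
qed

text \<open>For all small t the bienergy of the varied map is half the integral treated in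
  \<open>first_variation\<close>; uniqueness of derivatives makes the derivative of that integral
  vanish. The velocity at t = 0 is the tangential part of \<eta> w.\<close>

lemma biharmonic_first_variation:
  fixes \<phi> :: "'a \<Rightarrow> real ^ 'k" and w :: "real ^ 'k"
  assumes c: "c \<in> \<A>" and box: "cbox a b \<subseteq> cod c" and \<eta>: "smooth_on \<eta> UNIV" "\<And>y. \<bar>\<eta> y\<bar> \<le> 1"
    and zero: "\<And>y. y \<notin> cbox a b \<Longrightarrow> \<eta> y = 0" and bi: "biharmonic \<A> g \<phi>"
  defines "u \<equiv> \<phi> \<circ> chart_inv c"
  defines "V \<equiv> \<lambda>y. \<eta> y *\<^sub>R (w - (w \<bullet> u y) *\<^sub>R u y)"
  shows "integral (cbox a b) (\<lambda>y. dens (loc_metric c) y * (2 * (lap (loc_metric c) u y \<bullet> lap (loc_metric c) V y) -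
    4 * grad_inner (loc_metric c) u u y * grad_inner (loc_metric c) V u y)) = 0"
proof -
  let ?G = "loc_metric c" and ?K = "chart_inv c ` cbox a b"
  define h where "h p = (if p \<in> fst c then \<eta> (snd c p) else 0)" for p
  define \<epsilon> where "\<epsilon> = 1 / (norm w + 1)"
  define \<Phi> where "\<Phi> t p = sphere_retract (\<phi> p + t *\<^sub>R (h p *\<^sub>R w))" for t p
  define F where "F z = \<Phi> (fst z) (chart_inv c (snd z))" for z
  let ?I = "{-\<epsilon><..<\<epsilon>}"
  have \<phi>: "smooth_sphere_map \<A> \<phi>" using bi by (simp add: biharmonic_def)
  interpret sphere_map ?G "cod c" u unfolding u_def by (rule sphere_map_chart[OF c \<phi>])
  have var: "compactly_supported_variation \<A> \<phi> \<epsilon> ?K \<Phi>"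
    unfolding \<Phi>_def[abs_def] h_def \<epsilon>_def by (rule variation_in_direction(1)[OF c box \<eta> zero \<phi>])
  have sm: "smooth_on (\<lambda>z. \<Phi> (fst z) (chart_inv d (snd z))) (?I \<times> cod d)" if "d \<in> \<A>" for d
    unfolding \<Phi>_def h_def \<epsilon>_def by (rule variation_in_direction(2)[OF c box \<eta> zero \<phi> that])
  have eps: "\<epsilon> > 0" by (simp add: \<epsilon>_def add_nonneg_pos)
  have sF: "smooth_on F (?I \<times> cod c)" unfolding F_def[abs_def] by (rule sm[OF c])
  have s\<Phi>: "smooth_sphere_map \<A> (\<Phi> t)" if t: "t \<in> ?I" for t
    unfolding smooth_sphere_map_def smooth_map_def
  proof (intro conjI ballI)
    show "smooth_on (\<Phi> t \<circ> chart_inv d) (snd d ` fst d)" if d: "d \<in> \<A>" for d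
      using smooth_on_slice[OF open_cod[OF d] sm[OF d] t] by (simp add: o_def cod_def)
    show "range (\<Phi> t) \<subseteq> sphere 0 1"
      using var t by (simp add: compactly_supported_variation_def)
  qed
  let ?E = "\<lambda>t. integral (cbox a b) (\<lambda>y. dens ?G y *
      (lap ?G (\<lambda>y. F (t, y)) y \<bullet> lap ?G (\<lambda>y. F (t, y)) y - (grad_inner ?G (\<lambda>y. F (t, y)) (\<lambda>y. F (t, y)) y)\<^sup>2))"
  have bE: "bienergy \<A> g ?K (\<Phi> t) = 1 / 2 * ?E t" if "t \<in> ?I" for t
    using bienergy_box[OF c box s\<Phi>[OF that]] by (simp add: F_def o_def)
  have "((\<lambda>t. bienergy \<A> g ?K (\<Phi> t)) has_real_derivative 0) (at 0)"
    using bi var eps unfolding biharmonic_def by blast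
  then have "((\<lambda>t. 1 / 2 * ?E t) has_real_derivative 0) (at 0)"
    by (rule has_field_derivative_transform_within_open[of _ _ _ ?I]) (use eps bE in auto)
  moreover have "((\<lambda>t. 1 / 2 * ?E t) has_real_derivative 1 / 2 * integral (cbox a b) (\<lambda>y. dens ?G y *
      (2 * (lap ?G (\<lambda>y. F (0, y)) y \<bullet> lap ?G (\<lambda>y. tder F (0, y)) y) -
       4 * grad_inner ?G (\<lambda>y. F (0, y)) (\<lambda>y. F (0, y)) y * grad_inner ?G (\<lambda>y. tder F (0, y)) (\<lambda>y. F (0, y)) y))) (at 0)"
    by (rule DERIV_cmult[OF first_variation[OF _ _ sF box]]) (use eps in auto)
  ultimately have 0: "integral (cbox a b) (\<lambda>y. dens ?G y *
      (2 * (lap ?G (\<lambda>y. F (0, y)) y \<bullet> lap ?G (\<lambda>y. tder F (0, y)) y) -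
       4 * grad_inner ?G (\<lambda>y. F (0, y)) (\<lambda>y. F (0, y)) y * grad_inner ?G (\<lambda>y. tder F (0, y)) (\<lambda>y. F (0, y)) y)) = 0"
    by (auto dest: DERIV_unique)
  have F0: "(\<lambda>y. F (0, y)) = u"
    using var by (auto simp: F_def u_def compactly_supported_variation_def)
  have T0: "tder F (0, y) = V y" if y: "y \<in> cod c" for y
  proof -
    have "((\<lambda>t. F (t, y)) has_vector_derivative tder F (0, y)) (at 0)"
      by (rule has_vector_derivative_tder[OF sF]) (use eps y in auto)
    moreover have "(\<lambda>t. F (t, y)) = (\<lambda>t. sphere_retract (u y + t *\<^sub>R (\<eta> y *\<^sub>R w)))"
      by (simp add: F_def \<Phi>_def h_def u_def chart_inv_dom[OF c y] chart_chart_inv[OF c y])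
    moreover have "((\<lambda>t. sphere_retract (u y + t *\<^sub>R (\<eta> y *\<^sub>R w))) has_vector_derivative
        (\<eta> y *\<^sub>R w - ((\<eta> y *\<^sub>R w) \<bullet> u y) *\<^sub>R u y)) (at 0)"
      by (rule sphere_retract_has_vector_derivative[OF unit[OF y]])
    ultimately show ?thesis
      unfolding V_def by (auto dest: vector_derivative_unique_at simp: scaleR_diff_right)
  qed
  have sT: "smooth_on (\<lambda>y. tder F (0, y)) (cod c)"
    by (rule smooth_on_slice[OF opn smooth_on_tder[OF sF]]) (use eps in auto)
  \<comment> \<open>The velocity is identified on the open set \<open>cod c\<close> only, which
    suffices for its derivatives there.\<close>
  have eq1: "lap ?G (\<lambda>y. tder F (0, y)) y = lap ?G V y" if "y \<in> cod c" for y
    by (rule lap_cong[OF opn that T0 sT])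
  have eq2: "grad_inner ?G (\<lambda>y. tder F (0, y)) u y = grad_inner ?G V u y" if "y \<in> cod c" for y
    by (rule grad_inner_cong[OF opn that T0 refl sT smu])
  show ?thesis
    by (rule trans[OF _ 0[unfolded F0]], rule Henstock_Kurzweil_Integration.integral_cong)
      (use eq1 eq2 box in auto)
qed

section \<open>The weak equation for the tension field and its localisation\<close>

lemma tension_weak:
  fixes \<phi> :: "'a \<Rightarrow> real ^ 'k" and w :: "real ^ 'k"
  assumes c: "c \<in> \<A>" and C: "closed C" "C \<subseteq> cbox a b" "cbox a b \<subseteq> cod c"
    and \<eta>: "smooth_on \<eta> UNIV" "\<And>y. \<bar>\<eta> y\<bar> \<le> 1" and zero: "\<And>y. y \<notin> C \<Longrightarrow> \<eta> y = 0"
    and bi: "biharmonic \<A> g \<phi>"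
    and e: "\<And>y. y \<in> cod c \<Longrightarrow> grad_inner (loc_metric c) (\<phi> \<circ> chart_inv c) (\<phi> \<circ> chart_inv c) y = e"
    and bilap: "\<And>y. y \<in> cod c \<Longrightarrow>
      lap (loc_metric c) (lap (loc_metric c) (\<phi> \<circ> chart_inv c)) y = l y *\<^sub>R (\<phi> \<circ> chart_inv c) y"
  shows "e * integral (cbox a b) (\<lambda>y. dens (loc_metric c) y *
    (\<eta> y * (w \<bullet> sphere_map.tension (loc_metric c) (\<phi> \<circ> chart_inv c) y))) = 0"
proof -
  let ?G = "loc_metric c" and ?u = "\<phi> \<circ> chart_inv c"
  have \<phi>: "smooth_sphere_map \<A> \<phi>" using bi by (simp add: biharmonic_def)
  interpret sphere_map ?G "cod c" ?u by (rule sphere_map_chart[OF c \<phi>])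
  define V where "V y = \<eta> y *\<^sub>R (w - (w \<bullet> ?u y) *\<^sub>R ?u y)" for y
  have sV: "smooth_on V (cod c)"
    unfolding V_def[abs_def]
    by (intro smooth_on_scaleR smooth_on_diff smooth_on_inner smooth_on_const smu opn smooth_on_subset[OF \<eta>(1)]) simp
  have V0: "\<forall>y\<in>cod c - C. V y = 0" using zero by (simp add: V_def)
  have Vu: "V y \<bullet> ?u y = 0" if "y \<in> cod c" for y
    using unit[OF that] by (simp add: V_def inner_diff_left)
  \<comment> \<open>The test field is orthogonal to u, so the Laplacian may be replaced by the
    tension; the tension is tangential, so the normal part subtracted from w may be dropped.\<close>
  have Vlap: "V y \<bullet> lap ?G ?u y = \<eta> y * (w \<bullet> tension y)" if y: "y \<in> cod c" for y
  proof -
    have "lap ?G ?u y = tension y - e *\<^sub>R ?u y" by (simp add: tension_def e[OF y])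
    then have "V y \<bullet> lap ?G ?u y = V y \<bullet> tension y" using Vu[OF y] by (simp add: inner_diff_right)
    also have "\<dots> = \<eta> y * (w \<bullet> tension y)"
      using inner_tension[OF y] unfolding inner_commute[of "tension y"] by (simp add: V_def inner_diff_left)
    finally show ?thesis .
  qed
  let ?J = "\<lambda>f. integral (cbox a b) (\<lambda>y. dens ?G y * f y)"
  have "?J (\<lambda>y. lap ?G ?u y \<bullet> lap ?G V y) = ?J (\<lambda>y. V y \<bullet> lap ?G (lap ?G ?u) y)"
    by (rule lap_self_adjoint[OF sV smooth_lap[OF smu] C V0, symmetric])
  also have "\<dots> = ?J (\<lambda>y. 0)"
    by (rule Henstock_Kurzweil_Integration.integral_cong) (use C(3) bilap Vu in \<open>auto simp: subset_iff\<close>)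
  finally have 1: "?J (\<lambda>y. lap ?G ?u y \<bullet> lap ?G V y) = 0" by simp
  have "?J (\<lambda>y. V y \<bullet> lap ?G ?u y) = ?J (\<lambda>y. \<eta> y * (w \<bullet> tension y))"
    by (rule Henstock_Kurzweil_Integration.integral_cong) (use C(3) Vlap in auto)
  then have 2: "?J (grad_inner ?G V ?u) = - ?J (\<lambda>y. \<eta> y * (w \<bullet> tension y))"
    using green[OF sV smu C disjI1[OF V0]] by simp
  have zero': "\<eta> y = 0" if "y \<notin> cbox a b" for y using that C(2) zero by auto
  \<comment> \<open>With J the integral of \<eta> <w, tau>, fact \<open>1\<close> removes the first
    term and fact \<open>2\<close> turns the second into 4 e J.\<close>
  have "0 = ?J (\<lambda>y. 2 * (lap ?G ?u y \<bullet> lap ?G V y) - 4 * grad_inner ?G ?u ?u y * grad_inner ?G V ?u y)"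
    using biharmonic_first_variation[OF c C(3) \<eta> zero' bi, of w] by (simp add: V_def[abs_def])
  also have "\<dots> = integral (cbox a b) (\<lambda>y. 2 *\<^sub>R (dens ?G y * (lap ?G ?u y \<bullet> lap ?G V y)) -
      (4 * e) *\<^sub>R (dens ?G y * grad_inner ?G V ?u y))"
    by (rule Henstock_Kurzweil_Integration.integral_cong) (use C(3) e in \<open>auto simp: subset_iff algebra_simps\<close>)
  also have "\<dots> = 2 *\<^sub>R ?J (\<lambda>y. lap ?G ?u y \<bullet> lap ?G V y) - (4 * e) *\<^sub>R ?J (grad_inner ?G V ?u)"
  proof -
    have i1: "(\<lambda>y. dens ?G y * (lap ?G ?u y \<bullet> lap ?G V y)) integrable_on cbox a b"
      by (rule integrable_smooth[OF _ C(3)]) (intro smooth_on_mult smooth_on_inner opn sV smu smooth_lap smooth_dens)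
    have i2: "(\<lambda>y. dens ?G y * grad_inner ?G V ?u y) integrable_on cbox a b"
      by (rule integrable_smooth[OF _ C(3)]) (intro smooth_on_mult opn sV smu smooth_grad_inner smooth_dens)
    show ?thesis
      by (subst Henstock_Kurzweil_Integration.integral_diff) (auto intro!: integrable_cmul i1 i2 simp only: Henstock_Kurzweil_Integration.integral_cmul)
  qed
  finally show ?thesis using 1 2 by simp
qed

lemma tension_zero:
  fixes \<phi> :: "'a \<Rightarrow> real ^ 'k"
  assumes c: "c \<in> \<A>" and p: "p \<in> fst c" and bi: "biharmonic \<A> g \<phi>"
    and e: "\<And>y. y \<in> cod c \<Longrightarrow> grad_inner (loc_metric c) (\<phi> \<circ> chart_inv c) (\<phi> \<circ> chart_inv c) y = e"
    and bilap: "\<And>y. y \<in> cod c \<Longrightarrow>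
      lap (loc_metric c) (lap (loc_metric c) (\<phi> \<circ> chart_inv c)) y = l y *\<^sub>R (\<phi> \<circ> chart_inv c) y"
  shows "tension_field \<A> g \<phi> p = 0"
proof -
  let ?G = "loc_metric c" and ?u = "\<phi> \<circ> chart_inv c" and ?y = "snd c p"
  have \<phi>: "smooth_sphere_map \<A> \<phi>" using bi by (simp add: biharmonic_def)
  interpret sphere_map ?G "cod c" ?u by (rule sphere_map_chart[OF c \<phi>])
  have y: "?y \<in> cod c" by (rule chart_cod[OF p])
  have "tension ?y = 0"
  proof (cases "e = 0")
    case True
    have z: "partial i ?u z = 0" if "z \<in> cod c" for i z
      by (rule grad_inner_self[OF that]) (simp add: e[OF that] True)
    \<comment> \<open>The first derivatives vanish on all of \<open>cod c\<close>, not just at the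
      point, so the second derivatives vanish as well.\<close>
    have "partial i (partial j ?u) ?y = partial i (\<lambda>_. 0) ?y" for i j
      by (rule partial_cong[OF opn y z smooth_on_partial[OF smu]])
    then have "lap ?G ?u ?y = 0" by (simp add: lap_def z[OF y] partial_const)
    then show ?thesis by (simp add: tension_def e[OF y] True)
  next
    case False
    show ?thesis
    proof (rule ccontr)
      assume nz: "tension ?y \<noteq> 0"
      \<comment> \<open>With this test vector <w, tau> is positive at the point, hence on a ball
        around it by continuity.\<close>
      define w where "w = tension ?y"
      have st: "smooth_on tension (cod c)"
        unfolding tension_def[abs_def]
        by (intro smooth_on_add smooth_on_scaleR smooth_lap smooth_grad_inner smu opn)
      have ct: "continuous_on (cod c) (\<lambda>z. w \<bullet> tension z)"
        by (intro continuous_intros smooth_on_continuous[OF st])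
      have "open (cod c \<inter> (\<lambda>z. w \<bullet> tension z) -` {0<..})"
        by (rule continuous_open_preimage[OF ct opn]) simp
      moreover have "?y \<in> cod c \<inter> (\<lambda>z. w \<bullet> tension z) -` {0<..}" using y nz by (simp add: w_def)
      ultimately obtain r1 where r1: "r1 > 0" "ball ?y r1 \<subseteq> cod c \<inter> (\<lambda>z. w \<bullet> tension z) -` {0<..}"
        by (meson openE)
      obtain a b where ab: "cbox a b \<subseteq> cod c" "?y \<in> box a b" and "\<forall>i\<in>Basis. a \<bullet> i < b \<bullet> i"
        by (rule open_contains_cbox[OF opn y])
      obtain r2 where r2: "r2 > 0" "cball ?y r2 \<subseteq> box a b"
        using open_box[of a b] ab(2) open_contains_cball by blast
      \<comment> \<open>The support of the bump then lies in the box, and <w, tau> is positive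
        wherever the bump is.\<close>
      define r where "r = min r1 r2"
      have r: "r > 0" "cball ?y r \<subseteq> cbox a b" "ball ?y r \<subseteq> ball ?y r1"
        using r1 r2 box_subset_cbox[of a b] by (auto simp: r_def subset_iff)
      let ?\<eta> = "bump ?y r"
      have \<eta>0: "?\<eta> z = 0" if "z \<notin> ball ?y r" for z
        using bump_pos_iff[OF r(1), of ?y z] bump_nonneg[of ?y r z] that by linarith
      let ?f = "\<lambda>z. dens ?G z * (?\<eta> z * (w \<bullet> tension z))"
      have "e * integral (cbox a b) ?f = 0"
        by (rule tension_weak[OF c closed_cball r(2) ab(1) smooth_on_bump _ _ bi e bilap])
          (use \<eta>0 bump_nonneg[of ?y r] bump_le_1[of ?y r] in auto)
      then have i0: "integral (cbox a b) ?f = 0" using False by simp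
      have sf: "smooth_on ?f (cod c)"
        by (intro smooth_on_mult smooth_on_inner smooth_on_const st smooth_dens opn smooth_on_subset[OF smooth_on_bump]) simp
      \<comment> \<open>A continuous integrand that is nonnegative on the box and has integral zero
        vanishes, yet at the centre of the bump all three factors are positive.\<close>
      have "?f ?y = 0"
      proof (rule has_integral_0_cbox_imp_0[of a b ?f ?y])
        show "continuous_on (cbox a b) ?f"
          by (rule continuous_on_subset[OF smooth_on_continuous[OF sf] ab(1)])
        show "(?f has_integral 0) (cbox a b)"
          using integrable_integral[OF integrable_smooth[OF sf ab(1)]] by (simp only: i0)
        show "0 \<le> ?f z" if "z \<in> box a b" for z
        proof (cases "z \<in> ball ?y r")
          case True
          then have "z \<in> cod c \<inter> (\<lambda>z. w \<bullet> tension z) -` {0<..}" using r(3) r1(2) by blast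
          then have "w \<bullet> tension z > 0" "z \<in> cod c" by auto
          then show ?thesis using dens_pos[of z] bump_nonneg[of ?y r z] by simp
        qed (simp add: \<eta>0)
        show "box a b \<noteq> {}" "?y \<in> cbox a b" using ab(2) box_subset_cbox[of a b] by auto
      qed
      moreover have "?f ?y > 0"
        using dens_pos[OF y] bump_pos_iff[OF r(1), of ?y ?y] r(1) nz by (simp add: w_def)
      ultimately show False by linarith
    qed
  qed
  then show ?thesis by (simp add: tension_field_chart[OF c p \<phi>])
qed

end

theorem theorem3p2:
  fixes \<A> :: "('a::{t2_space, second_countable_topology}, 'm::finite) chart set"
    and g :: "('a, 'm) metric"
    and \<phi> :: "'a \<Rightarrow> real ^ 'k"
    and lam :: "'a \<Rightarrow> real"
  assumes "riemannian_manifold \<A> g"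
    and "biharmonic \<A> g \<phi>"
    and "energy_density \<A> g \<phi> constant_on UNIV"
    and "\<forall>p. vec_laplacian \<A> g (vec_laplacian \<A> g \<phi>) p = lam p *\<^sub>R \<phi> p"
  shows "harmonic \<A> g \<phi>"
proof -
  interpret riemannian \<A> g by (rule riemannian.intro[OF assms(1)])
  have \<phi>: "smooth_sphere_map \<A> \<phi>" using assms(2) by (simp add: biharmonic_def)
  then have sm: "smooth_map \<A> \<phi>" by (simp add: smooth_sphere_map_def)
  obtain e where e: "\<And>p. energy_density \<A> g \<phi> p = e" using assms(3) by (auto simp: constant_on_def)
  have "tension_field \<A> g \<phi> p = 0" for p
  proof -
    let ?c = "chart_at \<A> p"
    note c = chart_at[of p]
    show ?thesis
    \<comment> \<open>The chart selected at p is kept fixed for the whole local argument, and the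
      factor \<open>lam\<close> is read in its coordinates.\<close>
    proof (rule tension_zero[OF c assms(2), where e = e and l = "\<lambda>y. lam (chart_inv ?c y)"])
      fix y assume y: "y \<in> cod ?c"
      show "grad_inner (loc_metric ?c) (\<phi> \<circ> chart_inv ?c) (\<phi> \<circ> chart_inv ?c) y = e"
        using energy_density_chart[OF c(1) chart_inv_dom[OF c(1) y] sm] by (simp add: e chart_chart_inv[OF c(1) y])
      show "lap (loc_metric ?c) (lap (loc_metric ?c) (\<phi> \<circ> chart_inv ?c)) y =
          lam (chart_inv ?c y) *\<^sub>R (\<phi> \<circ> chart_inv ?c) y"
        using vec_bilaplacian_lap[OF c(1) sm y] assms(4) by simp
    qed
  qed
  with \<phi> show ?thesis by (simp add: harmonic_def)
qed

end
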